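(* Let $\mathbf f^n\in L^2(\Omega)^d$ and $g^n,p_0,\varphi_0\in L^2(\Omega)$ be given for each time instant $n\in\{1,\dots,N\}$, and assume that $V^\varphi_h=V^\lambda_h$. Then for each $n\in\{1,\dots,N\}$ there exists a unique $((\mathbf d^n_h,\mu^n_h,\varphi^n_h),\lambda^n_h)\in\mathbf V_h\times Q_h$ such that $$\langle\mathcal A(\mathbf d^n_h,\mu^n_h,\varphi^n_h),(\mathbf d^*_h,\mu^*_h,\varphi^*_h)\rangle+\langle\mathcal B(\mathbf d^*_h,\mu^*_h,\varphi^*_h),\lambda^n_h\rangle=(\mathbf f^n,\mathbf d_h^* )+\tau(g^n,\mu_h^* )-(p_0,\varphi_h^* )\quad\forall(\mathbf d_h^*,\mu_h^*,\varphi_h^* )\in\mathbf V_h,$$ $$\langle\mathcal B(\mathbf d_h^n,\mu_h^n,\varphi_h^n),\lambda_h^*\rangle=-(\varphi_0,\lambda_h^* )\quad\forall\lambda_h^*\in Q_h.$$ Moreover, there is a constant $C>0$, independent of the mesh size $h$ (i.e. of the discrete spaces) and of the physical constants $\rho_0,\tau,\mathbb C_{\mathrm{Hooke}},\beta,\mathbf K,M$ (and of the data), such that $$\|((\mathbf d^n_h,\mu^n_h,\varphi^n_h),\lambda^n_h)\|_{\mathbf V\times Q}\le C\max\left\{\frac1{\alpha_0},\frac{2\sqrt{\alpha_1}}{\sqrt{\alpha_0}},\alpha_1\right\}\left(\|\mathbf f^n\|_{0,\Omega}+\tau\|g^n\|_{0,\Omega}+\|p_0\|_{0,\Omega}+\|\varphi_0\|_{0,\Omega}\right),$$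 where $\alpha_0=\min\left\{\frac{\rho_0}{\tau^2},\mathbb C^{\min}_{\mathrm{Hooke}},2\beta,\tau\mathbf K^{\min},M\right\}$ and $\alpha_1=\max\left\{\frac{\rho_0}{\tau^2},\mathbb C^{\max}_{\mathrm{Hooke}},2\beta,\tau\mathbf K^{\max},M\right\}$.
   Context: $\Omega\subset\mathbb R^d$, $d\in\{2,3\}$, is a bounded domain with Lipschitz boundary; $(\cdot,\cdot)$ is the $L^2(\Omega)$ inner product (scalar, vector or tensor), $\|\cdot\|_{0,\Omega}$, $\|\cdot\|_{1,\Omega}$ are the $L^2(\Omega)$ and $H^1(\Omega)$ norms, and $\boldsymbol\varepsilon(\mathbf d)$ is the symmetric part of $\nabla\mathbf d$. Parameters: $\rho_0>0$ (density), $\tau>0$ (time step), $\beta>0$, $M\ge0$ are constants (if $M=0$, so that $\alpha_0=0$, the a priori bound is understood as trivial, with $1/\alpha_0=+\infty$). The permeability $\mathbf K$ is a symmetric $d\times d$ tensor (field) with $\mathbf K^{\min}|\boldsymbol\xi|^2\le\boldsymbol\xi^{t}\mathbf K\boldsymbol\xi\le\mathbf K^{\max}|\boldsymbol\xi|^2$ for all $\boldsymbol\xi\in\mathbb R^d$, where $0<\mathbf K^{\min}\le\mathbf K^{\max}<\infty$. The Hooke tensor $\mathbb C_{\mathrm{Hooke}}$ is a symmetric fourth-order tensor with $\mathbb C^{\min}_{\mathrm{Hooke}}|\boldsymbol\tau|^2\le\boldsymbol\tau:\mathbb C_{\mathrm{Hooke}}:\boldsymbol\tau\le\mathbb C^{\max}_{\mathrm{Hooke}}|\boldsymbol\tau|^2$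 for all symmetric $\boldsymbol\tau\in\mathbb R^{d\times d}$, where $0<\mathbb C^{\min}_{\mathrm{Hooke}}\le\mathbb C^{\max}_{\mathrm{Hooke}}<\infty$. Spaces: $\mathbf V:=H^1_0(\Omega)^d\times H^1_0(\Omega)\times L^2(\Omega)$ with $\|(\mathbf d,\mu,\varphi)\|_{\mathbf V}^2:=\|\mathbf d\|_{1,\Omega}^2+\|\mu\|_{1,\Omega}^2+\|\varphi\|_{0,\Omega}^2$; $Q:=L^2(\Omega)$ with norm $\|\cdot\|_{0,\Omega}$; $\mathbf V\times Q$ carries the product norm. The conforming discrete spaces are (finite-dimensional) subspaces $\mathbf V^{\mathbf d}_h\subset H^1_0(\Omega)^d$, $V^\mu_h\subset H^1_0(\Omega)$, $V^\varphi_h\subset L^2(\Omega)$, $V^\lambda_h\subset L^2(\Omega)$; $\mathbf V_h:=\mathbf V^{\mathbf d}_h\times V^\mu_h\times V^\varphi_h$ and $Q_h:=V^\lambda_h$. Operators: $\mathcal A:\mathbf V\to\mathbf V'$ is given by $$\langle\mathcal A(\mathbf d,\mu,\varphi),(\mathbf d^*,\mu^*,\varphi^* )\rangle:=\tfrac{\rho_0}{\tau^2}(\mathbf d,\mathbf d^* )+(\mathbb C_{\mathrm{Hooke}}:\boldsymbol\varepsilon(\mathbf d),\boldsymbol\varepsilon(\mathbf d^* ))+\beta(\varphi,\operatorname{div}\mathbf d^* )+\tau(\mathbf K\nabla\mu,\nabla\mu^* )+(\varphi,\mu^* )+\beta(\operatorname{div}\mathbf d,\varphi^* )-(\mu,\varphi^*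 )+M(\varphi,\varphi^* ),$$ and $\mathcal B:\mathbf V\to Q'$ by $\langle\mathcal B(\mathbf d,\mu,\varphi),\lambda^*\rangle:=(\lambda^*,\operatorname{div}\mathbf d)-(\varphi,\lambda^* )$. The data $\mathbf f^n,g^n$ at step $n$ are understood to already incorporate the known terms coming from the discretization of the time derivatives. *)

theory Defs
  imports "HOL-Analysis.Analysis"
begin

text \<open>
  Elements of the Lebesgue and Sobolev spaces are represented by functions on the whole of
  \<open>real ^ 'd\<close> of which only the values on \<open>\<Omega>\<close> matter; two representatives stand for the same
  element iff they agree almost everywhere on \<open>\<Omega>\<close>.
\<close>

definition ae_eq :: "(real ^ 'd) set \<Rightarrow> (real ^ 'd \<Rightarrow> 'b) \<Rightarrow> (real ^ 'd \<Rightarrow> 'b) \<Rightarrow> bool" where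
  "ae_eq \<Omega> u v \<longleftrightarrow> (AE x in lebesgue_on \<Omega>. u x = v x)"

text \<open>
  Near each boundary point, the set lies strictly on one side of the graph of a Lipschitz function
  over the hyperplane orthogonal to some unit vector \<open>e\<close>; \<open>x - (x \<bullet> e) *\<^sub>R e\<close> is the projection
  of \<open>x\<close> onto that hyperplane.
\<close>

definition lipschitz_boundary :: "(real ^ 'd) set \<Rightarrow> bool" where
  "lipschitz_boundary \<Omega> \<longleftrightarrow>
     (\<forall>p \<in> frontier \<Omega>. \<exists>U e \<gamma> L. open U \<and> p \<in> U \<and> norm e = 1 \<and>
        L-lipschitz_on {y. y \<bullet> e = 0} \<gamma> \<and>
        \<Omega> \<inter> U = {x \<in> U. x \<bullet> e > \<gamma> (x - (x \<bullet> e) *\<^sub>R e)})"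

definition bounded_lipschitz_domain :: "(real ^ 'd) set \<Rightarrow> bool" where
  "bounded_lipschitz_domain \<Omega> \<longleftrightarrow>
     open \<Omega> \<and> connected \<Omega> \<and> \<Omega> \<noteq> {} \<and> bounded \<Omega> \<and> lipschitz_boundary \<Omega>"

text \<open>
  For matrix-valued functions the inner product of \<open>real ^ 'd ^ 'd\<close> is the Frobenius product, so
  the following covers the scalar, the vector and the tensor case.
\<close>

definition L2 :: "(real ^ 'd) set \<Rightarrow> (real ^ 'd \<Rightarrow> 'b::euclidean_space) set" where
  "L2 \<Omega> = {u. u \<in> borel_measurable (lebesgue_on \<Omega>) \<and>
               integrable (lebesgue_on \<Omega>) (\<lambda>x. (norm (u x))\<^sup>2)}"

definition L2_inner ::
  "(real ^ 'd) set \<Rightarrow> (real ^ 'd \<Rightarrow> 'b::euclidean_space) \<Rightarrow> (real ^ 'd \<Rightarrow> 'b) \<Rightarrow> real" where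
  "L2_inner \<Omega> u v = (LINT x|lebesgue_on \<Omega>. u x \<bullet> v x)"

definition L2_norm :: "(real ^ 'd) set \<Rightarrow> (real ^ 'd \<Rightarrow> 'b::euclidean_space) \<Rightarrow> real" where
  "L2_norm \<Omega> u = sqrt (L2_inner \<Omega> u u)"

definition partial_deriv :: "'d \<Rightarrow> (real ^ 'd \<Rightarrow> real) \<Rightarrow> real ^ 'd \<Rightarrow> real" where
  "partial_deriv i f x = frechet_derivative f (at x) (axis i 1)"

primrec C_k :: "nat \<Rightarrow> (real ^ 'd \<Rightarrow> real) \<Rightarrow> bool" where
  "C_k 0 f \<longleftrightarrow> continuous_on UNIV f"
| "C_k (Suc k) f \<longleftrightarrow> (\<forall>x. f differentiable (at x)) \<and> (\<forall>i. C_k k (partial_deriv i f))"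

definition test_functions :: "(real ^ 'd) set \<Rightarrow> (real ^ 'd \<Rightarrow> real) set" where
  "test_functions \<Omega> =
     {\<psi>. (\<forall>k. C_k k \<psi>) \<and> compact (closure {x. \<psi> x \<noteq> 0}) \<and> closure {x. \<psi> x \<noteq> 0} \<subseteq> \<Omega>}"

definition weak_gradient ::
  "(real ^ 'd) set \<Rightarrow> (real ^ 'd \<Rightarrow> real) \<Rightarrow> (real ^ 'd \<Rightarrow> real ^ 'd) \<Rightarrow> bool" where
  "weak_gradient \<Omega> u G \<longleftrightarrow> G \<in> L2 \<Omega> \<and>
     (\<forall>\<psi> \<in> test_functions \<Omega>. \<forall>i.
        (LINT x|lebesgue_on \<Omega>. u x * partial_deriv i \<psi> x) =
        - (LINT x|lebesgue_on \<Omega>. G x $ i * \<psi> x))"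

definition H1 :: "(real ^ 'd) set \<Rightarrow> (real ^ 'd \<Rightarrow> real) set" where
  "H1 \<Omega> = {u \<in> L2 \<Omega>. \<exists>G. weak_gradient \<Omega> u G}"

text \<open>A representative of the weak gradient; meaningful for elements of \<^const>\<open>H1\<close> only.\<close>

definition grad :: "(real ^ 'd) set \<Rightarrow> (real ^ 'd \<Rightarrow> real) \<Rightarrow> real ^ 'd \<Rightarrow> real ^ 'd" where
  "grad \<Omega> u = (SOME G. weak_gradient \<Omega> u G)"

definition H1_norm :: "(real ^ 'd) set \<Rightarrow> (real ^ 'd \<Rightarrow> real) \<Rightarrow> real" where
  "H1_norm \<Omega> u = sqrt ((L2_norm \<Omega> u)\<^sup>2 + (L2_norm \<Omega> (grad \<Omega> u))\<^sup>2)"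

definition H10 :: "(real ^ 'd) set \<Rightarrow> (real ^ 'd \<Rightarrow> real) set" where
  "H10 \<Omega> = {u \<in> H1 \<Omega>. \<forall>e>0. \<exists>\<psi> \<in> test_functions \<Omega>. H1_norm \<Omega> (\<lambda>x. u x - \<psi> x) < e}"

definition H10_vec :: "(real ^ 'd) set \<Rightarrow> (real ^ 'd \<Rightarrow> real ^ 'd) set" where
  "H10_vec \<Omega> = {d. \<forall>i. (\<lambda>x. d x $ i) \<in> H10 \<Omega>}"

definition grad_vec ::
  "(real ^ 'd) set \<Rightarrow> (real ^ 'd \<Rightarrow> real ^ 'd) \<Rightarrow> real ^ 'd \<Rightarrow> real ^ 'd ^ 'd" where
  "grad_vec \<Omega> d x = (\<chi> i. grad \<Omega> (\<lambda>y. d y $ i) x)"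

definition H1_norm_vec :: "(real ^ 'd) set \<Rightarrow> (real ^ 'd \<Rightarrow> real ^ 'd) \<Rightarrow> real" where
  "H1_norm_vec \<Omega> d = sqrt ((L2_norm \<Omega> d)\<^sup>2 + (L2_norm \<Omega> (grad_vec \<Omega> d))\<^sup>2)"

definition sym_grad ::
  "(real ^ 'd) set \<Rightarrow> (real ^ 'd \<Rightarrow> real ^ 'd) \<Rightarrow> real ^ 'd \<Rightarrow> real ^ 'd ^ 'd" where
  "sym_grad \<Omega> d x = (1 / 2) *\<^sub>R (grad_vec \<Omega> d x + transpose (grad_vec \<Omega> d x))"

definition divergence :: "(real ^ 'd) set \<Rightarrow> (real ^ 'd \<Rightarrow> real ^ 'd) \<Rightarrow> real ^ 'd \<Rightarrow> real" where
  "divergence \<Omega> d x = (\<Sum>i\<in>UNIV. grad_vec \<Omega> d x $ i $ i)"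

definition permeability ::
  "(real ^ 'd) set \<Rightarrow> (real ^ 'd \<Rightarrow> real ^ 'd ^ 'd) \<Rightarrow> real \<Rightarrow> real \<Rightarrow> bool" where
  "permeability \<Omega> K Kmin Kmax \<longleftrightarrow> 0 < Kmin \<and> Kmin \<le> Kmax \<and>
     K \<in> borel_measurable (lebesgue_on \<Omega>) \<and>
     (AE x in lebesgue_on \<Omega>. transpose (K x) = K x \<and>
        (\<forall>\<xi>. Kmin * (norm \<xi>)\<^sup>2 \<le> \<xi> \<bullet> (K x *v \<xi>) \<and> \<xi> \<bullet> (K x *v \<xi>) \<le> Kmax * (norm \<xi>)\<^sup>2))"

definition double_contraction ::
  "real ^ 'd ^ 'd ^ 'd ^ 'd \<Rightarrow> real ^ 'd ^ 'd \<Rightarrow> real ^ 'd ^ 'd" where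
  "double_contraction C T = (\<chi> i j. \<Sum>k\<in>UNIV. \<Sum>l\<in>UNIV. C $ i $ j $ k $ l * T $ k $ l)"

text \<open>
  Symmetry is the major symmetry, i.e. self-adjointness with respect to the Frobenius product.
  The minor symmetries of elasticity need not be imposed: the tensor is only ever contracted with
  symmetric matrices on both sides. As for the permeability, a constant tensor is a constant field.
\<close>

definition hooke_tensor ::
  "(real ^ 'd) set \<Rightarrow> (real ^ 'd \<Rightarrow> real ^ 'd ^ 'd ^ 'd ^ 'd) \<Rightarrow> real \<Rightarrow> real \<Rightarrow> bool" where
  "hooke_tensor \<Omega> C Cmin Cmax \<longleftrightarrow> 0 < Cmin \<and> Cmin \<le> Cmax \<and>
     C \<in> borel_measurable (lebesgue_on \<Omega>) \<and>
     (AE x in lebesgue_on \<Omega>. (\<forall>i j k l. C x $ i $ j $ k $ l = C x $ k $ l $ i $ j) \<and>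
        (\<forall>T. transpose T = T \<longrightarrow>
           Cmin * (norm T)\<^sup>2 \<le> T \<bullet> double_contraction (C x) T \<and>
           T \<bullet> double_contraction (C x) T \<le> Cmax * (norm T)\<^sup>2))"

text \<open>
  A finite-dimensional subspace of \<open>X\<close>. Linear combinations are taken pointwise on representatives,
  and finite-dimensionality is modulo equality almost everywhere; \<open>S\<close> may, but need not, contain
  all representatives of its elements.
\<close>

definition fin_dim_subspace ::
  "(real ^ 'd) set \<Rightarrow> (real ^ 'd \<Rightarrow> 'b::euclidean_space) set \<Rightarrow> (real ^ 'd \<Rightarrow> 'b) set \<Rightarrow> bool" where
  "fin_dim_subspace \<Omega> X S \<longleftrightarrow> S \<subseteq> X \<and>
     (\<lambda>x. 0) \<in> S \<and>
     (\<forall>u\<in>S. \<forall>v\<in>S. (\<lambda>x. u x + v x) \<in> S) \<and>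
     (\<forall>c. \<forall>u\<in>S. (\<lambda>x. c *\<^sub>R u x) \<in> S) \<and>
     (\<exists>B. finite B \<and> B \<subseteq> S \<and> (\<forall>u\<in>S. \<exists>c. ae_eq \<Omega> u (\<lambda>x. \<Sum>b\<in>B. c b *\<^sub>R b x)))"

type_synonym 'd triple =
  "(real ^ 'd \<Rightarrow> real ^ 'd) \<times> (real ^ 'd \<Rightarrow> real) \<times> (real ^ 'd \<Rightarrow> real)"

fun op_A ::
  "(real ^ 'd) set \<Rightarrow> real \<Rightarrow> real \<Rightarrow> (real ^ 'd \<Rightarrow> real ^ 'd ^ 'd ^ 'd ^ 'd) \<Rightarrow> real \<Rightarrow>
   (real ^ 'd \<Rightarrow> real ^ 'd ^ 'd) \<Rightarrow> real \<Rightarrow> 'd triple \<Rightarrow> 'd triple \<Rightarrow> real" where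
  "op_A \<Omega> \<rho>\<^sub>0 \<tau> C \<beta> K M (d, \<mu>, \<phi>) (d', \<mu>', \<phi>') =
     \<rho>\<^sub>0 / \<tau>\<^sup>2 * L2_inner \<Omega> d d'
     + L2_inner \<Omega> (\<lambda>x. double_contraction (C x) (sym_grad \<Omega> d x)) (sym_grad \<Omega> d')
     + \<beta> * L2_inner \<Omega> \<phi> (divergence \<Omega> d')
     + \<tau> * L2_inner \<Omega> (\<lambda>x. K x *v grad \<Omega> \<mu> x) (grad \<Omega> \<mu>')
     + L2_inner \<Omega> \<phi> \<mu>'
     + \<beta> * L2_inner \<Omega> (divergence \<Omega> d) \<phi>'
     - L2_inner \<Omega> \<mu> \<phi>'
     + M * L2_inner \<Omega> \<phi> \<phi>'"

fun op_B :: "(real ^ 'd) set \<Rightarrow> 'd triple \<Rightarrow> (real ^ 'd \<Rightarrow> real) \<Rightarrow> real" where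
  "op_B \<Omega> (d, \<mu>, \<phi>) l = L2_inner \<Omega> l (divergence \<Omega> d) - L2_inner \<Omega> \<phi> l"

fun V_norm :: "(real ^ 'd) set \<Rightarrow> 'd triple \<Rightarrow> real" where
  "V_norm \<Omega> (d, \<mu>, \<phi>) =
     sqrt ((H1_norm_vec \<Omega> d)\<^sup>2 + (H1_norm \<Omega> \<mu>)\<^sup>2 + (L2_norm \<Omega> \<phi>)\<^sup>2)"

fun VQ_norm :: "(real ^ 'd) set \<Rightarrow> 'd triple \<times> (real ^ 'd \<Rightarrow> real) \<Rightarrow> real" where
  "VQ_norm \<Omega> (v, l) = sqrt ((V_norm \<Omega> v)\<^sup>2 + (L2_norm \<Omega> l)\<^sup>2)"

fun VQ_eq ::
  "(real ^ 'd) set \<Rightarrow> 'd triple \<times> (real ^ 'd \<Rightarrow> real) \<Rightarrow>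
   'd triple \<times> (real ^ 'd \<Rightarrow> real) \<Rightarrow> bool" where
  "VQ_eq \<Omega> ((d, \<mu>, \<phi>), l) ((d', \<mu>', \<phi>'), l') \<longleftrightarrow>
     ae_eq \<Omega> d d' \<and> ae_eq \<Omega> \<mu> \<mu>' \<and> ae_eq \<Omega> \<phi> \<phi>' \<and> ae_eq \<Omega> l l'"

definition discrete_solution ::
  "(real ^ 'd) set \<Rightarrow> real \<Rightarrow> real \<Rightarrow> (real ^ 'd \<Rightarrow> real ^ 'd ^ 'd ^ 'd ^ 'd) \<Rightarrow> real \<Rightarrow>
   (real ^ 'd \<Rightarrow> real ^ 'd ^ 'd) \<Rightarrow> real \<Rightarrow>
   'd triple set \<Rightarrow> (real ^ 'd \<Rightarrow> real) set \<Rightarrow>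
   (real ^ 'd \<Rightarrow> real ^ 'd) \<Rightarrow> (real ^ 'd \<Rightarrow> real) \<Rightarrow> (real ^ 'd \<Rightarrow> real) \<Rightarrow> (real ^ 'd \<Rightarrow> real) \<Rightarrow>
   'd triple \<times> (real ^ 'd \<Rightarrow> real) \<Rightarrow> bool" where
  "discrete_solution \<Omega> \<rho>\<^sub>0 \<tau> C \<beta> K M Vh Qh f g p\<^sub>0 \<phi>\<^sub>0 s \<longleftrightarrow>
     s \<in> Vh \<times> Qh \<and>
     (\<forall>(d', \<mu>', \<phi>') \<in> Vh.
        op_A \<Omega> \<rho>\<^sub>0 \<tau> C \<beta> K M (fst s) (d', \<mu>', \<phi>') + op_B \<Omega> (d', \<mu>', \<phi>') (snd s) =
        L2_inner \<Omega> f d' + \<tau> * L2_inner \<Omega> g \<mu>' - L2_inner \<Omega> p\<^sub>0 \<phi>') \<and>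
     (\<forall>l' \<in> Qh. op_B \<Omega> (fst s) l' = - L2_inner \<Omega> \<phi>\<^sub>0 l')"

definition alpha0 :: "real \<Rightarrow> real \<Rightarrow> real \<Rightarrow> real \<Rightarrow> real \<Rightarrow> real \<Rightarrow> real" where
  "alpha0 \<rho>\<^sub>0 \<tau> Cmin \<beta> Kmin M = Min {\<rho>\<^sub>0 / \<tau>\<^sup>2, Cmin, 2 * \<beta>, \<tau> * Kmin, M}"

definition alpha1 :: "real \<Rightarrow> real \<Rightarrow> real \<Rightarrow> real \<Rightarrow> real \<Rightarrow> real \<Rightarrow> real" where
  "alpha1 \<rho>\<^sub>0 \<tau> Cmax \<beta> Kmax M = Max {\<rho>\<^sub>0 / \<tau>\<^sup>2, Cmax, 2 * \<beta>, \<tau> * Kmax, M}"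

end

theory Submission
  imports Defs
begin

text \<open>
  The discrete problem is a saddle point problem for \<open>\<A>\<close> and \<open>\<B>\<close>, and both assertions rest on
  a few well-chosen test functions. Write \<open>(d, \<mu>, \<phi>)\<close> and \<open>l\<close> for the unknowns.

  \<^emph>\<open>Energy.\<close> In \<open>\<A>(v, v)\<close> the skew pair \<open>(\<phi>, \<mu>) - (\<mu>, \<phi>)\<close> cancels, and the only term without a sign is
  \<open>2 \<beta> (\<phi>, div d)\<close>. Because the multiplier space equals the space of \<open>\<phi>\<close>, the function \<open>\<phi>\<close> itself may
  be used as a test function in the constraint, which gives \<open>(\<phi>, div d) = (\<phi>, \<phi>) - (\<phi>\<^sub>0, \<phi>)\<close>. So up to data
  the form is bounded below by
  \<open>\<rho>\<^sub>0 / \<tau>\<^sup>2 |d|\<^sup>2 + Cmin |\<epsilon>(d)|\<^sup>2 + \<tau> Kmin |\<nabla> \<mu>|\<^sup>2 + (2 \<beta> + M) |\<phi>|\<^sup>2\<close>. The inequality of Korn (\<open>korn\<close>) and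
  that of Poincare (\<open>poincare\<close>) turn this into control of the full \<open>V\<close> norm, with constants that depend
  on the domain only.

  \<^emph>\<open>Multiplier.\<close> The triple \<open>(0, 0, l)\<close> is an admissible test function, again because the two spaces
  coincide. It expresses \<open>(l, l)\<close> through \<open>d, \<mu>, \<phi>\<close>, and after the constraint has been used once more,
  \<open>|l| \<le> (\<beta> + M) |\<phi>| + \<beta> |\<phi>\<^sub>0| + |\<mu>| + |p\<^sub>0|\<close>. This plays the part of an inf-sup condition with constant 1.

  \<^emph>\<open>A priori bound.\<close> Both estimates are combined by Young's inequality (\<open>a_priori_arithmetic\<close>). The term
  \<open>(\<beta> + M) |\<phi>|\<close> must not be estimated through \<open>\<alpha>\<^sub>0\<close>; it is controlled by the part \<open>(2 \<beta> + M) |\<phi>|\<^sup>2\<close>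
  of the energy, and this is where \<open>sqrt \<alpha>\<^sub>1 / sqrt \<alpha>\<^sub>0\<close> comes from. The coupling \<open>(\<phi>, \<mu>)\<close>, which has
  coefficient 1, enters only through the multiplier estimate, where it costs \<open>|\<mu>|\<close>, which the energy
  controls. Data terms without a parameter, such as \<open>|p\<^sub>0|\<close>, are absorbed because the maximum in the bound is
  at least 2.

  \<^emph>\<open>Existence and uniqueness.\<close> With zero data the same tests show that a solution vanishes almost
  everywhere (\<open>left_kernel\<close>), and that a test function annihilated by all trial functions vanishes
  (\<open>right_kernel\<close>). Since the spaces are finite-dimensional modulo null functions, the second fact yields
  a solution: a functional that vanishes on the common kernel of finitely many functionals is a
  combination of them (\<open>functional_in_span_of_finite_family\<close>).

  \<^emph>\<open>Sobolev prerequisites.\<close> Gradients are representatives of weak gradients, so that even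
  \<open>grad (u + v) = grad u + grad v\<close> (almost everywhere) needs the uniqueness of weak gradients, that is, the
  fundamental lemma of the calculus of variations (\<open>fundamental_lemma_of_variations\<close>), for which smooth
  bump functions are built from \<open>exp (- 1 / t)\<close>. The inequalities of Poincare and Korn are
  proved for test functions and extended to \<open>H10\<close> by density. Both rest on \<open>\<integral> \<partial>\<^sub>i f = 0\<close> for
  compactly supported \<open>f\<close>, which follows from the translation invariance of Lebesgue measure.
\<close>

section \<open>Smooth bump functions\<close>

lemma partial_deriv_eq:
  assumes "(f has_derivative f') (at x)"
  shows "partial_deriv i f x = f' (axis i 1)"
  using frechet_derivative_at[OF assms] by (simp add: partial_deriv_def)

lemma partial_deriv_add:
  assumes "f differentiable (at x)" "g differentiable (at x)"
  shows "partial_deriv i (\<lambda>x. f x + g x) x = partial_deriv i f x + partial_deriv i g x"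
proof -
  obtain f' g' where *: "(f has_derivative f') (at x)" "(g has_derivative g') (at x)"
    using assms by (auto simp: differentiable_def)
  show ?thesis
    using partial_deriv_eq[OF has_derivative_add[OF *]] partial_deriv_eq[OF *(1)] partial_deriv_eq[OF *(2)]
    by simp
qed

lemma partial_deriv_mult:
  assumes "f differentiable (at x)" "g differentiable (at x)"
  shows "partial_deriv i (\<lambda>x. f x * g x) x = partial_deriv i f x * g x + f x * partial_deriv i g x"
proof -
  obtain f' g' where *: "(f has_derivative f') (at x)" "(g has_derivative g') (at x)"
    using assms by (auto simp: differentiable_def)
  show ?thesis
    using partial_deriv_eq[OF has_derivative_mult[OF *]] partial_deriv_eq[OF *(1)] partial_deriv_eq[OF *(2)]
    by simp
qed

lemma partial_deriv_const: "partial_deriv i (\<lambda>x. c) x = 0"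
  by (rule partial_deriv_eq) (auto intro: derivative_eq_intros)

lemma C_k_Suc_imp: "C_k (Suc k) f \<Longrightarrow> C_k k f"
proof (induction k arbitrary: f)
  case 0
  then show ?case
    by (auto intro!: differentiable_imp_continuous_on simp: differentiable_on_def)
qed auto

lemma C_k_continuous: "C_k k f \<Longrightarrow> continuous_on UNIV f"
  by (induction k) (auto dest: C_k_Suc_imp simp del: C_k.simps(2))

lemma C_k_const: "C_k k (\<lambda>x. c)"
  by (induction k arbitrary: c) (auto simp: partial_deriv_const[abs_def] intro: continuous_intros)

lemma C_k_add: "C_k k f \<Longrightarrow> C_k k g \<Longrightarrow> C_k k (\<lambda>x. f x + g x)"
proof (induction k arbitrary: f g)
  case (Suc k)
  then have "partial_deriv i (\<lambda>x. f x + g x) = (\<lambda>x. partial_deriv i f x + partial_deriv i g x)" for i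
    by (auto simp: partial_deriv_add)
  with Suc show ?case by (auto intro!: differentiable_add)
qed (auto intro: continuous_intros)

lemma C_k_mult: "C_k k f \<Longrightarrow> C_k k g \<Longrightarrow> C_k k (\<lambda>x. f x * g x)"
proof (induction k arbitrary: f g)
  case (Suc k)
  then have *: "partial_deriv i (\<lambda>x. f x * g x) = (\<lambda>x. partial_deriv i f x * g x + f x * partial_deriv i g x)" for i
    by (auto simp: partial_deriv_mult)
  have "C_k k f" "C_k k g" using Suc.prems C_k_Suc_imp by blast+
  with Suc show ?case by (auto simp: * intro!: differentiable_mult C_k_add)
qed (auto intro: continuous_intros)

lemma C_k_prod: "(\<And>j. j \<in> J \<Longrightarrow> C_k k (f j)) \<Longrightarrow> C_k k (\<lambda>x. \<Prod>j\<in>J. f j x)"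
  by (induction J rule: infinite_finite_induct) (auto intro: C_k_const C_k_mult)

lemma C_k_nth: "C_k k (\<lambda>x :: real ^ 'd. x $ i)"
proof (cases k)
  case (Suc l)
  have *: "((\<lambda>x. x $ i) has_derivative (\<lambda>h. h $ i)) (at x)" for x :: "real ^ 'd"
    by (rule bounded_linear.has_derivative[OF bounded_linear_vec_nth]) (rule has_derivative_ident)
  have "partial_deriv j (\<lambda>x. x $ i) = (\<lambda>x. axis j 1 $ i)" for j :: 'd
    by (rule ext) (rule partial_deriv_eq[OF *])
  then show ?thesis using * by (auto simp: Suc C_k_const differentiable_def)
qed (auto intro: continuous_intros)

text \<open>
  The class of the functions \<open>p(1 / t) exp (- 1 / t)\<close>, extended by zero to \<open>t \<le> 0\<close>, with \<open>p\<close> a polynomial, is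
  closed under differentiation, so that smoothness of all its members follows by a plain induction.
\<close>

definition flat :: "real poly \<Rightarrow> real \<Rightarrow> real" where
  "flat p t = (if t > 0 then poly p (1 / t) * exp (- (1 / t)) else 0)"

lemma flat_tendsto:
  fixes p :: "real poly"
  shows "((\<lambda>t. poly p (1 / t) * exp (- (1 / t))) \<longlongrightarrow> 0) (at_right 0)"
proof -
  have "((\<lambda>x. poly p x * exp (- x)) \<longlongrightarrow> 0) at_top"
  proof -
    have *: "((\<lambda>x. coeff p k * (x ^ k / exp x)) \<longlongrightarrow> coeff p k * 0) at_top" for k
      by (intro tendsto_intros tendsto_power_div_exp_0)
    have "((\<lambda>x. \<Sum>k\<le>degree p. coeff p k * (x ^ k / exp x)) \<longlongrightarrow> (\<Sum>k\<le>degree p. coeff p k * 0)) at_top"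
      by (intro tendsto_sum *)
    then show ?thesis
      by (simp add: poly_altdef exp_minus divide_inverse sum_distrib_right mult.assoc)
  qed
  then show ?thesis
    by (rule filterlim_compose[where f="\<lambda>t. 1 / t"])
       (simp add: filterlim_inverse_at_top_right divide_inverse)
qed

text \<open>
  For \<open>t > 0\<close> the derivative of \<open>p(1 / t) exp (- 1 / t)\<close> is \<open>(p(1 / t) - p'(1 / t)) / t\<^sup>2\<close> times the
  exponential, and at the origin the difference quotient is itself a flat function, with polynomial \<open>X p\<close>.
\<close>

lemma flat_deriv:
  "(flat p has_real_derivative flat (monom 1 2 * (p - pderiv p)) t) (at t)"
proof -
  consider "t > 0" | "t < 0" | "t = 0" by linarith
  then show ?thesis
  proof cases
    case 1
    have "((\<lambda>t. poly p (1 / t) * exp (- (1 / t))) has_real_derivative flat (monom 1 2 * (p - pderiv p)) t) (at t)"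
      using 1 by (auto intro!: derivative_eq_intros DERIV_chain2[OF poly_DERIV]
          simp: flat_def poly_monom field_simps power2_eq_square)
    then show ?thesis
      by (rule has_field_derivative_transform_within_open[where S="{0<..}"]) (use 1 in \<open>auto simp: flat_def\<close>)
  next
    case 2
    have "((\<lambda>t. 0) has_real_derivative flat (monom 1 2 * (p - pderiv p)) t) (at t)"
      using 2 by (auto simp: flat_def)
    then show ?thesis
      by (rule has_field_derivative_transform_within_open[where S="{..<0}"]) (use 2 in \<open>auto simp: flat_def\<close>)
  next
    case 3
    have r: "((\<lambda>t. flat p t / t) \<longlongrightarrow> 0) (at_right 0)"
      by (rule Lim_transform_eventually[OF flat_tendsto[of "monom 1 1 * p"]])
         (auto simp: eventually_at_right_field flat_def poly_monom intro!: exI[of _ 1])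
    have l: "((\<lambda>t. flat p t / t) \<longlongrightarrow> 0) (at_left 0)"
      by (rule Lim_transform_eventually[OF tendsto_const])
         (auto simp: eventually_at_left_field flat_def intro!: exI[of _ "-1"])
    have "((\<lambda>t. flat p t / t) \<longlongrightarrow> 0) (at 0)"
      using r l by (simp add: filterlim_at_split)
    then show ?thesis
      using 3 by (auto simp: has_field_derivative_iff flat_def)
  qed
qed

lemma C_k_flat: "C_k k (\<lambda>x :: real ^ 'd. flat p (c * x $ i + e))"
proof (induction k arbitrary: p)
  case 0
  have "continuous_on UNIV (flat p)"
    by (meson DERIV_isCont continuous_at_imp_continuous_on flat_deriv)
  then show ?case
    by (auto intro!: continuous_intros continuous_on_compose2[of UNIV "flat p"])
next
  case (Suc k)
  let ?q = "monom 1 2 * (p - pderiv p)"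
  have *: "((\<lambda>x. flat p (c * x $ i + e)) has_derivative
      (\<lambda>h. flat ?q (c * x $ i + e) * (c * h $ i))) (at x)" for x :: "real ^ 'd"
    by (rule has_derivative_compose[of "\<lambda>x. c * x $ i + e" _ _ _ "flat p",
          OF _ flat_deriv[unfolded has_field_derivative_def]])
       (auto intro!: derivative_eq_intros bounded_linear.has_derivative[OF bounded_linear_vec_nth])
  have "partial_deriv j (\<lambda>x. flat p (c * x $ i + e)) =
      (\<lambda>x. flat ?q (c * x $ i + e) * (c * axis j 1 $ i))" for j :: 'd
    by (rule ext) (rule partial_deriv_eq[OF *])
  then show ?case
    using * Suc by (auto simp: differentiable_def intro!: C_k_mult C_k_const)
qed

text \<open>
  A product of one-dimensional cut-offs that vanishes off the open box and increases to 1 inside it as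
  \<open>n\<close> grows.
\<close>

definition bump :: "real ^ 'd \<Rightarrow> real ^ 'd \<Rightarrow> nat \<Rightarrow> real ^ 'd \<Rightarrow> real" where
  "bump a b n x = (\<Prod>i\<in>UNIV. flat 1 (real n * x $ i - real n * a $ i) *
                              flat 1 (real n * b $ i - real n * x $ i))"

lemma C_k_bump: "C_k k (bump a b n)"
proof -
  have "C_k k (\<lambda>x. \<Prod>i\<in>UNIV. flat 1 (real n * x $ i + (- (real n * a $ i))) *
                              flat 1 (- real n * x $ i + real n * b $ i))"
    by (intro C_k_prod C_k_mult C_k_flat)
  then show ?thesis
    by (simp add: bump_def[abs_def] algebra_simps)
qed

lemma flat_1_bounds: "0 \<le> flat 1 t" "flat 1 t \<le> 1"
  by (auto simp: flat_def)

lemma bump_bounds: "0 \<le> bump a b n x" "bump a b n x \<le> 1"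
  unfolding bump_def by (auto intro!: prod_nonneg prod_le_1 mult_le_one flat_1_bounds mult_nonneg_nonneg)

lemma bump_eq_0:
  assumes "x \<notin> box a b" shows "bump a b n x = 0"
proof -
  obtain i where "x $ i \<le> a $ i \<or> b $ i \<le> x $ i"
    using assms by (auto simp: mem_box_cart not_less)
  then have "flat 1 (real n * x $ i - real n * a $ i) * flat 1 (real n * b $ i - real n * x $ i) = 0"
    by (metis diff_le_0_iff_le flat_def linorder_not_less mult_eq_0_iff mult_left_mono of_nat_0_le_iff)
  then show ?thesis unfolding bump_def by (intro prod_zero) auto
qed

lemma bump_tendsto:
  assumes "x \<in> box a b" shows "(\<lambda>n. bump a b n x) \<longlonglongrightarrow> 1"
proof -
  have *: "(\<lambda>n. flat 1 (real n * s)) \<longlonglongrightarrow> 1" if "s > 0" for s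
  proof -
    have "(\<lambda>n. exp (- (inverse s * inverse (real n)))) \<longlonglongrightarrow> exp (- (inverse s * 0))"
      by (intro tendsto_intros lim_inverse_n)
    moreover have "\<forall>\<^sub>F n in sequentially. exp (- (inverse s * inverse (real n))) = flat 1 (real n * s)"
      using eventually_gt_at_top[of 0] by eventually_elim (use that in \<open>auto simp: flat_def field_simps\<close>)
    ultimately show ?thesis by (auto intro: Lim_transform_eventually)
  qed
  have "(\<lambda>n. \<Prod>i\<in>UNIV. flat 1 (real n * (x $ i - a $ i)) * flat 1 (real n * (b $ i - x $ i)))
      \<longlonglongrightarrow> (\<Prod>i\<in>(UNIV::'a set). 1 * 1)"
    using assms by (intro tendsto_prod tendsto_mult *) (auto simp: mem_box_cart)
  then show ?thesis by (simp add: bump_def right_diff_distrib)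
qed

lemma bump_test_function:
  assumes "cbox a b \<subseteq> \<Omega>" shows "bump a b n \<in> test_functions \<Omega>"
proof -
  have "{x. bump a b n x \<noteq> 0} \<subseteq> cbox a b"
    using bump_eq_0 box_subset_cbox by blast
  then have "closure {x. bump a b n x \<noteq> 0} \<subseteq> cbox a b"
    by (intro closure_minimal closed_cbox)
  then show ?thesis
    using assms C_k_bump bounded_subset[OF bounded_cbox, of _ a b]
    by (auto simp: test_functions_def compact_eq_bounded_closed)
qed

section \<open>Integration by parts without boundary terms\<close>

lemma lborel_integral_shift:
  fixes f :: "'a::euclidean_space \<Rightarrow> real"
  assumes "f \<in> borel_measurable borel"
  shows "(LINT x|lborel. f (x + a)) = (LINT x|lborel. f x)"
proof -
  have "(LINT x|lborel. f x) = (LINT x|distr lborel borel ((+) a). f x)"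
    by (simp add: lborel_distr_plus)
  also have "\<dots> = (LINT x|lborel. f (a + x))"
    using assms by (intro integral_distr) auto
  finally show ?thesis by (simp add: add.commute)
qed

lemma integrable_bounded_support:
  fixes f :: "'a::euclidean_space \<Rightarrow> real"
  assumes "continuous_on UNIV f" "bounded {x. f x \<noteq> 0}"
  shows "integrable lborel f"
proof -
  obtain a b where ab: "{x. f x \<noteq> 0} \<subseteq> cbox a b"
    using bounded_subset_cbox_symmetric[OF assms(2)] by blast
  have "integrable lborel (\<lambda>x. indicator (cbox a b) x *\<^sub>R f x)"
    using assms(1) by (intro borel_integrable_compact) (auto intro: continuous_on_subset)
  moreover have "(\<lambda>x. indicator (cbox a b) x *\<^sub>R f x) = f"
    using ab by (intro ext) (auto simp: indicator_def subset_eq)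
  ultimately show ?thesis by simp
qed

lemma bounded_support_mult:
  "bounded {x. f x \<noteq> (0::real)} \<Longrightarrow> bounded {x. f x * g x \<noteq> 0}"
  "bounded {x. f x \<noteq> (0::real)} \<Longrightarrow> bounded {x. g x * f x \<noteq> 0}"
  by (auto elim!: bounded_subset)

lemma partial_deriv_support: "{x. partial_deriv i v x \<noteq> 0} \<subseteq> closure {x. v x \<noteq> 0}"
proof -
  have "partial_deriv i v x = 0" if "x \<notin> closure {x. v x \<noteq> 0}" for x
  proof -
    have "((\<lambda>x. 0::real) has_derivative (\<lambda>h. 0)) (at x)" by simp
    then have "(v has_derivative (\<lambda>h. 0)) (at x)"
      by (rule has_derivative_transform_within_open[where s="- closure {x. v x \<noteq> 0}"])
         (use that closure_subset[of "{x. v x \<noteq> 0}"] in \<open>auto\<close>)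
    then show ?thesis by (simp add: partial_deriv_eq)
  qed
  then show ?thesis by blast
qed

lemma bounded_support_partial_deriv:
  "bounded {x. v x \<noteq> 0} \<Longrightarrow> bounded {x. partial_deriv i v x \<noteq> 0}"
  using partial_deriv_support bounded_closure bounded_subset by metis

lemma C1_line_derivative:
  assumes "C_k (Suc 0) v"
  shows "((\<lambda>t. v (x + t *\<^sub>R axis i 1)) has_real_derivative partial_deriv i v (x + t *\<^sub>R axis i 1)) (at t)"
proof -
  obtain f' where f': "(v has_derivative f') (at (x + t *\<^sub>R axis i 1))"
    using assms by (auto simp: differentiable_def)
  have "((\<lambda>t. x + t *\<^sub>R axis i 1) has_derivative (\<lambda>h. h *\<^sub>R axis i 1)) (at t)"
    by (auto intro!: derivative_eq_intros)
  from has_derivative_compose[OF this f']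
  have "((\<lambda>t. v (x + t *\<^sub>R axis i 1)) has_derivative (\<lambda>h. f' (h *\<^sub>R axis i 1))) (at t)" .
  moreover have "(\<lambda>h. f' (h *\<^sub>R axis i 1)) = (\<lambda>h. h * f' (axis i 1))"
    using has_derivative_linear[OF f'] by (auto simp: linear_cmul)
  ultimately show ?thesis
    by (simp add: partial_deriv_eq[OF f'] has_field_derivative_def mult_commute_abs)
qed

text \<open>
  Dominated convergence: the difference quotients are bounded by a bound of the partial derivative, and
  they all vanish outside a ball that is independent of \<open>n\<close>.
\<close>

lemma difference_quotient_integral:
  fixes v :: "real ^ 'd \<Rightarrow> real"
  assumes v: "C_k (Suc 0) v" "bounded {x. v x \<noteq> 0}" and g: "continuous_on UNIV g"
    and s: "s \<longlonglongrightarrow> 0" "\<And>n. s n \<noteq> 0"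
  shows "(\<lambda>n. LINT x|lborel. g x * ((v (x + s n *\<^sub>R axis i 1) - v x) / s n))
      \<longlonglongrightarrow> (LINT x|lborel. g x * partial_deriv i v x)"
proof -
  have cv: "continuous_on UNIV v" and cd: "continuous_on UNIV (partial_deriv i v)"
    using v C_k_continuous[of "Suc 0" v] by auto
  obtain R where R: "\<And>x. v x \<noteq> 0 \<Longrightarrow> norm x \<le> R"
    using v(2) by (auto simp: bounded_iff)
  obtain S where S: "\<And>n. \<bar>s n\<bar> \<le> S"
    using s(1) convergent_imp_Bseq[of s] by (auto simp: convergent_def Bseq_def)
  have bd: "bounded (partial_deriv i v ` closure {x. v x \<noteq> 0})"
    using v(2) cd by (intro compact_imp_bounded compact_continuous_image)
      (auto simp: compact_eq_bounded_closed intro: continuous_on_subset)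
  then obtain B where B: "\<And>x. \<bar>partial_deriv i v x\<bar> \<le> B"
  proof -
    assume *: "\<And>B. (\<And>x. \<bar>partial_deriv i v x\<bar> \<le> B) \<Longrightarrow> thesis"
    obtain B0 where B0: "\<forall>x\<in>closure {x. v x \<noteq> 0}. \<bar>partial_deriv i v x\<bar> \<le> B0"
      using bd by (auto simp: bounded_iff)
    show thesis
    proof (rule *[of "max B0 0"])
      show "\<bar>partial_deriv i v x\<bar> \<le> max B0 0" for x
        using B0 partial_deriv_support[of i v] by (cases "partial_deriv i v x = 0") (auto intro: max.coboundedI1)
    qed
  qed
  let ?D = "cball 0 (R + S) :: (real ^ 'd) set"
  have "bounded (g ` ?D)"
    using g by (intro compact_imp_bounded compact_continuous_image) (auto intro: continuous_on_subset)
  then obtain G where "\<forall>x\<in>?D. \<bar>g x\<bar> \<le> G"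
    by (auto simp: bounded_iff)
  then have G: "\<bar>g x\<bar> \<le> G" if "x \<in> ?D" for x
    using that by blast
  have lip: "\<bar>(v (x + s n *\<^sub>R axis i 1) - v x) / s n\<bar> \<le> B" for x n
  proof -
    have "norm (v (x + s n *\<^sub>R axis i 1) - v (x + 0 *\<^sub>R axis i 1)) \<le> B * norm (s n - 0)"
      by (rule field_differentiable_bound[of UNIV "\<lambda>t. v (x + t *\<^sub>R axis i 1)"
            "\<lambda>t. partial_deriv i v (x + t *\<^sub>R axis i 1)" B])
         (use B C1_line_derivative[OF v(1)] in auto)
    then show ?thesis using s(2)[of n] by (simp add: abs_divide field_simps)
  qed
  have pt: "(\<lambda>n. (v (x + s n *\<^sub>R axis i 1) - v x) / s n) \<longlonglongrightarrow> partial_deriv i v x" for x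
  proof -
    have "((\<lambda>t. (v (x + t *\<^sub>R axis i 1) - v x) / t) \<longlongrightarrow> partial_deriv i v x) (at 0)"
      using C1_line_derivative[OF v(1), of x i 0] by (simp add: has_field_derivative_iff)
    moreover have "filterlim s (at 0) sequentially"
      using s by (simp add: filterlim_at)
    ultimately show ?thesis by (rule filterlim_compose)
  qed
  show ?thesis
  proof (rule integral_dominated_convergence[where w="\<lambda>x. indicator ?D x * (G * B)"])
    show "integrable lborel (\<lambda>x. indicator ?D x * (G * B))"
      by (intro integrable_mult_left integrable_real_indicator emeasure_lborel_cball_finite) simp
    show "AE x in lborel. (\<lambda>n. g x * ((v (x + s n *\<^sub>R axis i 1) - v x) / s n)) \<longlonglongrightarrow> g x * partial_deriv i v x"
      by (intro AE_I2 tendsto_intros pt)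
    show "AE x in lborel. norm (g x * ((v (x + s n *\<^sub>R axis i 1) - v x) / s n)) \<le> indicator ?D x * (G * B)" for n
    proof (intro AE_I2)
      fix x
      show "norm (g x * ((v (x + s n *\<^sub>R axis i 1) - v x) / s n)) \<le> indicator ?D x * (G * B)"
      proof (cases "x \<in> ?D")
        case True
        then show ?thesis using mult_mono[OF G[OF True] lip[of x n]] G[OF True]
          by (auto simp: abs_mult)
      next
        case False
        have "norm x \<le> norm (x + s n *\<^sub>R axis i 1) + norm (s n *\<^sub>R (axis i 1 :: real ^ 'd))"
          by (metis add_diff_cancel norm_triangle_ineq4)
        then have "norm x \<le> norm (x + s n *\<^sub>R axis i 1) + S" using S[of n] by simp
        moreover have "0 \<le> S" using S[of 0] by simp
        ultimately have "v x = 0" "v (x + s n *\<^sub>R axis i 1) = 0"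
          using False R[of x] R[of "x + s n *\<^sub>R axis i 1"] by auto
        then show ?thesis using False by simp
      qed
    qed
    show "(\<lambda>x. g x * partial_deriv i v x) \<in> borel_measurable lborel"
      using continuous_on_mult[OF g cd] by (simp add: borel_measurable_continuous_onI)
    have "continuous_on UNIV (\<lambda>x. v (x + s n *\<^sub>R axis i 1))" for n
      by (rule continuous_on_compose2[OF cv]) (auto intro!: continuous_intros)
    then have "continuous_on UNIV (\<lambda>x. g x * ((v (x + s n *\<^sub>R axis i 1) - v x) / s n))" for n
      using g cv s(2) by (intro continuous_intros) auto
    then show "(\<lambda>x. g x * ((v (x + s n *\<^sub>R axis i 1) - v x) / s n)) \<in> borel_measurable lborel" for n
      by (simp add: borel_measurable_continuous_onI)
  qed
qed

text \<open>
  The integral of each difference quotient is zero, since Lebesgue measure is invariant under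
  translations.
\<close>

lemma integral_partial_deriv_eq_0:
  assumes f: "C_k (Suc 0) f" "bounded {x. f x \<noteq> 0}"
  shows "(LINT x|lborel. partial_deriv i f x) = 0"
proof -
  let ?s = "\<lambda>n. inverse (real (Suc n))"
  have c: "continuous_on UNIV f" by (rule C_k_continuous[OF f(1)])
  have int: "integrable lborel f" "integrable lborel (\<lambda>x. f (x + a))" for a
  proof -
    show "integrable lborel f" by (rule integrable_bounded_support[OF c f(2)])
    moreover have "f \<in> borel_measurable borel" by (rule borel_measurable_continuous_onI[OF c])
    ultimately show "integrable lborel (\<lambda>x. f (x + a))"
      using integrable_distr_eq[of "(+) a" lborel borel f] by (simp add: lborel_distr_plus add.commute)
  qed
  have *: "(LINT x|lborel. 1 * ((f (x + ?s n *\<^sub>R axis i 1) - f x) / ?s n)) = 0" for n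
    using lborel_integral_shift[of f "?s n *\<^sub>R axis i 1"] borel_measurable_continuous_onI[OF c] int
    by simp
  have "(\<lambda>n. LINT x|lborel. 1 * ((f (x + ?s n *\<^sub>R axis i 1) - f x) / ?s n)) \<longlonglongrightarrow>
     (LINT x|lborel. 1 * partial_deriv i f x)"
    by (rule difference_quotient_integral[OF f]) (use LIMSEQ_inverse_real_of_nat in auto)
  then show ?thesis unfolding * by (simp add: LIMSEQ_const_iff)
qed

lemma integral_by_parts:
  assumes u: "C_k (Suc 0) u" "bounded {x. u x \<noteq> 0}" and w: "C_k (Suc 0) w"
  shows "(LINT x|lborel. u x * partial_deriv i w x) = - (LINT x|lborel. partial_deriv i u x * w x)"
proof -
  have c: "continuous_on UNIV u" "continuous_on UNIV w"
     "continuous_on UNIV (partial_deriv i u)" "continuous_on UNIV (partial_deriv i w)"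
    using u w C_k_continuous[of "Suc 0" u] C_k_continuous[of "Suc 0" w] by auto
  have "0 = (LINT x|lborel. partial_deriv i (\<lambda>x. u x * w x) x)"
    using C_k_mult[OF u(1) w] bounded_support_mult[OF u(2)]
    by (intro integral_partial_deriv_eq_0[symmetric]) auto
  also have "\<dots> = (LINT x|lborel. partial_deriv i u x * w x + u x * partial_deriv i w x)"
    using u(1) w by (simp add: partial_deriv_mult)
  also have "\<dots> = (LINT x|lborel. partial_deriv i u x * w x) + (LINT x|lborel. u x * partial_deriv i w x)"
    using c u(2) by (intro Bochner_Integration.integral_add integrable_bounded_support continuous_intros bounded_support_mult
        bounded_support_partial_deriv)
  finally show ?thesis by simp
qed

lemma C_k_shift:
  assumes "C_k k f" shows "C_k k (\<lambda>x. f (x + a))" and "k > 0 \<Longrightarrow> partial_deriv i (\<lambda>x. f (x + a)) x = partial_deriv i f (x + a)"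
proof -
  have d: "((\<lambda>x. f (x + a)) has_derivative f') (at x)" if "(f has_derivative f') (at (x + a))" for f f' x
  proof -
    have "((\<lambda>x. x + a) has_derivative (\<lambda>x. x)) (at x)"
      by (auto intro!: derivative_eq_intros)
    from has_derivative_compose[OF this that] show ?thesis .
  qed
  have p: "partial_deriv i (\<lambda>x. f (x + a)) x = partial_deriv i f (x + a)" if "f differentiable (at (x + a))" for f x i
    using that d partial_deriv_eq unfolding differentiable_def by metis
  show "C_k k (\<lambda>x. f (x + a))" using assms
  proof (induction k arbitrary: f)
    case 0
    then show ?case by (auto intro!: continuous_on_compose2[of UNIV f] continuous_intros)
  next
    case (Suc k)
    have "partial_deriv i (\<lambda>x. f (x + a)) = (\<lambda>x. partial_deriv i f (x + a))" for i
      using p Suc.prems by auto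
    moreover have "(\<lambda>x. f (x + a)) differentiable (at x)" for x
      using d Suc.prems unfolding C_k.simps differentiable_def by blast
    ultimately show ?case using Suc by auto
  qed
  show "partial_deriv i (\<lambda>x. f (x + a)) x = partial_deriv i f (x + a)" if "k > 0"
    using p assms that by (cases k) auto
qed

text \<open>
  Formally two integrations by parts and the symmetry of second derivatives. Only first derivatives are
  needed if one of the two partial derivatives is kept as a difference quotient: integrating by parts in
  direction \<open>i\<close> and then translating turns the quotient of \<open>v\<close> in direction \<open>j\<close> into the
  backward quotient of \<open>u\<close>.
\<close>

lemma integral_mixed_partials:
  assumes u: "C_k (Suc 0) u" "bounded {x. u x \<noteq> 0}" and v: "C_k (Suc 0) v" "bounded {x. v x \<noteq> 0}"
  shows "(LINT x|lborel. partial_deriv i u x * partial_deriv j v x) =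
         (LINT x|lborel. partial_deriv j u x * partial_deriv i v x)"
proof -
  define s where "s n = inverse (real (Suc n))" for n
  have s: "s \<longlonglongrightarrow> 0" "(\<lambda>n. - s n) \<longlonglongrightarrow> 0" "s n \<noteq> 0" "- s n \<noteq> 0" for n
    using LIMSEQ_inverse_real_of_nat tendsto_minus[OF LIMSEQ_inverse_real_of_nat]
    by (auto simp: s_def[abs_def] simp del: of_nat_Suc)
  have c: "continuous_on UNIV u" "continuous_on UNIV v"
     "continuous_on UNIV (partial_deriv i u)" "continuous_on UNIV (partial_deriv i v)"
    using u v C_k_continuous[of "Suc 0" u] C_k_continuous[of "Suc 0" v] by auto
  note bc = bounded_support_mult bounded_support_partial_deriv u(2) v(2)
  have cs: "continuous_on UNIV (\<lambda>x. h (x + a))" if "continuous_on UNIV h" for h :: "real ^ 'a \<Rightarrow> real" and a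
    by (rule continuous_on_compose2[OF that]) (auto intro!: continuous_intros)
  have eq: "(LINT x|lborel. partial_deriv i u x * v (x + s n *\<^sub>R axis j 1)) =
        - (LINT x|lborel. partial_deriv i v x * u (x + (- s n) *\<^sub>R axis j 1))" for n
  proof -
    let ?a = "s n *\<^sub>R axis j 1"
    have "(LINT x|lborel. u x * partial_deriv i (\<lambda>x. v (x + ?a)) x) = - (LINT x|lborel. partial_deriv i u x * v (x + ?a))"
      by (rule integral_by_parts[OF u C_k_shift(1)[OF v(1)]])
    then have "(LINT x|lborel. partial_deriv i u x * v (x + ?a)) = - (LINT x|lborel. u x * partial_deriv i v (x + ?a))"
      by (simp add: C_k_shift(2)[OF v(1)])
    also have "\<dots> = - (LINT x|lborel. (\<lambda>x. partial_deriv i v x * u (x + (- s n) *\<^sub>R axis j 1)) (x + ?a))"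
      by (simp add: mult.commute)
    also have "\<dots> = - (LINT x|lborel. (\<lambda>x. partial_deriv i v x * u (x + (- s n) *\<^sub>R axis j 1)) x)"
      by (subst lborel_integral_shift) (intro borel_measurable_continuous_onI continuous_on_mult c cs refl)+
    finally show ?thesis by simp
  qed
  have zero: "(LINT x|lborel. partial_deriv i u x * v x) = - (LINT x|lborel. partial_deriv i v x * u x)"
    using integral_by_parts[OF u v(1), of i] by (simp add: mult.commute)
  have L: "(LINT x|lborel. partial_deriv i u x * ((v (x + s n *\<^sub>R axis j 1) - v x) / s n)) =
      ((LINT x|lborel. partial_deriv i u x * v (x + s n *\<^sub>R axis j 1)) - (LINT x|lborel. partial_deriv i u x * v x)) / s n" for n
  proof -
    have "(LINT x|lborel. partial_deriv i u x * ((v (x + s n *\<^sub>R axis j 1) - v x) / s n)) =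
      (LINT x|lborel. (partial_deriv i u x * v (x + s n *\<^sub>R axis j 1) - partial_deriv i u x * v x) / s n)"
      by (simp add: algebra_simps diff_divide_distrib)
    also have "\<dots> = (LINT x|lborel. partial_deriv i u x * v (x + s n *\<^sub>R axis j 1) - partial_deriv i u x * v x) / s n"
      by simp
    also have "(LINT x|lborel. partial_deriv i u x * v (x + s n *\<^sub>R axis j 1) - partial_deriv i u x * v x) =
       (LINT x|lborel. partial_deriv i u x * v (x + s n *\<^sub>R axis j 1)) - (LINT x|lborel. partial_deriv i u x * v x)"
      by (intro Bochner_Integration.integral_diff integrable_bounded_support continuous_on_mult c cs bc)
    finally show ?thesis .
  qed
  have R: "(LINT x|lborel. partial_deriv i v x * ((u (x + (- s n) *\<^sub>R axis j 1) - u x) / (- s n))) =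
      ((LINT x|lborel. partial_deriv i v x * u (x + (- s n) *\<^sub>R axis j 1)) - (LINT x|lborel. partial_deriv i v x * u x)) / (- s n)" for n
  proof -
    have "(LINT x|lborel. partial_deriv i v x * ((u (x + (- s n) *\<^sub>R axis j 1) - u x) / (- s n))) =
      (LINT x|lborel. (partial_deriv i v x * u (x + (- s n) *\<^sub>R axis j 1) - partial_deriv i v x * u x) / (- s n))"
      by (simp add: algebra_simps diff_divide_distrib)
    also have "\<dots> = (LINT x|lborel. partial_deriv i v x * u (x + (- s n) *\<^sub>R axis j 1) - partial_deriv i v x * u x) / (- s n)"
      by simp
    also have "(LINT x|lborel. partial_deriv i v x * u (x + (- s n) *\<^sub>R axis j 1) - partial_deriv i v x * u x) =
       (LINT x|lborel. partial_deriv i v x * u (x + (- s n) *\<^sub>R axis j 1)) - (LINT x|lborel. partial_deriv i v x * u x)"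
      by (intro Bochner_Integration.integral_diff integrable_bounded_support continuous_on_mult c cs bc)
    finally show ?thesis .
  qed
  have "(LINT x|lborel. partial_deriv i u x * ((v (x + s n *\<^sub>R axis j 1) - v x) / s n)) =
     (LINT x|lborel. partial_deriv i v x * ((u (x + (- s n) *\<^sub>R axis j 1) - u x) / (- s n)))" for n
    unfolding L R eq zero using s(3)[of n] by (simp add: field_simps)
  moreover have "(\<lambda>n. LINT x|lborel. partial_deriv i u x * ((v (x + s n *\<^sub>R axis j 1) - v x) / s n))
     \<longlonglongrightarrow> (LINT x|lborel. partial_deriv i u x * partial_deriv j v x)"
    by (rule difference_quotient_integral[OF v c(3) s(1,3)])
  moreover have "(\<lambda>n. LINT x|lborel. partial_deriv i v x * ((u (x + (- s n) *\<^sub>R axis j 1) - u x) / (- s n)))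
     \<longlonglongrightarrow> (LINT x|lborel. partial_deriv i v x * partial_deriv j u x)"
    by (rule difference_quotient_integral[OF u c(4) s(2,4)])
  ultimately show ?thesis
    using LIMSEQ_unique by (simp add: mult.commute)
qed

section \<open>The fundamental lemma of the calculus of variations\<close>

text \<open>
  The positive and the negative part of \<open>f\<close> are the densities of two finite measures which agree on boxes.
  Boxes form a generator of the Borel sets that is stable under intersection, so the measures agree, and hence
  so do their densities.
\<close>

lemma AE_zero_if_integral_boxes_zero:
  fixes f :: "'a::euclidean_space \<Rightarrow> real"
  assumes f: "integrable lebesgue f"
    and zero: "\<And>a b. (LINT x|lebesgue. indicator (box a b) x * f x) = 0"
  shows "AE x in lebesgue. f x = 0"
proof -
  obtain f' where f'[measurable]: "f' \<in> borel_measurable lborel" and eq: "AE x in lborel. f x = f' x"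
    using completion_ex_borel_measurable_real borel_measurable_integrable[OF f] by blast
  then have eq': "AE x in lebesgue. f x = f' x" by (simp add: AE_completion_iff)
  have "integrable lebesgue f'"
    using integrable_cong_AE_imp[OF f measurable_completion[OF f']] eq' by fastforce
  then have int: "integrable lborel f'" by (simp add: integrable_completion)
  have zero': "(LINT x|lborel. indicator (box a b) x * f' x) = 0" for a b
  proof -
    have "(LINT x|lborel. indicator (box a b) x * f' x) = (LINT x|lebesgue. indicator (box a b) x * f' x)"
      by (rule integral_completion[symmetric]) measurable
    also have "\<dots> = (LINT x|lebesgue. indicator (box a b) x * f x)"
    proof (rule integral_cong_AE)
      show "AE x in lebesgue. indicator (box a b) x * f' x = indicator (box a b) x * f x"
        using eq' by eventually_elim simp
    qed (intro borel_measurable_times borel_measurable_indicator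
          borel_measurable_integrable[OF f] measurable_completion[OF f']; simp)+
    finally show ?thesis using zero by simp
  qed
  let ?P = "density lborel (\<lambda>x. ennreal (f' x))" and ?N = "density lborel (\<lambda>x. ennreal (- f' x))"
  have fin: "(\<integral>\<^sup>+x. ennreal (f' x) \<partial>lborel) < \<infinity>" "(\<integral>\<^sup>+x. ennreal (- f' x) \<partial>lborel) < \<infinity>"
    using int by (auto simp: real_integrable_def less_top)
  have mono: "emeasure ?P A < \<infinity>" "emeasure ?N A < \<infinity>" for A
  proof -
    have "emeasure ?P A \<le> emeasure ?P (space ?P)" "emeasure ?N A \<le> emeasure ?N (space ?N)"
      by (rule emeasure_space)+
    then show "emeasure ?P A < \<infinity>" "emeasure ?N A < \<infinity>"
      using fin by (auto simp: emeasure_density)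
  qed
  have box: "emeasure ?P (box a b) = emeasure ?N (box a b)" for a b
  proof -
    let ?h = "\<lambda>x. indicator (box a b) x * f' x"
    have i: "integrable lborel ?h"
      using integrable_mult_indicator[OF _ int, of "box a b"] by simp
    have e: "(\<integral>\<^sup>+x. ennreal (?h x) \<partial>lborel) = emeasure ?P (box a b)"
      "(\<integral>\<^sup>+x. ennreal (- ?h x) \<partial>lborel) = emeasure ?N (box a b)"
      by (auto simp: emeasure_density indicator_def intro!: nn_integral_cong)
    have "enn2real (emeasure ?P (box a b)) = enn2real (emeasure ?N (box a b))"
      using real_lebesgue_integral_def[OF i] zero'[of a b] unfolding e by simp
    then show ?thesis
      using mono by (metis ennreal_enn2real infinity_ennreal_def)
  qed
  \<comment> \<open>\<open>ennreal\<close> truncates negative numbers, so these densities are the positive and the negative part\<close>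
  have "?P = ?N"
  proof (rule measure_eqI_generator_eq[where E="range (\<lambda>(a, b). box a b)" and \<Omega>=UNIV
        and A="\<lambda>n. box (- (real n *\<^sub>R One)) (real n *\<^sub>R One)"])
    show "Int_stable (range (\<lambda>(a, b). box a b :: 'a set))"
      by (auto simp: Int_stable_def box_Int_box)
    show "sets ?P = sigma_sets UNIV (range (\<lambda>(a, b). box a b))" "sets ?N = sigma_sets UNIV (range (\<lambda>(a, b). box a b))"
      by (simp_all add: borel_eq_box)
    show "(\<Union>n. box (- (real n *\<^sub>R One)) (real n *\<^sub>R One)) = (UNIV :: 'a set)"
      unfolding UN_box_eq_UNIV ..
    show "emeasure ?P (box (- (real n *\<^sub>R One)) (real n *\<^sub>R One)) \<noteq> \<infinity>" for n
      using mono(1) by (simp add: less_top)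
  qed (auto simp: box)
  then have "AE x in lborel. ennreal (f' x) = ennreal (- f' x)"
    using fin by (subst (asm) finite_density_unique) auto
  then have "AE x in lborel. f' x = 0"
    by eventually_elim (metis ennreal_eq_0_iff ennreal_neg linorder_le_cases neg_le_0_iff_le nle_le)
  then show ?thesis using eq' by (auto simp: AE_completion_iff)
qed

lemma integral_lebesgue_on_eq_lborel:
  fixes h :: "'a::euclidean_space \<Rightarrow> real"
  assumes "\<Omega> \<in> sets lebesgue" "h \<in> borel_measurable borel" "\<And>x. x \<notin> \<Omega> \<Longrightarrow> h x = 0"
  shows "(LINT x|lebesgue_on \<Omega>. h x) = (LINT x|lborel. h x)"
proof -
  have "(LINT x|lebesgue_on \<Omega>. h x) = (LINT x|lebesgue. (if x \<in> \<Omega> then h x else 0))"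
    using assms(1) by (simp add: Lebesgue_Measure.integral_restrict_UNIV)
  also have "\<dots> = (LINT x|lebesgue. h x)"
    using assms(3) by (intro Bochner_Integration.integral_cong) auto
  also have "\<dots> = (LINT x|lborel. h x)"
    using assms(2) by (intro integral_completion) simp
  finally show ?thesis .
qed

text \<open>
  The bump functions of a box converge boundedly to its indicator, so \<open>g\<close> integrates to zero over
  every box whose closure lies in the domain. This makes \<open>g\<close> vanish almost everywhere on each such
  box, and countably many of them cover the domain.
\<close>

lemma fundamental_lemma_of_variations:
  fixes g :: "real ^ 'd \<Rightarrow> real"
  assumes "open \<Omega>" and int: "integrable (lebesgue_on \<Omega>) g"
    and zero: "\<And>\<psi>. \<psi> \<in> test_functions \<Omega> \<Longrightarrow> (LINT x|lebesgue_on \<Omega>. g x * \<psi> x) = 0"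
  shows "AE x in lebesgue_on \<Omega>. g x = 0"
proof -
  have meas: "\<Omega> \<in> sets lebesgue" using \<open>open \<Omega>\<close> by auto
  define G where "G x = (if x \<in> \<Omega> then g x else 0)" for x
  have G: "integrable lebesgue G"
    unfolding G_def using int by (rule Lebesgue_Measure.integrable_restrict_UNIV[OF meas, THEN iffD2])
  have test: "(LINT x|lebesgue. G x * \<psi> x) = 0" if "\<psi> \<in> test_functions \<Omega>" for \<psi>
  proof -
    have "(LINT x|lebesgue. G x * \<psi> x) = (LINT x|lebesgue. (if x \<in> \<Omega> then g x * \<psi> x else 0))"
      by (intro Bochner_Integration.integral_cong) (auto simp: G_def)
    also have "\<dots> = 0"
      using zero[OF that] meas by (simp add: Lebesgue_Measure.integral_restrict_UNIV)
    finally show ?thesis .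
  qed
  have box0: "(LINT x|lebesgue. indicator (box a b) x * G x) = 0" if "cbox a b \<subseteq> \<Omega>" for a b
  proof -
    have "(\<lambda>n. LINT x|lebesgue. G x * bump a b n x) \<longlonglongrightarrow> (LINT x|lebesgue. indicator (box a b) x * G x)"
    proof (rule integral_dominated_convergence[where w="\<lambda>x. norm (G x)"])
      show "integrable lebesgue (\<lambda>x. norm (G x))" using G by simp
      show "(\<lambda>x. indicator (box a b) x * G x) \<in> borel_measurable lebesgue"
        using G by (intro borel_measurable_times borel_measurable_indicator) auto
      have "continuous_on UNIV (bump a b n)" for n by (rule C_k_continuous[OF C_k_bump])
      then have "bump a b n \<in> borel_measurable lebesgue" for n
        by (intro measurable_completion) (simp add: borel_measurable_continuous_onI)
      then show "(\<lambda>x. G x * bump a b n x) \<in> borel_measurable lebesgue" for n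
        using G by (intro borel_measurable_times) auto
      have "(\<lambda>n. G x * bump a b n x) \<longlonglongrightarrow> indicator (box a b) x * G x" for x
      proof (cases "x \<in> box a b")
        case True
        then show ?thesis using tendsto_mult[OF tendsto_const bump_tendsto[OF True], of "G x"] by simp
      qed (simp add: bump_eq_0)
      then show "AE x in lebesgue. (\<lambda>n. G x * bump a b n x) \<longlonglongrightarrow> indicator (box a b) x * G x" by simp
      show "AE x in lebesgue. norm (G x * bump a b n x) \<le> norm (G x)" for n
        using bump_bounds[of a b n] by (intro AE_I2) (simp add: abs_mult mult_left_le)
    qed
    then show ?thesis using test[OF bump_test_function[OF that]] by (simp add: LIMSEQ_const_iff)
  qed
  have cbox0: "AE x in lebesgue. x \<in> cbox p q \<longrightarrow> G x = 0" if pq: "cbox p q \<subseteq> \<Omega>" for p q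
  proof -
    have "AE x in lebesgue. indicator (box p q) x * G x = 0"
    proof (rule AE_zero_if_integral_boxes_zero)
      show "integrable lebesgue (\<lambda>x. indicator (box p q) x * G x)"
        using integrable_mult_indicator[OF _ G, of "box p q"] by simp
      fix c d :: "real ^ 'd"
      obtain a b where ab: "box c d \<inter> box p q = box a b" using box_Int_box by blast
      have "(LINT x|lebesgue. indicator (box a b) x * G x) = 0"
      proof (cases "box a b = {}")
        case False
        then have "cbox a b \<subseteq> closure (box p q)"
          using ab closure_box[OF False] closure_mono by (metis Int_lower2)
        then have "cbox a b \<subseteq> cbox p q"
          by (meson box_subset_cbox closed_cbox closure_minimal order_trans)
        then show ?thesis using box0 pq by blast
      qed simp
      then show "(LINT x|lebesgue. indicator (box c d) x * (indicator (box p q) x * G x)) = 0"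
        unfolding ab[symmetric] indicator_inter_arith by (simp add: mult.assoc)
    qed
    moreover have "AE x in lebesgue. x \<notin> cbox p q - box p q"
      by (rule AE_not_in[OF negligible_frontier_interval[unfolded negligible_iff_null_sets]])
    ultimately show ?thesis by eventually_elim auto
  qed
  obtain \<D> where D: "countable \<D>" "\<D> \<subseteq> Pow \<Omega>" "\<And>X. X \<in> \<D> \<Longrightarrow> \<exists>a b. X = cbox a b" "\<Union>\<D> = \<Omega>"
    using open_countable_Union_open_cbox[OF \<open>open \<Omega>\<close>] by metis
  have "AE x in lebesgue. \<forall>X\<in>\<D>. x \<in> X \<longrightarrow> G x = 0"
  proof (subst AE_ball_countable[OF D(1)], rule ballI)
    fix X assume X: "X \<in> \<D>"
    then obtain p q where "X = cbox p q" using D(3) by metis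
    then show "AE x in lebesgue. x \<in> X \<longrightarrow> G x = 0" using cbox0[of p q] D(2) X by auto
  qed
  then have "AE x in lebesgue. x \<in> \<Omega> \<longrightarrow> g x = 0"
    by eventually_elim (auto simp: G_def D(4)[symmetric])
  then show ?thesis using meas by (simp add: AE_restrict_space_iff)
qed

section \<open>Square-integrable functions\<close>

lemma L2_measurable: "u \<in> L2 \<Omega> \<Longrightarrow> u \<in> borel_measurable (lebesgue_on \<Omega>)"
  and L2_integrable: "u \<in> L2 \<Omega> \<Longrightarrow> integrable (lebesgue_on \<Omega>) (\<lambda>x. (norm (u x))\<^sup>2)"
  by (auto simp: L2_def)

text \<open>
  Integrability of everything that is quadratic in square-integrable functions.
\<close>

lemma integrable_of_norm_squares:
  fixes u :: "real ^ 'd \<Rightarrow> 'b::euclidean_space" and v :: "real ^ 'd \<Rightarrow> 'c::euclidean_space"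
    and h :: "real ^ 'd \<Rightarrow> 'e::euclidean_space"
  assumes "u \<in> L2 \<Omega>" "v \<in> L2 \<Omega>" "h \<in> borel_measurable (lebesgue_on \<Omega>)"
    and "AE x in lebesgue_on \<Omega>. norm (h x) \<le> c * ((norm (u x))\<^sup>2 + (norm (v x))\<^sup>2)"
  shows "integrable (lebesgue_on \<Omega>) h"
proof (rule Bochner_Integration.integrable_bound)
  show "integrable (lebesgue_on \<Omega>) (\<lambda>x. c * ((norm (u x))\<^sup>2 + (norm (v x))\<^sup>2))"
    using assms(1,2) by (intro integrable_mult_right Bochner_Integration.integrable_add L2_integrable)
  show "AE x in lebesgue_on \<Omega>. norm (h x) \<le> norm (c * ((norm (u x))\<^sup>2 + (norm (v x))\<^sup>2))"
    using assms(4) by eventually_elim simp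
qed fact

lemma mult_le_sum_squares: "a * b \<le> a\<^sup>2 + (b\<^sup>2 :: real)"
  using sum_squares_bound[of a b] zero_le_power2[of a] zero_le_power2[of b] by linarith

lemma L2_inner_integrable:
  assumes "u \<in> L2 \<Omega>" "v \<in> L2 \<Omega>"
  shows "integrable (lebesgue_on \<Omega>) (\<lambda>x. u x \<bullet> v x)"
proof (rule integrable_of_norm_squares[OF assms, where c=1])
  have "\<bar>u x \<bullet> v x\<bar> \<le> (norm (u x))\<^sup>2 + (norm (v x))\<^sup>2" for x
    using Cauchy_Schwarz_ineq2[of "u x" "v x"] mult_le_sum_squares[of "norm (u x)" "norm (v x)"] by linarith
  then show "AE x in lebesgue_on \<Omega>. norm (u x \<bullet> v x) \<le> 1 * ((norm (u x))\<^sup>2 + (norm (v x))\<^sup>2)" by simp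
qed (intro borel_measurable_inner L2_measurable assms)

lemma L2_zero: "(\<lambda>x. 0) \<in> L2 \<Omega>"
  by (auto simp: L2_def)

lemma L2_add: "u \<in> L2 \<Omega> \<Longrightarrow> v \<in> L2 \<Omega> \<Longrightarrow> (\<lambda>x. u x + v x) \<in> L2 \<Omega>"
proof -
  assume uv: "u \<in> L2 \<Omega>" "v \<in> L2 \<Omega>"
  have "(norm (a + b))\<^sup>2 \<le> 2 * ((norm a)\<^sup>2 + (norm b)\<^sup>2)" for a b :: 'b
    using sum_squares_bound[of "norm a" "norm b"] power_mono[OF norm_triangle_ineq[of a b], of 2]
    by (simp add: power2_sum algebra_simps)
  moreover have m: "(\<lambda>x. u x + v x) \<in> borel_measurable (lebesgue_on \<Omega>)"
    by (intro borel_measurable_add L2_measurable uv)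
  ultimately have "integrable (lebesgue_on \<Omega>) (\<lambda>x. (norm (u x + v x))\<^sup>2)"
    by (intro integrable_of_norm_squares[OF uv, where c=2]) auto
  then show ?thesis using m by (simp add: L2_def)
qed

lemma L2_scale: "u \<in> L2 \<Omega> \<Longrightarrow> (\<lambda>x. c *\<^sub>R u x) \<in> L2 \<Omega>"
  by (auto simp: L2_def power_mult_distrib)

lemma L2_cmult: "u \<in> L2 \<Omega> \<Longrightarrow> (\<lambda>x. c * u x) \<in> L2 \<Omega>" for u :: "real ^ 'd \<Rightarrow> real"
  using L2_scale[of u \<Omega> c] by simp

lemma L2_minus: "u \<in> L2 \<Omega> \<Longrightarrow> (\<lambda>x. - u x) \<in> L2 \<Omega>"
  using L2_scale[of u \<Omega> "-1"] by simp

lemma L2_diff: "u \<in> L2 \<Omega> \<Longrightarrow> v \<in> L2 \<Omega> \<Longrightarrow> (\<lambda>x. u x - v x) \<in> L2 \<Omega>"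
  using L2_add[OF _ L2_minus] by fastforce

lemma L2_sum: "(\<And>i. i \<in> I \<Longrightarrow> u i \<in> L2 \<Omega>) \<Longrightarrow> (\<lambda>x. \<Sum>i\<in>I. u i x) \<in> L2 \<Omega>"
  by (induction I rule: infinite_finite_induct) (auto intro: L2_zero L2_add)

lemma L2_inner_commute: "L2_inner \<Omega> u v = L2_inner \<Omega> v u"
  by (simp add: L2_inner_def inner_commute)

lemma L2_inner_add_left:
  "u \<in> L2 \<Omega> \<Longrightarrow> v \<in> L2 \<Omega> \<Longrightarrow> w \<in> L2 \<Omega> \<Longrightarrow>
   L2_inner \<Omega> (\<lambda>x. u x + v x) w = L2_inner \<Omega> u w + L2_inner \<Omega> v w"
  by (simp add: L2_inner_def inner_add_left L2_inner_integrable)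

lemma L2_inner_scale_left: "L2_inner \<Omega> (\<lambda>x. c *\<^sub>R u x) w = c * L2_inner \<Omega> u w"
  by (simp add: L2_inner_def)

lemma L2_inner_cmult_left: "L2_inner \<Omega> (\<lambda>x. c * u x) w = c * L2_inner \<Omega> u w" for u :: "real ^ 'd \<Rightarrow> real"
  using L2_inner_scale_left[of \<Omega> c u w] by simp

lemma L2_inner_diff_left:
  "u \<in> L2 \<Omega> \<Longrightarrow> v \<in> L2 \<Omega> \<Longrightarrow> w \<in> L2 \<Omega> \<Longrightarrow>
   L2_inner \<Omega> (\<lambda>x. u x - v x) w = L2_inner \<Omega> u w - L2_inner \<Omega> v w"
  by (simp add: L2_inner_def inner_diff_left L2_inner_integrable)

lemma L2_inner_add_right:
  "u \<in> L2 \<Omega> \<Longrightarrow> v \<in> L2 \<Omega> \<Longrightarrow> w \<in> L2 \<Omega> \<Longrightarrow>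
   L2_inner \<Omega> w (\<lambda>x. u x + v x) = L2_inner \<Omega> w u + L2_inner \<Omega> w v"
  by (simp add: L2_inner_def inner_add_right L2_inner_integrable)

lemma L2_inner_scale_right: "L2_inner \<Omega> w (\<lambda>x. c *\<^sub>R u x) = c * L2_inner \<Omega> w u"
  by (simp add: L2_inner_def)

lemma L2_inner_diff_right:
  "u \<in> L2 \<Omega> \<Longrightarrow> v \<in> L2 \<Omega> \<Longrightarrow> w \<in> L2 \<Omega> \<Longrightarrow>
   L2_inner \<Omega> w (\<lambda>x. u x - v x) = L2_inner \<Omega> w u - L2_inner \<Omega> w v"
  by (simp add: L2_inner_def inner_diff_right L2_inner_integrable)

lemma L2_inner_cong:
  assumes "ae_eq \<Omega> u u'" "ae_eq \<Omega> v v'"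
    "u \<in> L2 \<Omega>" "u' \<in> L2 \<Omega>" "v \<in> L2 \<Omega>" "v' \<in> L2 \<Omega>"
  shows "L2_inner \<Omega> u v = L2_inner \<Omega> u' v'"
  unfolding L2_inner_def
proof (rule integral_cong_AE)
  show "AE x in lebesgue_on \<Omega>. u x \<bullet> v x = u' x \<bullet> v' x"
    using assms(1,2) unfolding ae_eq_def by eventually_elim simp
qed (intro borel_measurable_inner L2_measurable assms)+

lemma L2_inner_nonneg: "0 \<le> L2_inner \<Omega> u u"
  by (simp add: L2_inner_def)

lemma L2_norm_nonneg: "0 \<le> L2_norm \<Omega> u"
  by (simp add: L2_norm_def L2_inner_nonneg)

lemma L2_norm_power2: "(L2_norm \<Omega> u)\<^sup>2 = L2_inner \<Omega> u u"
  by (simp add: L2_norm_def L2_inner_nonneg)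

lemma L2_norm_cong: "ae_eq \<Omega> u v \<Longrightarrow> u \<in> L2 \<Omega> \<Longrightarrow> v \<in> L2 \<Omega> \<Longrightarrow> L2_norm \<Omega> u = L2_norm \<Omega> v"
  unfolding L2_norm_def using L2_inner_cong by metis

lemma L2_norm_eq_0_iff:
  assumes "u \<in> L2 \<Omega>"
  shows "L2_norm \<Omega> u = 0 \<longleftrightarrow> ae_eq \<Omega> u (\<lambda>x. 0)"
proof -
  have "L2_norm \<Omega> u = 0 \<longleftrightarrow> (LINT x|lebesgue_on \<Omega>. u x \<bullet> u x) = 0"
    by (simp add: L2_norm_def L2_inner_def)
  also have "\<dots> \<longleftrightarrow> (AE x in lebesgue_on \<Omega>. u x \<bullet> u x = 0)"
    by (rule integral_nonneg_eq_0_iff_AE[OF L2_inner_integrable[OF assms assms]]) simp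
  finally show ?thesis by (simp add: ae_eq_def)
qed

lemma L2_inner_ae_zero:
  assumes "ae_eq \<Omega> u (\<lambda>x. 0)" "u \<in> L2 \<Omega>" "w \<in> L2 \<Omega>"
  shows "L2_inner \<Omega> u w = 0" "L2_inner \<Omega> w u = 0"
  using L2_inner_cong[OF assms(1) _ assms(2) L2_zero assms(3,3)]
  by (simp_all add: ae_eq_def L2_inner_def inner_commute)

lemma L2_Cauchy_Schwarz:
  assumes "u \<in> L2 \<Omega>" "v \<in> L2 \<Omega>"
  shows "\<bar>L2_inner \<Omega> u v\<bar> \<le> L2_norm \<Omega> u * L2_norm \<Omega> v"
proof (cases "L2_norm \<Omega> v = 0")
  case True
  then show ?thesis using L2_inner_ae_zero[of \<Omega> v u] assms L2_norm_eq_0_iff[OF assms(2)] by simp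
next
  case False
  define p q where "p = L2_inner \<Omega> v v" and "q = L2_inner \<Omega> u v"
  have p: "p > 0" using False L2_inner_nonneg[of \<Omega> v] by (auto simp: p_def L2_norm_def less_le)
  let ?w = "\<lambda>x. p *\<^sub>R u x - q *\<^sub>R v x"
  have w: "?w \<in> L2 \<Omega>" by (intro L2_diff L2_scale assms)
  have "0 \<le> L2_inner \<Omega> ?w ?w" by (rule L2_inner_nonneg)
  also have "\<dots> = p * (p * L2_inner \<Omega> u u - q * q)"
    using w assms L2_inner_commute[of \<Omega> v u]
    by (simp add: L2_inner_diff_left L2_inner_diff_right L2_scale L2_inner_scale_left L2_inner_scale_right
        p_def[symmetric] q_def[symmetric] algebra_simps)
  finally have "q\<^sup>2 \<le> L2_inner \<Omega> u u * p" using p by (simp add: zero_le_mult_iff power2_eq_square mult.commute)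
  then have "\<bar>q\<bar>\<^sup>2 \<le> (L2_norm \<Omega> u * L2_norm \<Omega> v)\<^sup>2"
    by (simp add: power_mult_distrib L2_norm_power2 p_def)
  then show ?thesis unfolding q_def by (rule power2_le_imp_le) (simp add: L2_norm_nonneg)
qed

lemma L2_norm_triangle:
  assumes "u \<in> L2 \<Omega>" "v \<in> L2 \<Omega>"
  shows "L2_norm \<Omega> (\<lambda>x. u x + v x) \<le> L2_norm \<Omega> u + L2_norm \<Omega> v"
proof (rule power2_le_imp_le)
  have "(L2_norm \<Omega> (\<lambda>x. u x + v x))\<^sup>2 = L2_inner \<Omega> u u + 2 * L2_inner \<Omega> u v + L2_inner \<Omega> v v"
    using assms L2_inner_commute[of \<Omega> v u]
    by (simp add: L2_norm_power2 L2_inner_add_left L2_inner_add_right L2_add)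
  also have "\<dots> \<le> (L2_norm \<Omega> u + L2_norm \<Omega> v)\<^sup>2"
    using L2_Cauchy_Schwarz[OF assms] by (simp add: power2_sum L2_norm_power2)
  finally show "(L2_norm \<Omega> (\<lambda>x. u x + v x))\<^sup>2 \<le> (L2_norm \<Omega> u + L2_norm \<Omega> v)\<^sup>2" .
qed (simp add: L2_norm_nonneg)

lemma L2_norm_le_diff:
  assumes "u \<in> L2 \<Omega>" "v \<in> L2 \<Omega>"
  shows "L2_norm \<Omega> u \<le> L2_norm \<Omega> (\<lambda>x. u x - v x) + L2_norm \<Omega> v"
  using L2_norm_triangle[OF L2_diff[OF assms] assms(2)] by simp

lemma borel_measurable_vec_iff:
  fixes u :: "'a \<Rightarrow> 'b::euclidean_space ^ 'n"
  shows "u \<in> borel_measurable M \<longleftrightarrow> (\<forall>i. (\<lambda>x. u x $ i) \<in> borel_measurable M)"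
proof
  assume u: "u \<in> borel_measurable M"
  have "(\<lambda>y. y $ i) \<in> borel_measurable (borel :: ('b ^ 'n) measure)" for i :: 'n
    by (intro borel_measurable_continuous_onI continuous_intros)
  then show "\<forall>i. (\<lambda>x. u x $ i) \<in> borel_measurable M" using measurable_compose[OF u] by blast
next
  assume u: "\<forall>i. (\<lambda>x. u x $ i) \<in> borel_measurable M"
  have "(\<lambda>x. u x \<bullet> b) \<in> borel_measurable M" if b: "b \<in> Basis" for b
  proof -
    obtain i c where "b = axis i c" using b by (auto simp: Basis_vec_def)
    then show ?thesis using u by (auto simp: inner_axis intro!: borel_measurable_inner)
  qed
  then show "u \<in> borel_measurable M" by (subst borel_measurable_euclidean_space) blast
qed

lemma norm_vec_power2: "(norm x)\<^sup>2 = (\<Sum>i\<in>UNIV. (norm (x $ i))\<^sup>2)" for x :: "'b::real_inner ^ 'n"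
  by (simp add: norm_vec_def L2_set_def sum_nonneg)

lemma L2_vec_iff:
  fixes u :: "real ^ 'd \<Rightarrow> 'b::euclidean_space ^ 'n"
  shows "u \<in> L2 \<Omega> \<longleftrightarrow> (\<forall>i. (\<lambda>x. u x $ i) \<in> L2 \<Omega>)"
proof
  assume u: "u \<in> L2 \<Omega>"
  show "\<forall>i. (\<lambda>x. u x $ i) \<in> L2 \<Omega>"
  proof
    fix i
    have m: "(\<lambda>x. u x $ i) \<in> borel_measurable (lebesgue_on \<Omega>)"
      using L2_measurable[OF u] borel_measurable_vec_iff by blast
    have "(norm (u x $ i))\<^sup>2 \<le> (norm (u x))\<^sup>2" for x
      by (simp add: Finite_Cartesian_Product.norm_nth_le power_mono)
    then have "integrable (lebesgue_on \<Omega>) (\<lambda>x. (norm (u x $ i))\<^sup>2)"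
      using m by (intro Bochner_Integration.integrable_bound[OF L2_integrable[OF u]]) auto
    then show "(\<lambda>x. u x $ i) \<in> L2 \<Omega>" using m by (simp add: L2_def)
  qed
next
  assume "\<forall>i. (\<lambda>x. u x $ i) \<in> L2 \<Omega>"
  then show "u \<in> L2 \<Omega>"
    by (auto simp: L2_def borel_measurable_vec_iff[of u] norm_vec_power2)
qed

lemma L2_inner_vec:
  fixes u :: "real ^ 'd \<Rightarrow> 'b::euclidean_space ^ 'n"
  assumes "u \<in> L2 \<Omega>" "v \<in> L2 \<Omega>"
  shows "L2_inner \<Omega> u v = (\<Sum>i\<in>UNIV. L2_inner \<Omega> (\<lambda>x. u x $ i) (\<lambda>x. v x $ i))"
  using assms unfolding L2_inner_def inner_vec_def
  by (intro Bochner_Integration.integral_sum L2_inner_integrable) (auto simp: L2_vec_iff[of u] L2_vec_iff[of v])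

lemma L2_norm_nth_le:
  fixes u :: "real ^ 'd \<Rightarrow> 'b::euclidean_space ^ 'n"
  assumes "u \<in> L2 \<Omega>"
  shows "L2_norm \<Omega> (\<lambda>x. u x $ i) \<le> L2_norm \<Omega> u"
  unfolding L2_norm_def L2_inner_vec[OF assms assms]
  by (intro real_sqrt_le_mono member_le_sum) (auto simp: L2_inner_nonneg)

text \<open>
  This puts test functions and their partial derivatives into \<open>L2\<close>.
\<close>

lemma L2_bounded_support:
  fixes h :: "real ^ 'd \<Rightarrow> real"
  assumes "continuous_on UNIV h" "bounded {x. h x \<noteq> 0}" "\<Omega> \<in> sets lebesgue"
  shows "h \<in> L2 \<Omega>"
proof -
  have "bounded {x. (norm (h x))\<^sup>2 \<noteq> 0}" using assms(2) by simp
  then have "integrable lborel (\<lambda>x. (norm (h x))\<^sup>2)"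
    using assms(1) by (intro integrable_bounded_support continuous_intros)
  then have i: "integrable lebesgue (\<lambda>x. (norm (h x))\<^sup>2)"
    by (subst integrable_completion) auto
  have "integrable (lebesgue_on \<Omega>) (\<lambda>x. (norm (h x))\<^sup>2)"
    using integrable_mult_indicator[OF assms(3) i] assms(3) by (subst integrable_restrict_space) auto
  moreover have "h \<in> borel_measurable (lebesgue_on \<Omega>)"
    using borel_measurable_continuous_onI[OF assms(1)]
    by (intro measurable_restrict_space1 measurable_completion) simp
  ultimately show ?thesis by (simp add: L2_def)
qed

section \<open>Weak gradients and the inequalities of Poincare and Korn\<close>

locale bounded_open =
  fixes \<Omega> :: "(real ^ 'd) set"
  assumes open_dom: "open \<Omega>" and bounded_dom: "bounded \<Omega>"
begin

lemma sets_dom: "\<Omega> \<in> sets lebesgue"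
  using open_dom by auto

lemma finite_measure_dom: "finite_measure (lebesgue_on \<Omega>)"
  using lmeasurable_open[OF bounded_dom open_dom]
  by (intro finite_measureI) (auto simp: emeasure_restrict_space sets_dom fmeasurable_def)

lemma L2_imp_integrable:
  fixes u :: "real ^ 'd \<Rightarrow> real"
  assumes "u \<in> L2 \<Omega>" shows "integrable (lebesgue_on \<Omega>) u"
proof -
  interpret finite_measure "lebesgue_on \<Omega>" by (rule finite_measure_dom)
  have one: "(\<lambda>x. 1::real) \<in> L2 \<Omega>" by (auto simp: L2_def)
  show ?thesis using L2_inner_integrable[OF assms one] by simp
qed

lemma test_function_C_k: "\<psi> \<in> test_functions \<Omega> \<Longrightarrow> C_k k \<psi>"
  by (simp add: test_functions_def)

lemma test_function_continuous:
  assumes "\<psi> \<in> test_functions \<Omega>"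
  shows "continuous_on UNIV \<psi>" "continuous_on UNIV (partial_deriv i \<psi>)"
  using test_function_C_k[OF assms, of 0] test_function_C_k[OF assms, of "Suc 0"] by auto

lemma test_function_bounded_support: "\<psi> \<in> test_functions \<Omega> \<Longrightarrow> bounded {x. \<psi> x \<noteq> 0}"
  by (auto simp: test_functions_def dest!: compact_imp_bounded intro: bounded_subset closure_subset)

lemma test_function_eq_0:
  assumes "\<psi> \<in> test_functions \<Omega>" "x \<notin> \<Omega>"
  shows "\<psi> x = 0" "partial_deriv i \<psi> x = 0"
  using assms partial_deriv_support[of i \<psi>] closure_subset[of "{x. \<psi> x \<noteq> 0}"]
  by (auto simp: test_functions_def)

lemma test_function_L2:
  assumes "\<psi> \<in> test_functions \<Omega>"
  shows "\<psi> \<in> L2 \<Omega>" "partial_deriv i \<psi> \<in> L2 \<Omega>"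
  using test_function_continuous[OF assms] test_function_bounded_support[OF assms]
  by (auto intro!: L2_bounded_support sets_dom bounded_support_partial_deriv)

lemma L2_inner_test:
  fixes h1 h2 :: "real ^ 'd \<Rightarrow> real"
  assumes "continuous_on UNIV h1" "continuous_on UNIV h2" "\<And>x. x \<notin> \<Omega> \<Longrightarrow> h1 x = 0"
  shows "L2_inner \<Omega> h1 h2 = (LINT x|lborel. h1 x * h2 x)"
  unfolding L2_inner_def using assms sets_dom
  by (simp add: integral_lebesgue_on_eq_lborel borel_measurable_continuous_onI continuous_on_mult)

lemma weak_gradient_test:
  assumes \<psi>: "\<psi> \<in> test_functions \<Omega>"
  shows "weak_gradient \<Omega> \<psi> (\<lambda>x. \<chi> i. partial_deriv i \<psi> x)"
  unfolding weak_gradient_def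
proof (intro conjI ballI allI)
  show "(\<lambda>x. \<chi> i. partial_deriv i \<psi> x) \<in> L2 \<Omega>"
    using test_function_L2(2)[OF \<psi>] by (simp add: L2_vec_iff)
  fix \<theta> i assume \<theta>: "\<theta> \<in> test_functions \<Omega>"
  have "L2_inner \<Omega> \<psi> (partial_deriv i \<theta>) = - L2_inner \<Omega> (partial_deriv i \<psi>) \<theta>"
    using integral_by_parts[OF test_function_C_k[OF \<psi>] test_function_bounded_support[OF \<psi>] test_function_C_k[OF \<theta>]]
    by (simp add: L2_inner_test test_function_eq_0[OF \<psi>] test_function_continuous[OF \<psi>] test_function_continuous[OF \<theta>])
  then show "(LINT x|lebesgue_on \<Omega>. \<psi> x * partial_deriv i \<theta> x) =
      - (LINT x|lebesgue_on \<Omega>. (\<chi> i. partial_deriv i \<psi> x) $ i * \<theta> x)"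
    by (simp add: L2_inner_def)
qed

lemma weak_gradient_iff:
  "weak_gradient \<Omega> u G \<longleftrightarrow> G \<in> L2 \<Omega> \<and> (\<forall>\<psi>\<in>test_functions \<Omega>. \<forall>i.
     L2_inner \<Omega> u (partial_deriv i \<psi>) = - L2_inner \<Omega> (\<lambda>x. G x $ i) \<psi>)"
  by (simp add: weak_gradient_def L2_inner_def)

text \<open>
  Every linearity property of the chosen gradients rests on this.
\<close>

lemma weak_gradient_unique:
  assumes G: "weak_gradient \<Omega> u G" and H: "weak_gradient \<Omega> u H"
  shows "ae_eq \<Omega> G H"
proof -
  have L: "(\<lambda>x. G x $ i) \<in> L2 \<Omega>" "(\<lambda>x. H x $ i) \<in> L2 \<Omega>" for i
    using G H L2_vec_iff unfolding weak_gradient_def by blast+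
  have "AE x in lebesgue_on \<Omega>. G x $ i - H x $ i = 0" for i
  proof (rule fundamental_lemma_of_variations[OF open_dom])
    show "integrable (lebesgue_on \<Omega>) (\<lambda>x. G x $ i - H x $ i)"
      by (intro L2_imp_integrable L2_diff L)
    fix \<psi> assume \<psi>: "\<psi> \<in> test_functions \<Omega>"
    have "L2_inner \<Omega> (\<lambda>x. G x $ i - H x $ i) \<psi> = 0"
      using G H \<psi> by (simp add: L2_inner_diff_left L test_function_L2[OF \<psi>] weak_gradient_iff)
    then show "(LINT x|lebesgue_on \<Omega>. (G x $ i - H x $ i) * \<psi> x) = 0" by (simp add: L2_inner_def)
  qed
  then have "AE x in lebesgue_on \<Omega>. \<forall>i. G x $ i - H x $ i = 0"
    by (subst AE_all_countable) auto
  then show ?thesis unfolding ae_eq_def by eventually_elim (simp add: vec_eq_iff)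
qed

lemma weak_gradient_grad: "u \<in> H1 \<Omega> \<Longrightarrow> weak_gradient \<Omega> u (grad \<Omega> u)"
  using someI_ex[of "weak_gradient \<Omega> u"] by (simp add: H1_def grad_def)

lemma H1_L2: "u \<in> H1 \<Omega> \<Longrightarrow> u \<in> L2 \<Omega>"
  by (simp add: H1_def)

lemma grad_L2: "u \<in> H1 \<Omega> \<Longrightarrow> grad \<Omega> u \<in> L2 \<Omega>"
  using weak_gradient_grad by (simp add: weak_gradient_def)

lemma H1_I: "u \<in> L2 \<Omega> \<Longrightarrow> weak_gradient \<Omega> u G \<Longrightarrow> u \<in> H1 \<Omega>"
  by (auto simp: H1_def)

lemma grad_unique: "u \<in> L2 \<Omega> \<Longrightarrow> weak_gradient \<Omega> u G \<Longrightarrow> ae_eq \<Omega> (grad \<Omega> u) G"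
  by (rule weak_gradient_unique[OF weak_gradient_grad]) (auto simp: H1_def)

lemma weak_gradient_add:
  assumes "u \<in> L2 \<Omega>" "v \<in> L2 \<Omega>" "weak_gradient \<Omega> u G" "weak_gradient \<Omega> v H"
  shows "weak_gradient \<Omega> (\<lambda>x. u x + v x) (\<lambda>x. G x + H x)"
  using assms L2_vec_iff[of G \<Omega>] L2_vec_iff[of H \<Omega>]
  by (simp add: weak_gradient_iff L2_add L2_inner_add_left test_function_L2)

lemma weak_gradient_scale:
  assumes "weak_gradient \<Omega> u G"
  shows "weak_gradient \<Omega> (\<lambda>x. c * u x) (\<lambda>x. c *\<^sub>R G x)"
  using assms by (simp add: weak_gradient_iff L2_scale L2_inner_cmult_left)

lemma H1_add:
  assumes "u \<in> H1 \<Omega>" "v \<in> H1 \<Omega>"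
  shows "(\<lambda>x. u x + v x) \<in> H1 \<Omega>" "ae_eq \<Omega> (grad \<Omega> (\<lambda>x. u x + v x)) (\<lambda>x. grad \<Omega> u x + grad \<Omega> v x)"
  using weak_gradient_add[OF H1_L2[OF assms(1)] H1_L2[OF assms(2)] weak_gradient_grad[OF assms(1)] weak_gradient_grad[OF assms(2)]]
    L2_add[OF H1_L2[OF assms(1)] H1_L2[OF assms(2)]]
  by (auto intro: H1_I grad_unique)

lemma H1_scale:
  assumes "u \<in> H1 \<Omega>"
  shows "(\<lambda>x. c * u x) \<in> H1 \<Omega>" "ae_eq \<Omega> (grad \<Omega> (\<lambda>x. c * u x)) (\<lambda>x. c *\<^sub>R grad \<Omega> u x)"
  using weak_gradient_scale[OF weak_gradient_grad[OF assms]] L2_cmult[OF H1_L2[OF assms]]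
  by (auto intro: H1_I grad_unique)

lemma H1_diff:
  assumes "u \<in> H1 \<Omega>" "v \<in> H1 \<Omega>"
  shows "(\<lambda>x. u x - v x) \<in> H1 \<Omega>" "ae_eq \<Omega> (grad \<Omega> (\<lambda>x. u x - v x)) (\<lambda>x. grad \<Omega> u x - grad \<Omega> v x)"
proof -
  have *: "(\<lambda>x. u x + (-1) * v x) = (\<lambda>x. u x - v x)" by simp
  show "(\<lambda>x. u x - v x) \<in> H1 \<Omega>" using H1_add(1)[OF assms(1) H1_scale(1)[OF assms(2), of "-1"]] unfolding * .
  have "ae_eq \<Omega> (grad \<Omega> (\<lambda>x. u x - v x)) (\<lambda>x. grad \<Omega> u x + grad \<Omega> (\<lambda>x. (-1) * v x) x)"
    using H1_add(2)[OF assms(1) H1_scale(1)[OF assms(2), of "-1"]] unfolding * .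
  with H1_scale(2)[OF assms(2), of "-1"]
  show "ae_eq \<Omega> (grad \<Omega> (\<lambda>x. u x - v x)) (\<lambda>x. grad \<Omega> u x - grad \<Omega> v x)"
    unfolding ae_eq_def by eventually_elim simp
qed

lemma test_function_H1:
  assumes "\<psi> \<in> test_functions \<Omega>"
  shows "\<psi> \<in> H1 \<Omega>" "ae_eq \<Omega> (grad \<Omega> \<psi>) (\<lambda>x. \<chi> i. partial_deriv i \<psi> x)"
  using weak_gradient_test[OF assms] test_function_L2[OF assms] by (auto intro: H1_I grad_unique)

lemma grad_test_nth:
  assumes "\<psi> \<in> test_functions \<Omega>"
  shows "ae_eq \<Omega> (\<lambda>x. grad \<Omega> \<psi> x $ i) (partial_deriv i \<psi>)"
  using test_function_H1(2)[OF assms] unfolding ae_eq_def by eventually_elim simp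

lemma H10_H1: "u \<in> H10 \<Omega> \<Longrightarrow> u \<in> H1 \<Omega>"
  by (simp add: H10_def)

text \<open>
  The norm in the definition of \<open>H10\<close> involves the gradient of the difference; here it is replaced by the
  difference of the gradients.
\<close>

lemma H10_approx:
  assumes u: "u \<in> H10 \<Omega>" and "e > 0"
  obtains \<psi> where "\<psi> \<in> test_functions \<Omega>" "L2_norm \<Omega> (\<lambda>x. u x - \<psi> x) < e"
    "L2_norm \<Omega> (\<lambda>x. grad \<Omega> u x - grad \<Omega> \<psi> x) < e"
proof -
  obtain \<psi> where \<psi>: "\<psi> \<in> test_functions \<Omega>" "H1_norm \<Omega> (\<lambda>x. u x - \<psi> x) < e"
    using assms by (auto simp: H10_def)
  note H1 = H10_H1[OF u] test_function_H1(1)[OF \<psi>(1)]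
  have "L2_norm \<Omega> (grad \<Omega> (\<lambda>x. u x - \<psi> x)) = L2_norm \<Omega> (\<lambda>x. grad \<Omega> u x - grad \<Omega> \<psi> x)"
    by (intro L2_norm_cong H1_diff H1 L2_diff grad_L2)
  moreover have "a \<le> sqrt (a\<^sup>2 + b\<^sup>2)" "b \<le> sqrt (a\<^sup>2 + b\<^sup>2)" for a b :: real
    by (auto intro!: real_le_rsqrt)
  ultimately show thesis
    using \<psi> by (intro that[OF \<psi>(1)]) (smt (verit) H1_norm_def)+
qed

text \<open>
  Integrating \<open>\<partial>\<^sub>i (x\<^sub>i \<psi>\<^sup>2)\<close> gives \<open>\<integral> \<psi>\<^sup>2 = - 2 \<integral> x\<^sub>i \<psi> \<partial>\<^sub>i \<psi>\<close>, where by Young's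
  inequality the right-hand side is at most half of the left-hand side plus a multiple of \<open>\<integral> (\<partial>\<^sub>i \<psi>)\<^sup>2\<close>. Any coordinate direction will do.
\<close>

lemma poincare_test:
  assumes \<psi>: "\<psi> \<in> test_functions \<Omega>" and R: "\<And>x. x \<in> \<Omega> \<Longrightarrow> norm x \<le> R" "R \<ge> 0"
  shows "L2_norm \<Omega> \<psi> \<le> 2 * R * L2_norm \<Omega> (grad \<Omega> \<psi>)"
proof -
  fix i :: 'd
  let ?f = "\<lambda>x. x $ i * (\<psi> x * \<psi> x)"
  note C = test_function_C_k[OF \<psi>, of "Suc 0"]
  note c = test_function_continuous[OF \<psi>]
  note b = test_function_bounded_support[OF \<psi>]
  have d: "\<psi> differentiable (at x)" for x using C by simp
  have pd: "partial_deriv i ?f x = \<psi> x * \<psi> x + 2 * x $ i * \<psi> x * partial_deriv i \<psi> x" for x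
  proof -
    have n: "((\<lambda>x. x $ i) has_derivative (\<lambda>h. h $ i)) (at x)" for x :: "real ^ 'd"
      by (rule bounded_linear.has_derivative[OF bounded_linear_vec_nth]) (rule has_derivative_ident)
    then have dn: "(\<lambda>x::real^'d. x $ i) differentiable (at x)" for x by (auto simp: differentiable_def)
    show ?thesis
      using partial_deriv_mult[OF dn differentiable_mult[OF d d], of i x] partial_deriv_mult[OF d d, of i x]
        partial_deriv_eq[OF n, of i x] by (simp add: algebra_simps)
  qed
  have int: "integrable lborel (\<lambda>x. h x * k x)"
    if "continuous_on UNIV h" "continuous_on UNIV k" "bounded {x. h x \<noteq> 0}" for h k :: "real ^ 'd \<Rightarrow> real"
    using that by (intro integrable_bounded_support continuous_on_mult bounded_support_mult)
  have i1: "integrable lborel (\<lambda>x. \<psi> x * \<psi> x)" using c b by (intro int)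
  have i2: "integrable lborel (\<lambda>x. partial_deriv i \<psi> x * partial_deriv i \<psi> x)"
    using c b by (intro int bounded_support_partial_deriv)
  have i3: "integrable lborel (\<lambda>x. 2 * x $ i * \<psi> x * partial_deriv i \<psi> x)"
    using c b by (intro int continuous_intros bounded_support_mult)
  have "(LINT x|lborel. partial_deriv i ?f x) = 0"
  proof (rule integral_partial_deriv_eq_0)
    show "C_k (Suc 0) ?f" by (intro C_k_mult C_k_nth C)
    show "bounded {x. ?f x \<noteq> 0}" by (intro bounded_support_mult b)
  qed
  then have "(LINT x|lborel. \<psi> x * \<psi> x) = (LINT x|lborel. - (2 * x $ i * \<psi> x * partial_deriv i \<psi> x))"
    unfolding pd using i1 i3 by simp
  also have "\<dots> \<le> (LINT x|lborel. 1/2 * (\<psi> x * \<psi> x) + 2 * R\<^sup>2 * (partial_deriv i \<psi> x * partial_deriv i \<psi> x))"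
  proof (rule integral_mono)
    show "integrable lborel (\<lambda>x. - (2 * x $ i * \<psi> x * partial_deriv i \<psi> x))" using i3 by simp
    show "integrable lborel (\<lambda>x. 1/2 * (\<psi> x * \<psi> x) + 2 * R\<^sup>2 * (partial_deriv i \<psi> x * partial_deriv i \<psi> x))"
      using i1 i2 by simp
    fix x
    show "- (2 * x $ i * \<psi> x * partial_deriv i \<psi> x) \<le> 1/2 * (\<psi> x * \<psi> x) + 2 * R\<^sup>2 * (partial_deriv i \<psi> x * partial_deriv i \<psi> x)"
    proof (cases "x \<in> \<Omega>")
      case True
      then have "\<bar>x $ i\<bar> \<le> R" using R(1) component_le_norm_cart[of x i] by fastforce
      then have "(x $ i)\<^sup>2 \<le> R\<^sup>2" using R(2) by (simp add: abs_le_square_iff[symmetric])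
      then have "2 * (x $ i)\<^sup>2 * (partial_deriv i \<psi> x)\<^sup>2 \<le> 2 * R\<^sup>2 * (partial_deriv i \<psi> x)\<^sup>2"
        by (simp add: mult_right_mono)
      moreover have "0 \<le> (\<psi> x / 2 + x $ i * partial_deriv i \<psi> x)\<^sup>2" by simp
      ultimately show ?thesis by (simp add: power2_sum power_mult_distrib power_divide power2_eq_square algebra_simps)
    next
      case False
      then show ?thesis using test_function_eq_0[OF \<psi>] by simp
    qed
  qed
  also have "\<dots> = 1/2 * (LINT x|lborel. \<psi> x * \<psi> x) + 2 * R\<^sup>2 * (LINT x|lborel. partial_deriv i \<psi> x * partial_deriv i \<psi> x)"
    using i1 i2 by simp
  finally have "(LINT x|lborel. \<psi> x * \<psi> x) \<le> 4 * R\<^sup>2 * (LINT x|lborel. partial_deriv i \<psi> x * partial_deriv i \<psi> x)"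
    by simp
  then have "L2_inner \<Omega> \<psi> \<psi> \<le> 4 * R\<^sup>2 * L2_inner \<Omega> (partial_deriv i \<psi>) (partial_deriv i \<psi>)"
    using c test_function_eq_0[OF \<psi>] by (simp add: L2_inner_test)
  then have "(L2_norm \<Omega> \<psi>)\<^sup>2 \<le> (2 * R * L2_norm \<Omega> (partial_deriv i \<psi>))\<^sup>2"
    by (simp add: L2_norm_power2 power_mult_distrib)
  then have "L2_norm \<Omega> \<psi> \<le> 2 * R * L2_norm \<Omega> (partial_deriv i \<psi>)"
    by (rule power2_le_imp_le) (simp add: R L2_norm_nonneg)
  also have "L2_norm \<Omega> (partial_deriv i \<psi>) = L2_norm \<Omega> (\<lambda>x. grad \<Omega> \<psi> x $ i)"
    using grad_test_nth[OF \<psi>, of i] grad_L2[OF test_function_H1(1)[OF \<psi>]] test_function_L2[OF \<psi>]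
    by (intro L2_norm_cong) (auto simp: ae_eq_def L2_vec_iff[of "grad \<Omega> \<psi>"])
  also have "2 * R * \<dots> \<le> 2 * R * L2_norm \<Omega> (grad \<Omega> \<psi>)"
    by (intro mult_left_mono L2_norm_nth_le grad_L2 test_function_H1 \<psi>) (simp add: R)
  finally show ?thesis .
qed

lemma poincare:
  obtains P where "P > 0" "\<And>u. u \<in> H10 \<Omega> \<Longrightarrow> L2_norm \<Omega> u \<le> P * L2_norm \<Omega> (grad \<Omega> u)"
proof -
  obtain R where R: "R > 0" "\<And>x. x \<in> \<Omega> \<Longrightarrow> norm x \<le> R"
    using bounded_dom bounded_pos by blast
  show thesis
  proof (rule that[of "2 * R"])
    fix u assume u: "u \<in> H10 \<Omega>"
    show "L2_norm \<Omega> u \<le> 2 * R * L2_norm \<Omega> (grad \<Omega> u)"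
    proof (rule field_le_epsilon)
      fix e :: real assume e: "e > 0"
      \<comment> \<open>chosen so that the error terms \<open>e'\<close> and \<open>2 R e'\<close> add up to \<open>e\<close>\<close>
      define e' where "e' = e / (1 + 2 * R)"
      have "e' * (1 + 2 * R) = e" using R by (simp add: e'_def)
      then have e': "e' > 0" "e' + 2 * R * e' = e"
        using e R by (simp add: e'_def, simp add: algebra_simps)
      obtain \<psi> where \<psi>: "\<psi> \<in> test_functions \<Omega>" "L2_norm \<Omega> (\<lambda>x. u x - \<psi> x) < e'"
          "L2_norm \<Omega> (\<lambda>x. grad \<Omega> u x - grad \<Omega> \<psi> x) < e'"
        using H10_approx[OF u e'(1)] .
      have "L2_norm \<Omega> u \<le> e' + L2_norm \<Omega> \<psi>"
        using L2_norm_le_diff[of u \<Omega> \<psi>] \<psi> u by (simp add: H1_L2 H10_H1 test_function_L2)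
      also have "L2_norm \<Omega> \<psi> \<le> 2 * R * L2_norm \<Omega> (grad \<Omega> \<psi>)"
        using poincare_test[OF \<psi>(1) R(2)] R by simp
      also have "L2_norm \<Omega> (grad \<Omega> \<psi>) \<le> L2_norm \<Omega> (grad \<Omega> u) + e'"
      proof -
        have L: "grad \<Omega> u \<in> L2 \<Omega>" "grad \<Omega> \<psi> \<in> L2 \<Omega>"
          using u \<psi> by (auto intro: grad_L2 H10_H1 test_function_H1)
        have "L2_norm \<Omega> (\<lambda>x. grad \<Omega> \<psi> x - grad \<Omega> u x) = L2_norm \<Omega> (\<lambda>x. grad \<Omega> u x - grad \<Omega> \<psi> x)"
          by (simp add: L2_norm_def L2_inner_def power2_norm_eq_inner[symmetric] norm_minus_commute)
        then show ?thesis using L2_norm_le_diff[OF L(2,1)] \<psi>(3) by simp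
      qed
      finally show "L2_norm \<Omega> u \<le> 2 * R * L2_norm \<Omega> (grad \<Omega> u) + e"
        using e' R by (simp add: algebra_simps)
    qed
  qed (use R in simp)
qed

text \<open>
  The difference \<open>J\<close> of the two sides is bilinear and bounded by the norms of the two gradients, and it
  vanishes on gradients of test functions. These are dense.
\<close>

lemma H10_mixed_partials:
  assumes u: "u \<in> H10 \<Omega>" and v: "v \<in> H10 \<Omega>"
  shows "L2_inner \<Omega> (\<lambda>x. grad \<Omega> u x $ i) (\<lambda>x. grad \<Omega> v x $ j) =
         L2_inner \<Omega> (\<lambda>x. grad \<Omega> u x $ j) (\<lambda>x. grad \<Omega> v x $ i)"
proof -
  define J where "J G H = L2_inner \<Omega> (\<lambda>x. G x $ i) (\<lambda>x. H x $ j) - L2_inner \<Omega> (\<lambda>x. G x $ j) (\<lambda>x. H x $ i)"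
    for G H :: "real ^ 'd \<Rightarrow> real ^ 'd"
  have nth: "(\<lambda>x. G x $ k) \<in> L2 \<Omega>" if "G \<in> L2 \<Omega>" for G :: "real ^ 'd \<Rightarrow> real ^ 'd" and k
    using that L2_vec_iff by blast
  have J_le: "\<bar>J G H\<bar> \<le> 2 * (L2_norm \<Omega> G * L2_norm \<Omega> H)" if "G \<in> L2 \<Omega>" "H \<in> L2 \<Omega>" for G H
  proof -
    have "\<bar>L2_inner \<Omega> (\<lambda>x. G x $ k) (\<lambda>x. H x $ l)\<bar> \<le> L2_norm \<Omega> G * L2_norm \<Omega> H" for k l
    proof -
      have "\<bar>L2_inner \<Omega> (\<lambda>x. G x $ k) (\<lambda>x. H x $ l)\<bar> \<le> L2_norm \<Omega> (\<lambda>x. G x $ k) * L2_norm \<Omega> (\<lambda>x. H x $ l)"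
        by (intro L2_Cauchy_Schwarz nth that)
      also have "\<dots> \<le> L2_norm \<Omega> G * L2_norm \<Omega> H"
        by (intro mult_mono L2_norm_nth_le that L2_norm_nonneg)
      finally show ?thesis .
    qed
    from this[of i j] this[of j i] show ?thesis unfolding J_def by linarith
  qed
  have J_diff: "J (\<lambda>x. G x - G' x) H = J G H - J G' H" "J H (\<lambda>x. G x - G' x) = J H G - J H G'"
    if "G \<in> L2 \<Omega>" "G' \<in> L2 \<Omega>" "H \<in> L2 \<Omega>" for G G' H
    using that by (simp_all add: J_def L2_inner_diff_left L2_inner_diff_right nth)
  have J_test: "J (grad \<Omega> \<psi>) (grad \<Omega> \<theta>) = 0" if "\<psi> \<in> test_functions \<Omega>" "\<theta> \<in> test_functions \<Omega>" for \<psi> \<theta>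
  proof -
    note t = that
    have "L2_inner \<Omega> (\<lambda>x. grad \<Omega> \<psi> x $ k) (\<lambda>x. grad \<Omega> \<theta> x $ l) =
        (LINT x|lborel. partial_deriv k \<psi> x * partial_deriv l \<theta> x)" for k l
    proof -
      have "L2_inner \<Omega> (\<lambda>x. grad \<Omega> \<psi> x $ k) (\<lambda>x. grad \<Omega> \<theta> x $ l) =
          L2_inner \<Omega> (partial_deriv k \<psi>) (partial_deriv l \<theta>)"
        by (intro L2_inner_cong grad_test_nth nth grad_L2 test_function_H1 test_function_L2 t)
      then show ?thesis
        by (simp add: L2_inner_test test_function_continuous[OF t(1)] test_function_continuous[OF t(2)] test_function_eq_0[OF t(1)])
    qed
    then show ?thesis
      unfolding J_def
      using integral_mixed_partials[OF test_function_C_k[OF t(1)] test_function_bounded_support[OF t(1)]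
          test_function_C_k[OF t(2)] test_function_bounded_support[OF t(2)], of i j] by simp
  qed
  let ?u = "grad \<Omega> u" and ?v = "grad \<Omega> v"
  have uv: "?u \<in> L2 \<Omega>" "?v \<in> L2 \<Omega>" using u v by (auto intro: grad_L2 H10_H1)
  define c where "c = 2 * L2_norm \<Omega> ?v + 2 * L2_norm \<Omega> ?u + 2"
  have c: "c > 0" unfolding c_def using L2_norm_nonneg[of \<Omega> ?u] L2_norm_nonneg[of \<Omega> ?v] by linarith
  have bound: "\<bar>J ?u ?v\<bar> \<le> e * c" if e: "0 < e" "e \<le> 1" for e
  proof -
    obtain \<psi> where \<psi>: "\<psi> \<in> test_functions \<Omega>" "L2_norm \<Omega> (\<lambda>x. ?u x - grad \<Omega> \<psi> x) < e"
      using H10_approx[OF u e(1)] by metis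
    obtain \<theta> where \<theta>: "\<theta> \<in> test_functions \<Omega>" "L2_norm \<Omega> (\<lambda>x. ?v x - grad \<Omega> \<theta> x) < e"
      using H10_approx[OF v e(1)] by metis
    let ?p = "grad \<Omega> \<psi>" and ?q = "grad \<Omega> \<theta>"
    have pq: "?p \<in> L2 \<Omega>" "?q \<in> L2 \<Omega>" using \<psi> \<theta> by (auto intro: grad_L2 test_function_H1)
    have "J ?u ?v = J (\<lambda>x. ?u x - ?p x) ?v + J ?u (\<lambda>x. ?v x - ?q x) - J (\<lambda>x. ?u x - ?p x) (\<lambda>x. ?v x - ?q x)"
      using J_test[OF \<psi>(1) \<theta>(1)] by (simp add: J_diff uv pq L2_diff)
    moreover have "\<bar>J (\<lambda>x. ?u x - ?p x) ?v + J ?u (\<lambda>x. ?v x - ?q x) - J (\<lambda>x. ?u x - ?p x) (\<lambda>x. ?v x - ?q x)\<bar> \<le> 2 * (e * L2_norm \<Omega> ?v) + 2 * (L2_norm \<Omega> ?u * e) + 2 * (e * 1)"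
    proof -
      have "\<bar>J (\<lambda>x. ?u x - ?p x) ?v\<bar> \<le> 2 * (e * L2_norm \<Omega> ?v)"
        using \<psi>(2) by (intro order_trans[OF J_le[OF L2_diff[OF uv(1) pq(1)] uv(2)]] mult_left_mono mult_right_mono L2_norm_nonneg) simp_all
      moreover have "\<bar>J ?u (\<lambda>x. ?v x - ?q x)\<bar> \<le> 2 * (L2_norm \<Omega> ?u * e)"
        using \<theta>(2) by (intro order_trans[OF J_le[OF uv(1) L2_diff[OF uv(2) pq(2)]]] mult_left_mono L2_norm_nonneg) simp_all
      moreover have "\<bar>J (\<lambda>x. ?u x - ?p x) (\<lambda>x. ?v x - ?q x)\<bar> \<le> 2 * (e * 1)"
        using \<psi>(2) \<theta>(2) e by (intro order_trans[OF J_le[OF L2_diff[OF uv(1) pq(1)] L2_diff[OF uv(2) pq(2)]]]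
            mult_left_mono mult_mono L2_norm_nonneg) simp_all
      ultimately show ?thesis by linarith
    qed
    ultimately show ?thesis by (simp add: c_def algebra_simps)
  qed
  have "\<bar>J ?u ?v\<bar> \<le> 0"
  proof (rule field_le_epsilon)
    fix e :: real assume "e > 0"
    then have "\<bar>J ?u ?v\<bar> \<le> min 1 (e / c) * c" using c by (intro bound) auto
    also have "\<dots> \<le> e / c * c" using c by (intro mult_right_mono) auto
    finally show "\<bar>J ?u ?v\<bar> \<le> 0 + e" using c by simp
  qed
  then show ?thesis by (simp add: J_def)
qed

lemma grad_vec_L2: "d \<in> H10_vec \<Omega> \<Longrightarrow> grad_vec \<Omega> d \<in> L2 \<Omega>"
  by (auto simp: L2_vec_iff[of "grad_vec \<Omega> d"] grad_vec_def H10_vec_def intro!: grad_L2 H10_H1)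

lemma grad_vec_nth_L2: "d \<in> H10_vec \<Omega> \<Longrightarrow> (\<lambda>x. grad_vec \<Omega> d x $ i $ j) \<in> L2 \<Omega>"
  using grad_vec_L2 by (metis L2_vec_iff)

lemma transpose_grad_vec_L2: "d \<in> H10_vec \<Omega> \<Longrightarrow> (\<lambda>x. transpose (grad_vec \<Omega> d x)) \<in> L2 \<Omega>"
  unfolding L2_vec_iff using grad_vec_nth_L2 by (simp add: transpose_def)

lemma H10_vec_L2: "d \<in> H10_vec \<Omega> \<Longrightarrow> d \<in> L2 \<Omega>"
  by (auto simp: L2_vec_iff[of d] H10_vec_def intro!: H1_L2 H10_H1)

lemma sym_grad_L2: "d \<in> H10_vec \<Omega> \<Longrightarrow> sym_grad \<Omega> d \<in> L2 \<Omega>"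
  unfolding sym_grad_def[abs_def] by (intro L2_scale L2_add grad_vec_L2 transpose_grad_vec_L2)

lemma divergence_L2: "d \<in> H10_vec \<Omega> \<Longrightarrow> divergence \<Omega> d \<in> L2 \<Omega>"
  unfolding divergence_def[abs_def] by (intro L2_sum grad_vec_nth_L2)

text \<open>
  Expanding the square, \<open>2 |\<epsilon>(d)|\<^sup>2 = |\<nabla> d|\<^sup>2 + \<nabla> d : (\<nabla> d)\<^sup>T\<close>, and by exchanging the mixed partial derivatives the
  last term integrates to the squared norm of the divergence, which is nonnegative.
\<close>

lemma korn:
  assumes d: "d \<in> H10_vec \<Omega>"
  shows "(L2_norm \<Omega> (grad_vec \<Omega> d))\<^sup>2 \<le> 2 * (L2_norm \<Omega> (sym_grad \<Omega> d))\<^sup>2"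
proof -
  let ?D = "grad_vec \<Omega> d"
  let ?T = "\<lambda>x. transpose (?D x)"
  have D: "?D \<in> L2 \<Omega>" by (rule grad_vec_L2[OF d])
  have T: "?T \<in> L2 \<Omega>"
    by (rule transpose_grad_vec_L2[OF d])
  have comp: "L2_inner \<Omega> A B = (\<Sum>i\<in>UNIV. \<Sum>j\<in>UNIV. L2_inner \<Omega> (\<lambda>x. A x $ i $ j) (\<lambda>x. B x $ i $ j))"
    if "A \<in> L2 \<Omega>" "B \<in> L2 \<Omega>" for A B :: "real ^ 'd \<Rightarrow> real ^ 'd ^ 'd"
    using that by (simp add: L2_inner_vec L2_vec_iff)
  have TT: "L2_inner \<Omega> ?T ?T = L2_inner \<Omega> ?D ?D"
    unfolding comp[OF T T] comp[OF D D] by (subst sum.swap) (simp add: transpose_def)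
  have "L2_inner \<Omega> ?D ?T = (\<Sum>i\<in>UNIV. \<Sum>j\<in>UNIV. L2_inner \<Omega> (\<lambda>x. ?D x $ i $ j) (\<lambda>x. ?D x $ j $ i))"
    unfolding comp[OF D T] by (simp add: transpose_def)
  also have "\<dots> = (\<Sum>i\<in>UNIV. \<Sum>j\<in>UNIV. L2_inner \<Omega> (\<lambda>x. ?D x $ i $ i) (\<lambda>x. ?D x $ j $ j))"
    using d by (intro sum.cong refl) (simp add: grad_vec_def H10_vec_def H10_mixed_partials)
  also have "\<dots> = L2_inner \<Omega> (divergence \<Omega> d) (divergence \<Omega> d)"
    unfolding L2_inner_def divergence_def inner_sum_left inner_sum_right
    using L2_inner_integrable[OF grad_vec_nth_L2[OF d] grad_vec_nth_L2[OF d]]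
    by simp (rule sum.swap)
  finally have "0 \<le> L2_inner \<Omega> ?D ?T" by (simp add: L2_inner_nonneg)
  moreover have "L2_inner \<Omega> (sym_grad \<Omega> d) (sym_grad \<Omega> d) = 1/4 * L2_inner \<Omega> (\<lambda>x. ?D x + ?T x) (\<lambda>x. ?D x + ?T x)"
    unfolding sym_grad_def[abs_def] L2_inner_scale_left L2_inner_scale_right by simp
  moreover have "\<dots> = 1/2 * L2_inner \<Omega> ?D ?D + 1/2 * L2_inner \<Omega> ?D ?T"
    using D T TT L2_inner_commute[of \<Omega> ?T ?D] by (simp add: L2_inner_add_left L2_inner_add_right L2_add)
  ultimately show ?thesis by (simp add: L2_norm_power2)
qed

end

section \<open>Solvability of Galerkin systems\<close>

text \<open>
  By induction on the family: restrict to the kernel of one functional \<open>L i\<close>, represent \<open>F\<close> there by the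
  others, and correct by a multiple of \<open>L i\<close>. The domain is not required to be a vector space: it suffices that
  the values of the functionals behave as if linear combinations could be formed in it. This allows it to be
  applied to sets of tuples of functions.
\<close>

lemma functional_in_span_of_finite_family:
  fixes F :: "'w \<Rightarrow> real" and L :: "'j \<Rightarrow> 'w \<Rightarrow> real"
  assumes "finite J"
    and "\<And>w w' c. w \<in> W \<Longrightarrow> w' \<in> W \<Longrightarrow>
      \<exists>z\<in>W. F z = F w + c * F w' \<and> (\<forall>j\<in>J. L j z = L j w + c * L j w')"
    and "\<And>w. w \<in> W \<Longrightarrow> (\<forall>j\<in>J. L j w = 0) \<Longrightarrow> F w = 0"
  shows "\<exists>c. \<forall>w\<in>W. F w = (\<Sum>j\<in>J. c j * L j w)"
  using assms
proof (induction J arbitrary: W rule: finite_induct)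
  case empty
  then show ?case by auto
next
  case (insert i J)
  let ?W = "{w \<in> W. L i w = 0}"
  have "\<exists>c. \<forall>w\<in>?W. F w = (\<Sum>j\<in>J. c j * L j w)"
  proof (rule insert.IH)
    fix w w' c assume w: "w \<in> ?W" "w' \<in> ?W"
    then obtain z where "z \<in> W" "F z = F w + c * F w'" "\<forall>j\<in>insert i J. L j z = L j w + c * L j w'"
      using insert.prems(1) by blast
    then show "\<exists>z\<in>?W. F z = F w + c * F w' \<and> (\<forall>j\<in>J. L j z = L j w + c * L j w')"
      using w by (intro bexI[of _ z]) auto
  qed (use insert.prems(2) in auto)
  then obtain c where c: "\<And>w. w \<in> ?W \<Longrightarrow> F w = (\<Sum>j\<in>J. c j * L j w)" by blast
  show ?case
  proof (cases "\<exists>w0\<in>W. L i w0 \<noteq> 0")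
    case False
    then have "\<forall>w\<in>W. F w = (\<Sum>j\<in>insert i J. (c(i := 0)) j * L j w)"
      using c insert.hyps by (auto simp: sum.insert intro!: sum.cong)
    then show ?thesis by blast
  next
    case True
    then obtain w0 where w0: "w0 \<in> W" "L i w0 \<noteq> 0" by blast
    define e where "e = (F w0 - (\<Sum>j\<in>J. c j * L j w0)) / L i w0"
    have "F w = (\<Sum>j\<in>insert i J. (c(i := e)) j * L j w)" if w: "w \<in> W" for w
    proof -
      \<comment> \<open>\<open>w - t w0\<close> lies in the kernel of \<open>L i\<close>\<close>
      define t where "t = L i w / L i w0"
      obtain z where z: "z \<in> W" "F z = F w + (- t) * F w0" "\<forall>j\<in>insert i J. L j z = L j w + (- t) * L j w0"
        using insert.prems(1)[OF w w0(1)] by blast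
      have "F z = (\<Sum>j\<in>J. c j * L j z)" using z w0(2) by (intro c) (auto simp: t_def)
      also have "\<dots> = (\<Sum>j\<in>J. c j * L j w) - t * (\<Sum>j\<in>J. c j * L j w0)"
      proof -
        have "(\<Sum>j\<in>J. c j * L j z) = (\<Sum>j\<in>J. c j * L j w - t * (c j * L j w0))"
        proof (rule sum.cong)
          fix j assume "j \<in> J"
          then have "L j z = L j w + (- t) * L j w0" using z(3) by simp
          then show "c j * L j z = c j * L j w - t * (c j * L j w0)" by (simp only:) (simp add: algebra_simps)
        qed simp
        then show ?thesis by (simp add: sum_subtractf sum_distrib_left)
      qed
      finally have "F w = (\<Sum>j\<in>J. c j * L j w) + t * (F w0 - (\<Sum>j\<in>J. c j * L j w0))"
        using z(2) by (simp add: algebra_simps)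
      also have "t * (F w0 - (\<Sum>j\<in>J. c j * L j w0)) = e * L i w"
        by (simp add: t_def e_def)
      also have "(\<Sum>j\<in>J. c j * L j w) = (\<Sum>j\<in>J. (c(i := e)) j * L j w)"
        using insert.hyps by (intro sum.cong) auto
      finally show ?thesis using insert.hyps by simp
    qed
    then show ?thesis by blast
  qed
qed

text \<open>
  A square system is solvable if the load vanishes on the kernel of the transposed matrix. The finite set
  \<open>B\<close> plays the part of a basis of the trial space: by \<open>spans\<close>, testing against \<open>B\<close> detects all of \<open>S\<close>.
\<close>

lemma galerkin_solvable:
  fixes a :: "'v \<Rightarrow> 'v \<Rightarrow> real" and F :: "'v \<Rightarrow> real"
  assumes fin: "finite B" "B \<subseteq> S"
    and spans: "\<And>w. w \<in> S \<Longrightarrow> (\<forall>b\<in>B. a b w = 0) \<Longrightarrow> (\<forall>u\<in>S. a u w = 0)"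
    and kernel: "\<And>w. w \<in> S \<Longrightarrow> (\<forall>u\<in>S. a u w = 0) \<Longrightarrow> F w = 0"
    and zero: "\<exists>u\<in>S. \<forall>w\<in>S. a u w = 0"
    and left: "\<And>u u' c. u \<in> S \<Longrightarrow> u' \<in> S \<Longrightarrow> \<exists>z\<in>S. \<forall>w\<in>S. a z w = a u w + c * a u' w"
    and right: "\<And>w w' c. w \<in> S \<Longrightarrow> w' \<in> S \<Longrightarrow>
      \<exists>z\<in>S. F z = F w + c * F w' \<and> (\<forall>u\<in>S. a u z = a u w + c * a u w')"
  shows "\<exists>u\<in>S. \<forall>w\<in>S. a u w = F w"
proof -
  have "\<exists>c. \<forall>w\<in>S. F w = (\<Sum>b\<in>B. c b * a b w)"
  proof (rule functional_in_span_of_finite_family[OF fin(1)])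
    show "\<exists>z\<in>S. F z = F w + c * F w' \<and> (\<forall>b\<in>B. a b z = a b w + c * a b w')"
      if "w \<in> S" "w' \<in> S" for w w' c
      using right[OF that, of c] fin(2) by blast
  qed (use spans kernel in blast)
  then obtain c where c: "\<And>w. w \<in> S \<Longrightarrow> F w = (\<Sum>b\<in>B. c b * a b w)" by blast
  have "\<exists>u\<in>S. \<forall>w\<in>S. a u w = (\<Sum>b\<in>B'. c b * a b w)" if "B' \<subseteq> B" for B'
    using finite_subset[OF that fin(1)] that
  proof (induction B' rule: finite_induct)
    case empty
    then show ?case using zero by simp
  next
    case (insert b B')
    then obtain u where u: "u \<in> S" "\<forall>w\<in>S. a u w = (\<Sum>b\<in>B'. c b * a b w)" by auto
    have "b \<in> S" using insert.prems fin(2) by blast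
    from left[OF u(1) this, of "c b"] u(2) insert.hyps show ?case by (auto simp: add.commute)
  qed
  from this[of B] c show ?thesis by auto
qed

section \<open>Linearity modulo equality almost everywhere\<close>

text \<open>
  Functionals and operators that are linear on a set of representatives and do not see null sets. For
  operators into function spaces linearity can be asked only almost everywhere, because gradients are arbitrary
  representatives.
\<close>

definition ae_linear :: "(real ^ 'd) set \<Rightarrow> (real ^ 'd \<Rightarrow> 'b::real_vector) set \<Rightarrow> ((real ^ 'd \<Rightarrow> 'b) \<Rightarrow> real) \<Rightarrow> bool" where
  "ae_linear \<Omega> X T \<longleftrightarrow>
     (\<forall>u\<in>X. \<forall>v\<in>X. T (\<lambda>x. u x + v x) = T u + T v) \<and>
     (\<forall>c. \<forall>u\<in>X. T (\<lambda>x. c *\<^sub>R u x) = c * T u) \<and>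
     (\<forall>u\<in>X. \<forall>v\<in>X. ae_eq \<Omega> u v \<longrightarrow> T u = T v)"

definition ae_linear_op ::
  "(real ^ 'd) set \<Rightarrow> (real ^ 'd \<Rightarrow> 'b::real_vector) set \<Rightarrow> ((real ^ 'd \<Rightarrow> 'b) \<Rightarrow> real ^ 'd \<Rightarrow> 'c::euclidean_space) \<Rightarrow> bool"
where
  "ae_linear_op \<Omega> X D \<longleftrightarrow>
     (\<forall>u\<in>X. D u \<in> L2 \<Omega>) \<and>
     (\<forall>u\<in>X. \<forall>v\<in>X. ae_eq \<Omega> (D (\<lambda>x. u x + v x)) (\<lambda>x. D u x + D v x)) \<and>
     (\<forall>c. \<forall>u\<in>X. ae_eq \<Omega> (D (\<lambda>x. c *\<^sub>R u x)) (\<lambda>x. c *\<^sub>R D u x)) \<and>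
     (\<forall>u\<in>X. \<forall>v\<in>X. ae_eq \<Omega> u v \<longrightarrow> ae_eq \<Omega> (D u) (D v))"

definition lin_closed :: "(real ^ 'd \<Rightarrow> 'b::real_vector) set \<Rightarrow> bool" where
  "lin_closed X \<longleftrightarrow> (\<lambda>x. 0) \<in> X \<and> (\<forall>u\<in>X. \<forall>v\<in>X. (\<lambda>x. u x + v x) \<in> X) \<and> (\<forall>c. \<forall>u\<in>X. (\<lambda>x. c *\<^sub>R u x) \<in> X)"

lemma ae_linear_add: "ae_linear \<Omega> X T \<Longrightarrow> ae_linear \<Omega> X T' \<Longrightarrow> ae_linear \<Omega> X (\<lambda>u. T u + T' u)"
  unfolding ae_linear_def by (simp add: algebra_simps)

lemma ae_linear_diff: "ae_linear \<Omega> X T \<Longrightarrow> ae_linear \<Omega> X T' \<Longrightarrow> ae_linear \<Omega> X (\<lambda>u. T u - T' u)"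
  unfolding ae_linear_def by (simp add: algebra_simps)

lemma ae_linear_cmult: "ae_linear \<Omega> X T \<Longrightarrow> ae_linear \<Omega> X (\<lambda>u. c * T u)"
  unfolding ae_linear_def by (simp add: algebra_simps)

lemma ae_linear_inner:
  assumes X: "lin_closed X" and D: "ae_linear_op \<Omega> X D" and w: "w \<in> L2 \<Omega>"
  shows "ae_linear \<Omega> X (\<lambda>u. L2_inner \<Omega> (D u) w)" "ae_linear \<Omega> X (\<lambda>u. L2_inner \<Omega> w (D u))"
proof -
  have L: "D u \<in> L2 \<Omega>" if "u \<in> X" for u using D that by (simp add: ae_linear_op_def)
  have c: "L2_inner \<Omega> p w = L2_inner \<Omega> q w" if "ae_eq \<Omega> p q" "p \<in> L2 \<Omega>" "q \<in> L2 \<Omega>" for p q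
    using that w by (intro L2_inner_cong) (auto simp: ae_eq_def)
  show "ae_linear \<Omega> X (\<lambda>u. L2_inner \<Omega> (D u) w)"
    unfolding ae_linear_def
  proof (intro conjI ballI allI impI)
    fix u v assume uv: "u \<in> X" "v \<in> X"
    have "L2_inner \<Omega> (D (\<lambda>x. u x + v x)) w = L2_inner \<Omega> (\<lambda>x. D u x + D v x) w"
      using D X uv by (intro c L2_add L) (auto simp: ae_linear_op_def lin_closed_def)
    then show "L2_inner \<Omega> (D (\<lambda>x. u x + v x)) w = L2_inner \<Omega> (D u) w + L2_inner \<Omega> (D v) w"
      using uv w by (simp add: L2_inner_add_left L)
    assume "ae_eq \<Omega> u v"
    then show "L2_inner \<Omega> (D u) w = L2_inner \<Omega> (D v) w"
      using D uv by (intro c L) (auto simp: ae_linear_op_def)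
  next
    fix t u assume u: "u \<in> X"
    have "L2_inner \<Omega> (D (\<lambda>x. t *\<^sub>R u x)) w = L2_inner \<Omega> (\<lambda>x. t *\<^sub>R D u x) w"
      using D X u by (intro c L2_scale L) (auto simp: ae_linear_op_def lin_closed_def)
    then show "L2_inner \<Omega> (D (\<lambda>x. t *\<^sub>R u x)) w = t * L2_inner \<Omega> (D u) w"
      by (simp add: L2_inner_scale_left)
  qed
  then show "ae_linear \<Omega> X (\<lambda>u. L2_inner \<Omega> w (D u))"
    by (simp add: L2_inner_commute[of \<Omega> w])
qed

lemma ae_linear_comb:
  assumes "ae_linear \<Omega> X T" "lin_closed X" "u \<in> X" "v \<in> X"
  shows "T (\<lambda>x. u x + c *\<^sub>R v x) = T u + c * T v"
  using assms unfolding ae_linear_def lin_closed_def by metis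

lemma ae_linear_zero:
  assumes "ae_linear \<Omega> X T" "lin_closed X"
  shows "T (\<lambda>x. 0) = 0"
  using ae_linear_comb[OF assms, of "\<lambda>x. 0" "\<lambda>x. 0" "-1"] assms(2) by (simp add: lin_closed_def)

lemma ae_linear_ae_zero:
  assumes "ae_linear \<Omega> X T" "lin_closed X" "u \<in> X" "ae_eq \<Omega> u (\<lambda>x. 0)"
  shows "T u = 0"
  using assms ae_linear_zero[OF assms(1,2)] unfolding ae_linear_def lin_closed_def by metis

lemma fin_dim_subspace_lin_closed: "fin_dim_subspace \<Omega> X S \<Longrightarrow> lin_closed S"
  by (auto simp: fin_dim_subspace_def lin_closed_def)

text \<open>
  The only consequence of finite dimension that is used: linear functionals that respect equality almost
  everywhere are determined by finitely many values.
\<close>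

lemma fin_dim_subspace_spanned:
  assumes S: "fin_dim_subspace \<Omega> X S"
  obtains B where "finite B" "B \<subseteq> S"
    "\<And>T u. ae_linear \<Omega> S T \<Longrightarrow> (\<And>b. b \<in> B \<Longrightarrow> T b = 0) \<Longrightarrow> u \<in> S \<Longrightarrow> T u = 0"
proof -
  have cl: "lin_closed S" by (rule fin_dim_subspace_lin_closed[OF S])
  obtain B where B: "finite B" "B \<subseteq> S" "\<And>u. u \<in> S \<Longrightarrow> \<exists>c. ae_eq \<Omega> u (\<lambda>x. \<Sum>b\<in>B. c b *\<^sub>R b x)"
    using S unfolding fin_dim_subspace_def by blast
  show thesis
  proof (rule that[OF B(1,2)])
    fix T u assume T: "ae_linear \<Omega> S T" and T0: "\<And>b. b \<in> B \<Longrightarrow> T b = 0" and u: "u \<in> S"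
    obtain c where c: "ae_eq \<Omega> u (\<lambda>x. \<Sum>b\<in>B. c b *\<^sub>R b x)" using B(3)[OF u] by blast
    have "(\<lambda>x. \<Sum>b\<in>B'. c b *\<^sub>R b x) \<in> S \<and> T (\<lambda>x. \<Sum>b\<in>B'. c b *\<^sub>R b x) = 0" if "B' \<subseteq> B" for B'
      using finite_subset[OF that B(1)] that
    proof (induction B' rule: finite_induct)
      case empty
      then show ?case using cl ae_linear_zero[OF T cl] by (simp add: lin_closed_def)
    next
      case (insert b B')
      let ?s = "\<lambda>x. \<Sum>b\<in>B'. c b *\<^sub>R b x"
      have eq: "(\<lambda>x. \<Sum>b\<in>insert b B'. c b *\<^sub>R b x) = (\<lambda>x. ?s x + c b *\<^sub>R b x)"
        using insert.hyps by (simp add: add.commute)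
      have s: "?s \<in> S" "T ?s = 0" "b \<in> S" "T b = 0" using insert B(2) T0 by auto
      then show ?case
        unfolding eq using ae_linear_comb[OF T cl s(1,3), of "c b"] cl by (simp add: lin_closed_def)
    qed
    from this[of B] show "T u = 0" using T u c unfolding ae_linear_def by auto
  qed
qed

lemma ae_linear_op_id: "X \<subseteq> L2 \<Omega> \<Longrightarrow> ae_linear_op \<Omega> X (\<lambda>u. u)"
  unfolding ae_linear_op_def by (auto simp: ae_eq_def)

lemma ae_linear_op_compose:
  assumes D: "ae_linear_op \<Omega> X D" and A: "\<And>x. linear (A x)" and L: "\<And>u. u \<in> X \<Longrightarrow> (\<lambda>x. A x (D u x)) \<in> L2 \<Omega>"
  shows "ae_linear_op \<Omega> X (\<lambda>u x. A x (D u x))"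
  unfolding ae_linear_op_def
proof (intro conjI ballI allI impI)
  fix u v assume uv: "u \<in> X" "v \<in> X"
  then have "ae_eq \<Omega> (D (\<lambda>x. u x + v x)) (\<lambda>x. D u x + D v x)" using D by (simp add: ae_linear_op_def)
  then show "ae_eq \<Omega> (\<lambda>x. A x (D (\<lambda>x. u x + v x) x)) (\<lambda>x. A x (D u x) + A x (D v x))"
    unfolding ae_eq_def by eventually_elim (simp add: linear_add[OF A])
  assume "ae_eq \<Omega> u v"
  then have "ae_eq \<Omega> (D u) (D v)" using D uv by (simp add: ae_linear_op_def)
  then show "ae_eq \<Omega> (\<lambda>x. A x (D u x)) (\<lambda>x. A x (D v x))"
    unfolding ae_eq_def by eventually_elim simp
next
  fix c u assume u: "u \<in> X"
  then have "ae_eq \<Omega> (D (\<lambda>x. c *\<^sub>R u x)) (\<lambda>x. c *\<^sub>R D u x)" using D by (simp add: ae_linear_op_def)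
  then show "ae_eq \<Omega> (\<lambda>x. A x (D (\<lambda>x. c *\<^sub>R u x) x)) (\<lambda>x. c *\<^sub>R A x (D u x))"
    unfolding ae_eq_def by eventually_elim (simp add: linear_scale[OF A])
qed (use L in blast)

context bounded_open
begin

lemma grad_cong:
  assumes "u \<in> H1 \<Omega>" "v \<in> H1 \<Omega>" "ae_eq \<Omega> u v"
  shows "ae_eq \<Omega> (grad \<Omega> u) (grad \<Omega> v)"
proof (rule grad_unique)
  have "L2_inner \<Omega> u (partial_deriv i \<psi>) = L2_inner \<Omega> v (partial_deriv i \<psi>)" if "\<psi> \<in> test_functions \<Omega>" for \<psi> i
    using assms that by (intro L2_inner_cong H1_L2 test_function_L2) (auto simp: ae_eq_def)
  then show "weak_gradient \<Omega> u (grad \<Omega> v)"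
    using weak_gradient_grad[OF assms(2)] by (simp add: weak_gradient_iff)
qed (rule H1_L2[OF assms(1)])

lemma ae_linear_op_grad: "X \<subseteq> H10 \<Omega> \<Longrightarrow> ae_linear_op \<Omega> X (grad \<Omega>)"
  unfolding ae_linear_op_def
  using grad_L2 H1_add(2) H1_scale(2) grad_cong H10_H1 by (auto simp: subset_eq)

lemma ae_linear_op_grad_vec:
  assumes X: "X \<subseteq> H10_vec \<Omega>"
  shows "ae_linear_op \<Omega> X (grad_vec \<Omega>)"
  unfolding ae_linear_op_def
proof (intro conjI ballI allI impI)
  have comp: "(\<lambda>x. u x $ i) \<in> H1 \<Omega>" if "u \<in> X" for u i
    using X that H10_H1 by (auto simp: H10_vec_def)
  have AE: "ae_eq \<Omega> G H" if "\<And>i. ae_eq \<Omega> (\<lambda>x. G x $ i) (\<lambda>x. H x $ i)" for G H :: "real ^ 'd \<Rightarrow> real ^ 'd ^ 'd"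
  proof -
    have "AE x in lebesgue_on \<Omega>. \<forall>i. G x $ i = H x $ i"
      using that by (subst AE_all_countable) (auto simp: ae_eq_def)
    then show ?thesis unfolding ae_eq_def by eventually_elim (simp add: vec_eq_iff)
  qed
  fix u assume u: "u \<in> X"
  then show "grad_vec \<Omega> u \<in> L2 \<Omega>" using X grad_vec_L2 by blast
  show "ae_eq \<Omega> (grad_vec \<Omega> (\<lambda>x. c *\<^sub>R u x)) (\<lambda>x. c *\<^sub>R grad_vec \<Omega> u x)" for c
    using H1_scale(2)[OF comp[OF u]] by (intro AE) (simp add: grad_vec_def)
  fix v assume v: "v \<in> X"
  show "ae_eq \<Omega> (grad_vec \<Omega> (\<lambda>x. u x + v x)) (\<lambda>x. grad_vec \<Omega> u x + grad_vec \<Omega> v x)"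
    using H1_add(2)[OF comp[OF u] comp[OF v]] by (intro AE) (simp add: grad_vec_def)
  assume uv: "ae_eq \<Omega> u v"
  have "ae_eq \<Omega> (\<lambda>x. u x $ i) (\<lambda>x. v x $ i)" for i
    using uv unfolding ae_eq_def by eventually_elim simp
  then show "ae_eq \<Omega> (grad_vec \<Omega> u) (grad_vec \<Omega> v)"
    using grad_cong[OF comp[OF u] comp[OF v]] by (intro AE) (simp add: grad_vec_def)
qed

lemma ae_linear_op_sym_grad:
  assumes "X \<subseteq> H10_vec \<Omega>" shows "ae_linear_op \<Omega> X (sym_grad \<Omega>)"
  unfolding sym_grad_def[abs_def]
proof (rule ae_linear_op_compose[OF ae_linear_op_grad_vec[OF assms], where A="\<lambda>x T. (1 / 2) *\<^sub>R (T + transpose T)"])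
  show "linear (\<lambda>T::real^'d^'d. (1 / 2) *\<^sub>R (T + transpose T))"
    by (rule linearI) (simp_all add: vec_eq_iff transpose_def algebra_simps)
qed (use assms sym_grad_L2 in \<open>auto simp: sym_grad_def[abs_def]\<close>)

lemma ae_linear_op_divergence:
  assumes "X \<subseteq> H10_vec \<Omega>" shows "ae_linear_op \<Omega> X (divergence \<Omega>)"
  unfolding divergence_def[abs_def]
proof (rule ae_linear_op_compose[OF ae_linear_op_grad_vec[OF assms], where A="\<lambda>x T. \<Sum>i\<in>UNIV. T $ i $ i"])
  show "linear (\<lambda>T::real^'d^'d. \<Sum>i\<in>UNIV. T $ i $ i)"
    by (rule linearI) (simp_all add: sum.distrib sum_distrib_left)
qed (use assms divergence_L2 in \<open>auto simp: divergence_def[abs_def]\<close>)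

end

section \<open>Bounds for symmetric coefficient fields\<close>

text \<open>
  Polarization with the vectors \<open>|A x| x\<close> and \<open>|x| A x\<close>, which have equal norm. The subspace is needed for
  the elasticity tensor, whose form is controlled on symmetric matrices only.
\<close>

lemma symmetric_form_bound:
  fixes A :: "'a::real_inner \<Rightarrow> 'a"
  assumes "linear A" "subspace V" "\<And>x. x \<in> V \<Longrightarrow> A x \<in> V"
    and sym: "\<And>x y. x \<in> V \<Longrightarrow> y \<in> V \<Longrightarrow> x \<bullet> A y = y \<bullet> A x"
    and pos: "\<And>x. x \<in> V \<Longrightarrow> 0 \<le> x \<bullet> A x" and le: "\<And>x. x \<in> V \<Longrightarrow> x \<bullet> A x \<le> m * (norm x)\<^sup>2" and "0 \<le> m"
    and x: "x \<in> V"
  shows "norm (A x) \<le> m * norm x"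
proof (cases "A x = 0 \<or> x = 0")
  case True
  then show ?thesis using \<open>0 \<le> m\<close> linear_0[OF \<open>linear A\<close>] by auto
next
  case False
  define s r where "s = norm (A x)" and "r = norm x"
  have sr: "s > 0" "r > 0" using False by (auto simp: s_def r_def)
  \<comment> \<open>scaled to equal norm \<open>s r\<close>\<close>
  define p q where "p = s *\<^sub>R x" and "q = r *\<^sub>R A x"
  have pq: "p \<in> V" "q \<in> V" using assms x by (auto simp: p_def q_def subspace_scale)
  have "4 * (q \<bullet> A p) = (p + q) \<bullet> A (p + q) - (p - q) \<bullet> A (p - q)"
    using sym[OF pq] by (simp add: linear_add[OF \<open>linear A\<close>] linear_diff[OF \<open>linear A\<close>] inner_simps)
  also have "\<dots> \<le> m * (norm (p + q))\<^sup>2"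
    using le[of "p + q"] pos[of "p - q"] pq \<open>subspace V\<close> by (simp add: subspace_add subspace_diff)
  also have "\<dots> \<le> m * (2 * (s * r))\<^sup>2"
    using norm_triangle_ineq[of p q] sr \<open>0 \<le> m\<close>
    by (intro mult_left_mono power_mono) (auto simp: p_def q_def s_def r_def mult.commute)
  also have "q \<bullet> A p = r * s * s\<^sup>2"
    by (simp add: p_def q_def linear_scale[OF \<open>linear A\<close>] s_def power2_norm_eq_inner)
  finally have "(4 * r * s\<^sup>2) * s \<le> (4 * r * s\<^sup>2) * (m * r)"
    by (simp add: power2_eq_square algebra_simps)
  moreover have "0 < 4 * r * s\<^sup>2" using sr by simp
  ultimately have "s \<le> m * r" by (simp only: mult_le_cancel_left_pos)
  then show ?thesis by (simp add: s_def r_def)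
qed

lemma L2_pointwise_bound:
  fixes u :: "real ^ 'd \<Rightarrow> 'b::euclidean_space" and v :: "real ^ 'd \<Rightarrow> 'c::euclidean_space"
  assumes "u \<in> L2 \<Omega>" "v \<in> borel_measurable (lebesgue_on \<Omega>)"
    and "AE x in lebesgue_on \<Omega>. norm (v x) \<le> m * norm (u x)"
  shows "v \<in> L2 \<Omega>"
proof -
  have "integrable (lebesgue_on \<Omega>) (\<lambda>x. (norm (v x))\<^sup>2)"
  proof (rule Bochner_Integration.integrable_bound)
    show "integrable (lebesgue_on \<Omega>) (\<lambda>x. m\<^sup>2 * (norm (u x))\<^sup>2)"
      using L2_integrable[OF assms(1)] by simp
    show "AE x in lebesgue_on \<Omega>. norm ((norm (v x))\<^sup>2) \<le> norm (m\<^sup>2 * (norm (u x))\<^sup>2)"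
      using assms(3) by eventually_elim (simp add: power_mult_distrib[symmetric] power_mono)
  qed (use assms(2) in simp)
  then show ?thesis using assms(2) by (simp add: L2_def)
qed

lemma inner_transpose: "transpose A \<bullet> B = A \<bullet> transpose (B :: real ^ 'd ^ 'd)"
  unfolding inner_vec_def transpose_def by simp (rule sum.swap)

text \<open>
  Major symmetry means self-adjointness for the Frobenius product.
\<close>

lemma double_contraction_sym:
  fixes C :: "real ^ 'd ^ 'd ^ 'd ^ 'd"
  assumes "\<And>i j k l. C $ i $ j $ k $ l = C $ k $ l $ i $ j"
  shows "T \<bullet> double_contraction C S = S \<bullet> double_contraction C T"
proof -
  have swap: "(\<Sum>j\<in>UNIV. \<Sum>k\<in>UNIV. \<Sum>l\<in>UNIV. h j k l) = (\<Sum>k\<in>UNIV. \<Sum>l\<in>UNIV. \<Sum>j\<in>UNIV. h j k l)"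
    for h :: "'d \<Rightarrow> 'd \<Rightarrow> 'd \<Rightarrow> real"
    by (subst sum.swap) (intro sum.cong refl sum.swap)
  have "T \<bullet> double_contraction C S =
      (\<Sum>i\<in>UNIV. \<Sum>j\<in>UNIV. \<Sum>k\<in>UNIV. \<Sum>l\<in>UNIV. T $ i $ j * (C $ i $ j $ k $ l * S $ k $ l))"
    by (simp add: inner_vec_def double_contraction_def sum_distrib_left)
  also have "\<dots> = (\<Sum>k\<in>UNIV. \<Sum>l\<in>UNIV. \<Sum>i\<in>UNIV. \<Sum>j\<in>UNIV. T $ i $ j * (C $ i $ j $ k $ l * S $ k $ l))"
  proof -
    define h where "h i j k l = T $ i $ j * (C $ i $ j $ k $ l * S $ k $ l)" for i j k l
    have "(\<Sum>i\<in>UNIV. \<Sum>j\<in>UNIV. \<Sum>k\<in>UNIV. \<Sum>l\<in>UNIV. h i j k l) =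
        (\<Sum>i\<in>UNIV. \<Sum>k\<in>UNIV. \<Sum>l\<in>UNIV. \<Sum>j\<in>UNIV. h i j k l)"
      by (intro sum.cong refl swap)
    also have "\<dots> = (\<Sum>k\<in>UNIV. \<Sum>l\<in>UNIV. \<Sum>i\<in>UNIV. \<Sum>j\<in>UNIV. h i j k l)"
      by (rule swap)
    finally show ?thesis by (simp only: h_def)
  qed
  also have "\<dots> = S \<bullet> double_contraction C T"
  proof -
    have "T $ i $ j * (C $ i $ j $ k $ l * S $ k $ l) = S $ k $ l * (C $ k $ l $ i $ j * T $ i $ j)" for i j k l
      using assms[of i j k l] by simp
    moreover have "S \<bullet> double_contraction C T =
        (\<Sum>k\<in>UNIV. \<Sum>l\<in>UNIV. \<Sum>i\<in>UNIV. \<Sum>j\<in>UNIV. S $ k $ l * (C $ k $ l $ i $ j * T $ i $ j))"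
      by (simp add: inner_vec_def double_contraction_def sum_distrib_left)
    ultimately show ?thesis by (simp only:)
  qed
  finally show ?thesis .
qed

text \<open>
  The bounds on the elasticity tensor say nothing about the skew part of \<open>C : T\<close>, so this product need not be
  square-integrable. Its symmetric part is, and pairing with a symmetric matrix gives the same value.
\<close>

definition stress :: "real ^ 'd ^ 'd ^ 'd ^ 'd \<Rightarrow> real ^ 'd ^ 'd \<Rightarrow> real ^ 'd ^ 'd" where
  "stress C T = (1 / 2) *\<^sub>R (double_contraction C T + transpose (double_contraction C T))"

lemma linear_stress: "linear (stress C)"
  by (rule linearI)
    (simp_all add: stress_def double_contraction_def transpose_def vec_eq_iff algebra_simps sum.distrib sum_distrib_left)

lemma transpose_stress: "transpose (stress C T) = stress C T"
  by (simp add: stress_def vec_eq_iff transpose_def add.commute)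

lemma inner_stress:
  assumes "transpose S = S"
  shows "stress C T \<bullet> S = double_contraction C T \<bullet> S" "S \<bullet> stress C T = S \<bullet> double_contraction C T"
proof -
  show "stress C T \<bullet> S = double_contraction C T \<bullet> S"
    using assms by (simp add: stress_def inner_add_left inner_transpose)
  then show "S \<bullet> stress C T = S \<bullet> double_contraction C T" by (simp add: inner_commute)
qed

lemma transpose_sym_grad: "transpose (sym_grad \<Omega> d x) = sym_grad \<Omega> d x"
  by (simp add: sym_grad_def vec_eq_iff transpose_def add.commute)

section \<open>The a priori estimate as an inequality between norms\<close>

text \<open>
  The estimate in terms of the norms \<open>D = |d|\<close>, \<open>D' = |\<nabla> d|\<close>, \<open>e = |\<epsilon>(d)|\<close>, \<open>m = |\<mu>|\<close>, \<open>G = |\<nabla> \<mu>|\<close>,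
  \<open>w = |\<phi>|\<close>, \<open>L = |l|\<close> and of the norms of the data. With \<open>\<gamma> = 2 \<beta> + M\<close>, with \<open>F\<close> the sum of the data norms and
  \<open>N\<close> the \<open>V\<close> norm, the energy bounds \<open>\<kappa> a N\<^sup>2 + \<gamma> w\<^sup>2 / 2\<close> from above, where only half of \<open>\<gamma> w\<^sup>2\<close> has
  been spent on \<open>N\<close>. Young's inequality then gives bounds for \<open>N\<close> and for \<open>\<gamma> w\<close> separately, and the second
  of them bounds \<open>L\<close>.
\<close>

lemma a_priori_arithmetic:
  fixes a r Cm \<beta> k M s P :: real
  assumes a: "a > 0" "a \<le> r" "a \<le> Cm" "a \<le> 2 * \<beta>" "a \<le> k" "a \<le> M"
    and s: "2 * \<beta> \<le> s" "M \<le> s"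
    and P: "P > 0" "m \<le> P * G" "D'\<^sup>2 \<le> 2 * e\<^sup>2"
    and nonneg: "D \<ge> 0" "D' \<ge> 0" "e \<ge> 0" "m \<ge> 0" "G \<ge> 0" "w \<ge> 0" "L \<ge> 0"
      "nf \<ge> 0" "ng \<ge> 0" "np \<ge> 0" "n\<phi> \<ge> 0"
    and energy: "r * D\<^sup>2 + Cm * e\<^sup>2 + k * G\<^sup>2 + (2 * \<beta> + M) * w\<^sup>2
      \<le> nf * D + ng * m + np * w + 2 * \<beta> * (n\<phi> * w) + n\<phi> * L"
    and multiplier: "L\<^sup>2 \<le> (\<beta> + M) * (w * L) + \<beta> * (n\<phi> * L) + m * L + np * L"
    and \<kappa>: "0 < \<kappa>" "\<kappa> \<le> 1 / 2" "\<kappa> * (1 + P\<^sup>2) \<le> 1"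
    and B: "1 / a \<le> B" "2 * sqrt s / sqrt a \<le> B" "s \<le> B"
  shows "sqrt (D\<^sup>2 + D'\<^sup>2 + (m\<^sup>2 + G\<^sup>2) + w\<^sup>2 + L\<^sup>2) \<le> 20 / \<kappa> * B * (nf + ng + np + n\<phi>)"
proof -
  define F where "F = nf + ng + np + n\<phi>"
  define \<gamma> where "\<gamma> = 2 * \<beta> + M"
  define N where "N = sqrt (D\<^sup>2 + D'\<^sup>2 + (m\<^sup>2 + G\<^sup>2) + w\<^sup>2)"
  have F: "F \<ge> 0" "nf \<le> F" "ng \<le> F" "np \<le> F" "n\<phi> \<le> F" using nonneg by (auto simp: F_def)
  have \<gamma>: "2 * a \<le> \<gamma>" "\<gamma> \<le> 2 * s" "2 * \<beta> \<le> \<gamma>" "\<beta> + M \<le> \<gamma>" "0 \<le> \<beta>" "0 < \<gamma>" "0 < s" "a \<le> s" "2 * \<beta> \<le> s"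
    using a s by (auto simp: \<gamma>_def)
  have N2: "N\<^sup>2 = D\<^sup>2 + D'\<^sup>2 + (m\<^sup>2 + G\<^sup>2) + w\<^sup>2" by (simp add: N_def)
  have N: "N \<ge> 0" "D \<le> N" "m \<le> N" "w \<le> N"
    using nonneg by (auto simp: N_def intro!: real_le_rsqrt)
  have B2: "2 \<le> B" "s / a \<le> B\<^sup>2 / 4" "1 / a\<^sup>2 \<le> B\<^sup>2" "1 / a \<le> B\<^sup>2 / 2" "s\<^sup>2 \<le> B\<^sup>2" "s \<le> B\<^sup>2 / 2"
  proof -
    \<comment> \<open>the middle entry of the maximum is at least 2, so every entry is at most half of the squared maximum\<close>
    have "1 \<le> sqrt (s / a)" using \<gamma> a by simp
    then show "2 \<le> B" using B(2) by (simp add: real_sqrt_divide)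
    have "(2 * sqrt (s / a))\<^sup>2 \<le> B\<^sup>2"
      using B(2) \<gamma> a by (intro power_mono) (simp_all add: real_sqrt_divide)
    then have "4 * (s / a) \<le> B\<^sup>2" using \<gamma> a by (simp add: power_mult_distrib)
    then show "s / a \<le> B\<^sup>2 / 4" by linarith
    have "(1 / a)\<^sup>2 \<le> B\<^sup>2" using B(1) a by (intro power_mono) auto
    then show "1 / a\<^sup>2 \<le> B\<^sup>2" by (simp add: power_divide)
    show "s\<^sup>2 \<le> B\<^sup>2" using B(3) \<gamma> by (intro power_mono) auto
    have "2 * B \<le> B * B" using \<open>2 \<le> B\<close> by (intro mult_right_mono) auto
    then have "B \<le> B\<^sup>2 / 2" by (simp add: power2_eq_square)
    then show "1 / a \<le> B\<^sup>2 / 2" "s \<le> B\<^sup>2 / 2" using B by linarith+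
  qed
  have L: "L \<le> \<gamma> * w + s * F + N + F"
  proof (cases "L = 0")
    case True
    then show ?thesis using \<gamma> nonneg N F by simp
  next
    case False
    have "L * L \<le> L * ((\<beta> + M) * w + \<beta> * n\<phi> + m + np)"
      using multiplier by (simp add: power2_eq_square algebra_simps)
    then have "L \<le> (\<beta> + M) * w + \<beta> * n\<phi> + m + np" using False nonneg by simp
    moreover have "(\<beta> + M) * w \<le> \<gamma> * w" using \<gamma> nonneg by (intro mult_right_mono) auto
    moreover have "\<beta> * n\<phi> \<le> s * F" using \<gamma> F nonneg by (intro mult_mono) auto
    ultimately show ?thesis using N F by linarith
  qed
  have lower: "\<kappa> * a * N\<^sup>2 + \<gamma> / 2 * w\<^sup>2 \<le> r * D\<^sup>2 + Cm * e\<^sup>2 + k * G\<^sup>2 + \<gamma> * w\<^sup>2"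
  proof -
    have "D\<^sup>2 + D'\<^sup>2 \<le> 2 * D\<^sup>2 + 2 * e\<^sup>2" using P(3) zero_le_power2[of D] by linarith
    then have "\<kappa> * (D\<^sup>2 + D'\<^sup>2) \<le> 1 / 2 * (2 * D\<^sup>2 + 2 * e\<^sup>2)"
      using \<kappa> by (intro mult_mono) auto
    then have "a * (\<kappa> * (D\<^sup>2 + D'\<^sup>2)) \<le> a * (D\<^sup>2 + e\<^sup>2)" using a by (intro mult_left_mono) auto
    also have "\<dots> \<le> r * D\<^sup>2 + Cm * e\<^sup>2" using a by (auto simp: distrib_left intro!: add_mono mult_right_mono)
    finally have 1: "a * (\<kappa> * (D\<^sup>2 + D'\<^sup>2)) \<le> r * D\<^sup>2 + Cm * e\<^sup>2" .
    have "m\<^sup>2 \<le> (P * G)\<^sup>2" using P nonneg by (intro power_mono) auto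
    then have "\<kappa> * (m\<^sup>2 + G\<^sup>2) \<le> \<kappa> * ((1 + P\<^sup>2) * G\<^sup>2)"
      using \<kappa> by (intro mult_left_mono) (auto simp: power_mult_distrib algebra_simps)
    also have "\<dots> \<le> 1 * G\<^sup>2" unfolding mult.assoc[symmetric] using \<kappa> by (intro mult_right_mono) auto
    finally have "a * (\<kappa> * (m\<^sup>2 + G\<^sup>2)) \<le> a * G\<^sup>2" using a by (intro mult_left_mono) auto
    also have "\<dots> \<le> k * G\<^sup>2" using a by (intro mult_right_mono) auto
    finally have 2: "a * (\<kappa> * (m\<^sup>2 + G\<^sup>2)) \<le> k * G\<^sup>2" .
    \<comment> \<open>\<open>\<gamma> / 2 \<ge> a\<close> because both \<open>2 \<beta>\<close> and \<open>M\<close> are at least \<open>a\<close>\<close>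
    have "a * \<kappa> \<le> a * 1" using a \<kappa> by (intro mult_left_mono) auto
    then have "a * \<kappa> * w\<^sup>2 \<le> \<gamma> / 2 * w\<^sup>2" using \<gamma> by (intro mult_right_mono) auto
    with 1 2 show ?thesis unfolding N2 by (simp add: algebra_simps)
  qed
  have "nf * D + ng * m + np * w + 2 * \<beta> * (n\<phi> * w) + n\<phi> * L \<le>
      F * N + F * N + F * N + \<gamma> * (F * w) + F * (\<gamma> * w + s * F + N + F)"
    using F N L \<gamma> nonneg by (intro add_mono mult_mono) auto
  also have "\<dots> = 4 * (F * N) + 2 * \<gamma> * (F * w) + s * F\<^sup>2 + F\<^sup>2"
    by (simp add: algebra_simps power2_eq_square)
  finally have "\<kappa> * a * N\<^sup>2 + \<gamma> / 2 * w\<^sup>2 \<le> 4 * (F * N) + 2 * \<gamma> * (F * w) + s * F\<^sup>2 + F\<^sup>2"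
    using lower energy unfolding \<gamma>_def by linarith
  moreover have "2 * \<gamma> * (F * w) \<le> \<gamma> / 4 * w\<^sup>2 + 8 * s * F\<^sup>2"
  proof -
    \<comment> \<open>Young's inequality, leaving a quarter of \<open>\<gamma> w\<^sup>2\<close> on the left\<close>
    have "0 \<le> \<gamma> * (w / 2 - 2 * F)\<^sup>2" using \<gamma> by simp
    then have "2 * \<gamma> * (F * w) \<le> \<gamma> / 4 * w\<^sup>2 + 4 * \<gamma> * F\<^sup>2"
      by (simp add: power2_diff power_mult_distrib power_divide algebra_simps)
    moreover have "4 * \<gamma> * F\<^sup>2 \<le> 8 * s * F\<^sup>2" using \<gamma> by (intro mult_right_mono) auto
    ultimately show ?thesis by linarith
  qed
  moreover have "4 * (F * N) \<le> \<kappa> * a * N\<^sup>2 / 2 + 8 / (\<kappa> * a) * F\<^sup>2"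
  proof -
    define t where "t = \<kappa> * a"
    have t: "t > 0" using \<kappa> a by (simp add: t_def)
    \<comment> \<open>Young's inequality, leaving half of \<open>\<kappa> a N\<^sup>2\<close> on the left\<close>
    have "0 \<le> (t * N - 4 * F)\<^sup>2 / (2 * t)" using t by simp
    also have "\<dots> = t * N\<^sup>2 / 2 + 8 / t * F\<^sup>2 - 4 * (F * N)"
      using t by (simp add: power2_eq_square field_simps)
    finally show ?thesis by (simp add: t_def)
  qed
  ultimately have main: "\<kappa> * a * N\<^sup>2 / 2 + \<gamma> / 4 * w\<^sup>2 \<le> (8 / (\<kappa> * a) + 9 * s + 1) * F\<^sup>2"
    by (simp add: algebra_simps)
  define Q where "Q = 8 / (\<kappa> * a) + 9 * s + 1"
  have \<kappa>i: "2 \<le> 1 / \<kappa>" "0 < 1 / \<kappa>" using \<kappa> by (auto simp: field_simps)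
  have N_le: "N \<le> 5 / \<kappa> * (B * F)"
  proof -
    have "0 \<le> \<gamma> / 4 * w\<^sup>2" using \<gamma> by simp
    then have "\<kappa> * a * N\<^sup>2 / 2 \<le> Q * F\<^sup>2" using main unfolding Q_def by linarith
    then have "N\<^sup>2 \<le> 2 / \<kappa> * ((Q / a) * F\<^sup>2)"
      using \<kappa> a by (simp add: field_simps)
    also have "Q / a \<le> 10 / \<kappa> * B\<^sup>2"
    proof -
      have "Q / a = 8 / \<kappa> * (1 / a\<^sup>2) + 9 * (s / a) + 1 / a"
        using \<kappa> a by (simp add: Q_def field_simps power2_eq_square)
      also have "\<dots> \<le> 8 / \<kappa> * B\<^sup>2 + 9 * (B\<^sup>2 / 4) + B\<^sup>2 / 2"
        using B2 \<kappa> by (intro add_mono mult_left_mono) auto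
      also have "\<dots> = (8 / \<kappa> + 11 / 4) * B\<^sup>2" by (simp add: algebra_simps)
      also have "\<dots> \<le> 10 / \<kappa> * B\<^sup>2" using \<kappa>i by (intro mult_right_mono) auto
      finally show ?thesis .
    qed
    then have "2 / \<kappa> * ((Q / a) * F\<^sup>2) \<le> 2 / \<kappa> * ((10 / \<kappa> * B\<^sup>2) * F\<^sup>2)"
      using \<kappa> by (intro mult_left_mono mult_right_mono) auto
    also have "\<dots> \<le> (5 / \<kappa> * (B * F))\<^sup>2"
    proof -
      have "20 / \<kappa>\<^sup>2 * (B\<^sup>2 * F\<^sup>2) \<le> 25 / \<kappa>\<^sup>2 * (B\<^sup>2 * F\<^sup>2)"
        by (intro mult_right_mono divide_right_mono) auto
      then show ?thesis by (simp add: power_mult_distrib power_divide power2_eq_square mult.assoc mult.left_commute)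
    qed
    finally show ?thesis
      by (rule power2_le_imp_le) (use \<kappa> B2 F in auto)
  qed
  have w_le: "\<gamma> * w \<le> 8 / \<kappa> * (B * F)"
  proof -
    have "0 \<le> \<kappa> * a * N\<^sup>2 / 2" using \<kappa> a by simp
    then have "\<gamma> / 4 * w\<^sup>2 \<le> Q * F\<^sup>2" using main unfolding Q_def by linarith
    then have "4 * \<gamma> * (\<gamma> / 4 * w\<^sup>2) \<le> 4 * \<gamma> * (Q * F\<^sup>2)" using \<gamma> by (intro mult_left_mono) auto
    then have "(\<gamma> * w)\<^sup>2 \<le> 4 * \<gamma> * (Q * F\<^sup>2)" by (simp add: power2_eq_square algebra_simps)
    also have "\<dots> \<le> 8 * s * (Q * F\<^sup>2)"
      using \<gamma> \<kappa> a by (intro mult_right_mono) (auto simp: Q_def)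
    also have "\<dots> = 8 * ((s * Q) * F\<^sup>2)" by simp
    also have "s * Q \<le> 8 / \<kappa> * B\<^sup>2"
    proof -
      have "s * Q = 8 / \<kappa> * (s / a) + 9 * s\<^sup>2 + s"
        using \<kappa> a by (simp add: Q_def field_simps power2_eq_square)
      also have "\<dots> \<le> 8 / \<kappa> * (B\<^sup>2 / 4) + 9 * B\<^sup>2 + B\<^sup>2 / 2"
        using B2 \<kappa> by (intro add_mono mult_left_mono) auto
      also have "\<dots> = (2 / \<kappa> + 19 / 2) * B\<^sup>2" by (simp add: algebra_simps)
      also have "\<dots> \<le> 8 / \<kappa> * B\<^sup>2" using \<kappa>i by (intro mult_right_mono) auto
      finally show ?thesis .
    qed
    then have "8 * ((s * Q) * F\<^sup>2) \<le> 8 * ((8 / \<kappa> * B\<^sup>2) * F\<^sup>2)"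
      by (intro mult_left_mono mult_right_mono) auto
    also have "\<dots> \<le> (8 / \<kappa> * (B * F))\<^sup>2"
    proof -
      have "1 / \<kappa> * (B\<^sup>2 * F\<^sup>2) \<le> 1 / \<kappa> * (1 / \<kappa>) * (B\<^sup>2 * F\<^sup>2)"
      proof (rule mult_right_mono)
        have "1 / \<kappa> * 1 \<le> 1 / \<kappa> * (1 / \<kappa>)" using \<kappa>i by (intro mult_left_mono) linarith+
        then show "1 / \<kappa> \<le> 1 / \<kappa> * (1 / \<kappa>)" by simp
      qed simp
      moreover have "8 * ((8 / \<kappa> * B\<^sup>2) * F\<^sup>2) = 64 * (1 / \<kappa> * (B\<^sup>2 * F\<^sup>2))" by simp
      moreover have "(8 / \<kappa> * (B * F))\<^sup>2 = 64 * (1 / \<kappa> * (1 / \<kappa>) * (B\<^sup>2 * F\<^sup>2))"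
        by (simp add: power_mult_distrib power_divide power2_eq_square)
      ultimately show ?thesis by linarith
    qed
    finally show ?thesis
      by (rule power2_le_imp_le) (use \<kappa> B2 F in auto)
  qed
  have sF: "s * F \<le> B * F" using B(3) F by (intro mult_right_mono) auto
  have FF: "1 * F \<le> B * F" using B2(1) F by (intro mult_right_mono) auto
  have "2 * (B * F) \<le> 1 / \<kappa> * (B * F)" using \<kappa>i B2 F by (intro mult_right_mono) auto
  with L N_le w_le sF FF have L_le: "L \<le> 14 / \<kappa> * (B * F)" by simp
  have "sqrt (D\<^sup>2 + D'\<^sup>2 + (m\<^sup>2 + G\<^sup>2) + w\<^sup>2 + L\<^sup>2) = sqrt (N\<^sup>2 + L\<^sup>2)" by (simp add: N2)
  also have "\<dots> \<le> N + L" using N nonneg by (intro sqrt_sum_squares_le_sum) auto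
  also have "\<dots> \<le> 19 / \<kappa> * (B * F)" using N_le L_le by simp
  also have "\<dots> \<le> 20 / \<kappa> * (B * F)" using \<kappa> B2 F by (intro mult_right_mono divide_right_mono) auto
  finally show ?thesis by (simp add: F_def mult.assoc)
qed

section \<open>The energy of the consolidation problem\<close>

locale consolidation = bounded_open \<Omega>
  for \<Omega> :: "(real ^ 'd) set" +
  fixes \<rho>\<^sub>0 \<tau> \<beta> M Kmin Kmax Cmin Cmax :: real
    and K :: "real ^ 'd \<Rightarrow> real ^ 'd ^ 'd" and C :: "real ^ 'd \<Rightarrow> real ^ 'd ^ 'd ^ 'd ^ 'd"
  assumes pos: "\<rho>\<^sub>0 > 0" "\<tau> > 0" "\<beta> > 0" "M \<ge> 0"
    and K: "permeability \<Omega> K Kmin Kmax" and C: "hooke_tensor \<Omega> C Cmin Cmax"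
begin

lemma permeability_AE:
  "AE x in lebesgue_on \<Omega>. transpose (K x) = K x \<and>
        (\<forall>\<xi>. Kmin * (norm \<xi>)\<^sup>2 \<le> \<xi> \<bullet> (K x *v \<xi>) \<and> \<xi> \<bullet> (K x *v \<xi>) \<le> Kmax * (norm \<xi>)\<^sup>2)"
  and permeability_pos: "0 < Kmin" "Kmin \<le> Kmax"
  using K by (auto simp: permeability_def)

lemma K_L2:
  assumes G: "G \<in> L2 \<Omega>"
  shows "(\<lambda>x. K x *v G x) \<in> L2 \<Omega>"
proof (rule L2_pointwise_bound[OF G])
  have "K \<in> borel_measurable (lebesgue_on \<Omega>)" using K by (simp add: permeability_def)
  then have "(\<lambda>x. K x $ i $ j) \<in> borel_measurable (lebesgue_on \<Omega>)" for i j
    by (metis borel_measurable_vec_iff)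
  moreover have "(\<lambda>x. G x $ j) \<in> borel_measurable (lebesgue_on \<Omega>)" for j
    using L2_measurable[OF G] borel_measurable_vec_iff by blast
  ultimately show "(\<lambda>x. K x *v G x) \<in> borel_measurable (lebesgue_on \<Omega>)"
    by (subst borel_measurable_vec_iff) (simp add: matrix_vector_mult_def)
  show "AE x in lebesgue_on \<Omega>. norm (K x *v G x) \<le> Kmax * norm (G x)"
    using permeability_AE
  proof eventually_elim
    case (elim x)
    show ?case
    proof (rule symmetric_form_bound[where V=UNIV])
      show "\<xi> \<bullet> (K x *v \<eta>) = \<eta> \<bullet> (K x *v \<xi>)" for \<xi> \<eta>
        using elim dot_lmul_matrix[of \<xi> "K x" \<eta>] transpose_matrix_vector[of "K x" \<xi>] by (simp add: inner_commute)
      show "0 \<le> \<xi> \<bullet> (K x *v \<xi>)" for \<xi>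
        using elim permeability_pos by (meson less_imp_le mult_nonneg_nonneg order_trans zero_le_power2)
    qed (use elim permeability_pos in auto)
  qed
qed

lemma K_coercive:
  assumes G: "G \<in> L2 \<Omega>"
  shows "Kmin * (L2_norm \<Omega> G)\<^sup>2 \<le> L2_inner \<Omega> (\<lambda>x. K x *v G x) G"
proof -
  have "(LINT x|lebesgue_on \<Omega>. Kmin * (G x \<bullet> G x)) \<le> (LINT x|lebesgue_on \<Omega>. (K x *v G x) \<bullet> G x)"
  proof (rule integral_mono_AE)
    show "AE x in lebesgue_on \<Omega>. Kmin * (G x \<bullet> G x) \<le> (K x *v G x) \<bullet> G x"
      using permeability_AE
      by eventually_elim (simp add: power2_norm_eq_inner inner_commute)
  qed (intro integrable_mult_right L2_inner_integrable K_L2 G)+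
  then show ?thesis by (simp add: L2_norm_power2 L2_inner_def)
qed

lemma hooke_AE:
  "AE x in lebesgue_on \<Omega>. (\<forall>i j k l. C x $ i $ j $ k $ l = C x $ k $ l $ i $ j) \<and>
        (\<forall>T. transpose T = T \<longrightarrow>
           Cmin * (norm T)\<^sup>2 \<le> T \<bullet> double_contraction (C x) T \<and>
           T \<bullet> double_contraction (C x) T \<le> Cmax * (norm T)\<^sup>2)"
  and hooke_pos: "0 < Cmin" "Cmin \<le> Cmax"
  using C by (auto simp: hooke_tensor_def)

lemma stress_L2:
  assumes E: "E \<in> L2 \<Omega>" and sym: "\<And>x. transpose (E x) = E x"
  shows "(\<lambda>x. stress (C x) (E x)) \<in> L2 \<Omega>"
proof (rule L2_pointwise_bound[OF E])
  have "C \<in> borel_measurable (lebesgue_on \<Omega>)" using C by (simp add: hooke_tensor_def)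
  then have "(\<lambda>x. C x $ i $ j $ k $ l) \<in> borel_measurable (lebesgue_on \<Omega>)" for i j k l
    by (metis borel_measurable_vec_iff)
  moreover have "(\<lambda>x. E x $ j $ k) \<in> borel_measurable (lebesgue_on \<Omega>)" for j k
    using L2_measurable[OF E] by (metis borel_measurable_vec_iff)
  ultimately have "(\<lambda>x. stress (C x) (E x) $ i $ j) \<in> borel_measurable (lebesgue_on \<Omega>)" for i j
    by (simp add: stress_def double_contraction_def transpose_def)
  then show "(\<lambda>x. stress (C x) (E x)) \<in> borel_measurable (lebesgue_on \<Omega>)"
    by (subst borel_measurable_vec_iff, subst borel_measurable_vec_iff) simp
  show "AE x in lebesgue_on \<Omega>. norm (stress (C x) (E x)) \<le> Cmax * norm (E x)"
    using hooke_AE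
  proof eventually_elim
    case (elim x)
    let ?V = "{T :: real ^ 'd ^ 'd. transpose T = T}"
    show ?case
    proof (rule symmetric_form_bound[where V="?V"])
      show "subspace ?V"
        by (auto simp: subspace_def vec_eq_iff transpose_def)
      show "T \<bullet> stress (C x) S = S \<bullet> stress (C x) T" if "T \<in> ?V" "S \<in> ?V" for T S
        using that elim double_contraction_sym[of "C x" T S] by (simp add: inner_stress)
      show "0 \<le> T \<bullet> stress (C x) T" if "T \<in> ?V" for T
      proof -
        have "0 \<le> Cmin * (norm T)\<^sup>2" using hooke_pos by simp
        also have "\<dots> \<le> T \<bullet> stress (C x) T" using that elim by (simp add: inner_stress)
        finally show ?thesis .
      qed
      show "T \<bullet> stress (C x) T \<le> Cmax * (norm T)\<^sup>2" if "T \<in> ?V" for T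
        using that elim by (simp add: inner_stress)
    qed (use hooke_pos sym in \<open>auto simp: linear_stress transpose_stress\<close>)
  qed
qed

lemma stress_coercive:
  assumes E: "E \<in> L2 \<Omega>" and sym: "\<And>x. transpose (E x) = E x"
  shows "Cmin * (L2_norm \<Omega> E)\<^sup>2 \<le> L2_inner \<Omega> (\<lambda>x. stress (C x) (E x)) E"
proof -
  have "(LINT x|lebesgue_on \<Omega>. Cmin * (E x \<bullet> E x)) \<le> (LINT x|lebesgue_on \<Omega>. stress (C x) (E x) \<bullet> E x)"
  proof (rule integral_mono_AE)
    show "AE x in lebesgue_on \<Omega>. Cmin * (E x \<bullet> E x) \<le> stress (C x) (E x) \<bullet> E x"
      using hooke_AE
      by eventually_elim (simp add: power2_norm_eq_inner inner_stress sym inner_commute)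
  qed (intro integrable_mult_right L2_inner_integrable stress_L2 assms)+
  then show ?thesis by (simp add: L2_norm_power2 L2_inner_def)
qed

abbreviation sigma where "sigma d \<equiv> \<lambda>x. stress (C x) (sym_grad \<Omega> d x)"
abbreviation flux where "flux \<mu> \<equiv> \<lambda>x. K x *v grad \<Omega> \<mu> x"

lemma elastic_form:
  "L2_inner \<Omega> (\<lambda>x. double_contraction (C x) (sym_grad \<Omega> d x)) (sym_grad \<Omega> d') = L2_inner \<Omega> (sigma d) (sym_grad \<Omega> d')"
  by (simp add: L2_inner_def inner_stress transpose_sym_grad)

lemma sigma_L2: "d \<in> H10_vec \<Omega> \<Longrightarrow> sigma d \<in> L2 \<Omega>"
  by (intro stress_L2 sym_grad_L2 transpose_sym_grad)

lemma flux_L2: "\<mu> \<in> H10 \<Omega> \<Longrightarrow> flux \<mu> \<in> L2 \<Omega>"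
  by (intro K_L2 grad_L2 H10_H1)

lemma ae_linear_op_sigma: "X \<subseteq> H10_vec \<Omega> \<Longrightarrow> ae_linear_op \<Omega> X sigma"
  using ae_linear_op_compose[OF ae_linear_op_sym_grad linear_stress] sigma_L2 by blast

lemma ae_linear_op_flux: "X \<subseteq> H10 \<Omega> \<Longrightarrow> ae_linear_op \<Omega> X flux"
  using ae_linear_op_compose[OF ae_linear_op_grad, where A="\<lambda>x. (*v) (K x)"] flux_L2 by blast

definition energy where
  "energy d \<mu> \<phi> = \<rho>\<^sub>0 / \<tau>\<^sup>2 * (L2_norm \<Omega> d)\<^sup>2 + Cmin * (L2_norm \<Omega> (sym_grad \<Omega> d))\<^sup>2
     + \<tau> * Kmin * (L2_norm \<Omega> (grad \<Omega> \<mu>))\<^sup>2 + (2 * \<beta> + M) * (L2_norm \<Omega> \<phi>)\<^sup>2"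

text \<open>
  The right-hand side is the form on the diagonal with \<open>(\<phi>, div d)\<close> replaced by \<open>(\<phi>, \<phi>)\<close>, as the homogeneous
  constraint permits.
\<close>

lemma energy_le:
  assumes d: "d \<in> H10_vec \<Omega>" and \<mu>: "\<mu> \<in> H10 \<Omega>" and \<phi>: "\<phi> \<in> L2 \<Omega>"
  shows "energy d \<mu> \<phi> \<le> op_A \<Omega> \<rho>\<^sub>0 \<tau> C \<beta> K M (d, \<mu>, \<phi>) (d, \<mu>, \<phi>)
      - 2 * \<beta> * (L2_inner \<Omega> \<phi> (divergence \<Omega> d) - L2_inner \<Omega> \<phi> \<phi>)"
proof -
  have "\<tau> * (Kmin * (L2_norm \<Omega> (grad \<Omega> \<mu>))\<^sup>2) \<le> \<tau> * L2_inner \<Omega> (flux \<mu>) (grad \<Omega> \<mu>)"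
    using pos \<mu> by (intro mult_left_mono K_coercive grad_L2 H10_H1) auto
  moreover have "Cmin * (L2_norm \<Omega> (sym_grad \<Omega> d))\<^sup>2 \<le> L2_inner \<Omega> (sigma d) (sym_grad \<Omega> d)"
    by (intro stress_coercive sym_grad_L2 transpose_sym_grad d)
  ultimately show ?thesis
    by (simp add: energy_def elastic_form L2_norm_power2 L2_inner_commute[of \<Omega> \<mu> \<phi>]
        L2_inner_commute[of \<Omega> "divergence \<Omega> d" \<phi>] algebra_simps)
qed

text \<open>
  The coefficient of \<open>\<phi>\<close> is positive even for \<open>M = 0\<close>, because of \<open>\<beta>\<close>; this is why solvability holds in
  that case too.
\<close>

lemma energy_definite:
  assumes d: "d \<in> H10_vec \<Omega>" and \<mu>: "\<mu> \<in> H10 \<Omega>" and \<phi>: "\<phi> \<in> L2 \<Omega>" and le: "energy d \<mu> \<phi> \<le> 0"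
  shows "ae_eq \<Omega> d (\<lambda>x. 0)" "ae_eq \<Omega> \<mu> (\<lambda>x. 0)" "ae_eq \<Omega> \<phi> (\<lambda>x. 0)"
proof -
  have c: "0 < \<rho>\<^sub>0 / \<tau>\<^sup>2" "0 < Cmin" "0 < \<tau> * Kmin" "0 < 2 * \<beta> + M"
    using pos hooke_pos K by (auto simp: permeability_def)
  then have nn: "0 \<le> \<rho>\<^sub>0 / \<tau>\<^sup>2 * (L2_norm \<Omega> d)\<^sup>2" "0 \<le> Cmin * (L2_norm \<Omega> (sym_grad \<Omega> d))\<^sup>2"
     "0 \<le> \<tau> * Kmin * (L2_norm \<Omega> (grad \<Omega> \<mu>))\<^sup>2" "0 \<le> (2 * \<beta> + M) * (L2_norm \<Omega> \<phi>)\<^sup>2"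
    using mult_nonneg_nonneg[OF less_imp_le[OF c(1)] zero_le_power2] mult_nonneg_nonneg[OF less_imp_le[OF c(2)] zero_le_power2]
      mult_nonneg_nonneg[OF less_imp_le[OF c(3)] zero_le_power2] mult_nonneg_nonneg[OF less_imp_le[OF c(4)] zero_le_power2]
    by blast+
  have "\<rho>\<^sub>0 / \<tau>\<^sup>2 * (L2_norm \<Omega> d)\<^sup>2 = 0" "\<tau> * Kmin * (L2_norm \<Omega> (grad \<Omega> \<mu>))\<^sup>2 = 0"
     "(2 * \<beta> + M) * (L2_norm \<Omega> \<phi>)\<^sup>2 = 0"
    using nn le unfolding energy_def by linarith+
  then have z: "L2_norm \<Omega> d = 0" "L2_norm \<Omega> (grad \<Omega> \<mu>) = 0" "L2_norm \<Omega> \<phi> = 0"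
    using c by auto
  obtain P where "\<And>u. u \<in> H10 \<Omega> \<Longrightarrow> L2_norm \<Omega> u \<le> P * L2_norm \<Omega> (grad \<Omega> u)"
    using poincare by blast
  from this[OF \<mu>] z(2) have "L2_norm \<Omega> \<mu> = 0" using L2_norm_nonneg[of \<Omega> \<mu>] by simp
  then show "ae_eq \<Omega> d (\<lambda>x. 0)" "ae_eq \<Omega> \<mu> (\<lambda>x. 0)" "ae_eq \<Omega> \<phi> (\<lambda>x. 0)"
    using z L2_norm_eq_0_iff H10_vec_L2[OF d] H1_L2[OF H10_H1[OF \<mu>]] \<phi> by blast+
qed

end

section \<open>The discrete problem\<close>

locale discrete_consolidation = consolidation \<Omega> \<rho>\<^sub>0 \<tau> \<beta> M Kmin Kmax Cmin Cmax K C
  for \<Omega> :: "(real ^ 'd) set" and \<rho>\<^sub>0 \<tau> \<beta> M Kmin Kmax Cmin Cmax K C +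
  fixes Vd :: "(real ^ 'd \<Rightarrow> real ^ 'd) set" and V\<mu> V\<phi> :: "(real ^ 'd \<Rightarrow> real) set"
    and f :: "real ^ 'd \<Rightarrow> real ^ 'd" and g p\<^sub>0 \<phi>\<^sub>0 :: "real ^ 'd \<Rightarrow> real"
  assumes Vd: "fin_dim_subspace \<Omega> (H10_vec \<Omega>) Vd" and V\<mu>: "fin_dim_subspace \<Omega> (H10 \<Omega>) V\<mu>"
    and V\<phi>: "fin_dim_subspace \<Omega> (L2 \<Omega>) V\<phi>"
    and data: "f \<in> L2 \<Omega>" "g \<in> L2 \<Omega>" "p\<^sub>0 \<in> L2 \<Omega>" "\<phi>\<^sub>0 \<in> L2 \<Omega>"
begin

abbreviation S where "S \<equiv> (Vd \<times> V\<mu> \<times> V\<phi>) \<times> V\<phi>"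

text \<open>
  The two equations of the saddle point problem added up; each of them is recovered by testing with a pair
  one of whose components is zero.
\<close>

definition form :: "'d triple \<times> (real ^ 'd \<Rightarrow> real) \<Rightarrow> 'd triple \<times> (real ^ 'd \<Rightarrow> real) \<Rightarrow> real" where
  "form s w = op_A \<Omega> \<rho>\<^sub>0 \<tau> C \<beta> K M (fst s) (fst w) + op_B \<Omega> (fst w) (snd s) + op_B \<Omega> (fst s) (snd w)"

fun load :: "'d triple \<times> (real ^ 'd \<Rightarrow> real) \<Rightarrow> real" where
  "load ((d, \<mu>, \<phi>), l) = L2_inner \<Omega> f d + \<tau> * L2_inner \<Omega> g \<mu> - L2_inner \<Omega> p\<^sub>0 \<phi> - L2_inner \<Omega> \<phi>\<^sub>0 l"

lemma spaces_lin_closed: "lin_closed Vd" "lin_closed V\<mu>" "lin_closed V\<phi>"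
  using Vd V\<mu> V\<phi> fin_dim_subspace_lin_closed by blast+

lemma subsets: "Vd \<subseteq> H10_vec \<Omega>" "V\<mu> \<subseteq> H10 \<Omega>" "V\<phi> \<subseteq> L2 \<Omega>" "Vd \<subseteq> L2 \<Omega>" "V\<mu> \<subseteq> L2 \<Omega>"
  using Vd V\<mu> V\<phi> H10_vec_L2 H1_L2 H10_H1 by (auto simp: fin_dim_subspace_def)

lemma zeros: "(\<lambda>x. 0) \<in> Vd" "(\<lambda>x. 0) \<in> V\<mu>" "(\<lambda>x. 0) \<in> V\<phi>"
  using spaces_lin_closed by (auto simp: lin_closed_def)

lemmas ae_linear_ops = ae_linear_op_id[OF subsets(4)] ae_linear_op_id[OF subsets(5)] ae_linear_op_id[OF subsets(3)]
  ae_linear_op_sym_grad[OF subsets(1)] ae_linear_op_divergence[OF subsets(1)] ae_linear_op_grad[OF subsets(2)]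
  ae_linear_op_sigma[OF subsets(1)] ae_linear_op_flux[OF subsets(2)]

lemmas L2_members = subsetD[OF subsets(3)] subsetD[OF subsets(4)] subsetD[OF subsets(5)]
  sym_grad_L2[OF subsetD[OF subsets(1)]] divergence_L2[OF subsetD[OF subsets(1)]]
  grad_L2[OF H10_H1[OF subsetD[OF subsets(2)]]] sigma_L2[OF subsetD[OF subsets(1)]] flux_L2[OF subsetD[OF subsets(2)]]

text \<open>
  The form splits into contributions of the four components of the trial function (\<open>L\<close>) and likewise of the
  test function (\<open>R\<close>). Each contribution is a linear functional of a single function.
\<close>

fun Ld :: "'d triple \<times> (real ^ 'd \<Rightarrow> real) \<Rightarrow> (real ^ 'd \<Rightarrow> real ^ 'd) \<Rightarrow> real" where
  "Ld ((d', \<mu>', \<phi>'), l') d = \<rho>\<^sub>0 / \<tau>\<^sup>2 * L2_inner \<Omega> d d' + L2_inner \<Omega> (sigma d) (sym_grad \<Omega> d')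
     + \<beta> * L2_inner \<Omega> (divergence \<Omega> d) \<phi>' + L2_inner \<Omega> l' (divergence \<Omega> d)"

fun L\<mu> :: "'d triple \<times> (real ^ 'd \<Rightarrow> real) \<Rightarrow> (real ^ 'd \<Rightarrow> real) \<Rightarrow> real" where
  "L\<mu> ((d', \<mu>', \<phi>'), l') \<mu> = \<tau> * L2_inner \<Omega> (flux \<mu>) (grad \<Omega> \<mu>') - L2_inner \<Omega> \<mu> \<phi>'"

fun L\<phi> :: "'d triple \<times> (real ^ 'd \<Rightarrow> real) \<Rightarrow> (real ^ 'd \<Rightarrow> real) \<Rightarrow> real" where
  "L\<phi> ((d', \<mu>', \<phi>'), l') \<phi> = \<beta> * L2_inner \<Omega> \<phi> (divergence \<Omega> d') + L2_inner \<Omega> \<phi> \<mu>'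
     + M * L2_inner \<Omega> \<phi> \<phi>' - L2_inner \<Omega> \<phi> l'"

fun Ll :: "'d triple \<times> (real ^ 'd \<Rightarrow> real) \<Rightarrow> (real ^ 'd \<Rightarrow> real) \<Rightarrow> real" where
  "Ll ((d', \<mu>', \<phi>'), l') l = L2_inner \<Omega> l (divergence \<Omega> d') - L2_inner \<Omega> \<phi>' l"

fun Rd :: "'d triple \<times> (real ^ 'd \<Rightarrow> real) \<Rightarrow> (real ^ 'd \<Rightarrow> real ^ 'd) \<Rightarrow> real" where
  "Rd ((d, \<mu>, \<phi>), l) d' = \<rho>\<^sub>0 / \<tau>\<^sup>2 * L2_inner \<Omega> d d' + L2_inner \<Omega> (sigma d) (sym_grad \<Omega> d')
     + \<beta> * L2_inner \<Omega> \<phi> (divergence \<Omega> d') + L2_inner \<Omega> l (divergence \<Omega> d')"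

fun R\<mu> :: "'d triple \<times> (real ^ 'd \<Rightarrow> real) \<Rightarrow> (real ^ 'd \<Rightarrow> real) \<Rightarrow> real" where
  "R\<mu> ((d, \<mu>, \<phi>), l) \<mu>' = \<tau> * L2_inner \<Omega> (flux \<mu>) (grad \<Omega> \<mu>') + L2_inner \<Omega> \<phi> \<mu>'"

fun R\<phi> :: "'d triple \<times> (real ^ 'd \<Rightarrow> real) \<Rightarrow> (real ^ 'd \<Rightarrow> real) \<Rightarrow> real" where
  "R\<phi> ((d, \<mu>, \<phi>), l) \<phi>' = \<beta> * L2_inner \<Omega> (divergence \<Omega> d) \<phi>' - L2_inner \<Omega> \<mu> \<phi>'
     + M * L2_inner \<Omega> \<phi> \<phi>' - L2_inner \<Omega> \<phi>' l"

fun Rl :: "'d triple \<times> (real ^ 'd \<Rightarrow> real) \<Rightarrow> (real ^ 'd \<Rightarrow> real) \<Rightarrow> real" where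
  "Rl ((d, \<mu>, \<phi>), l) l' = L2_inner \<Omega> l' (divergence \<Omega> d) - L2_inner \<Omega> \<phi> l'"

lemma form_left: "form ((d, \<mu>, \<phi>), l) w = Ld w d + L\<mu> w \<mu> + L\<phi> w \<phi> + Ll w l"
  by (cases w rule: load.cases) (simp add: form_def elastic_form)

lemma form_right: "form s ((d, \<mu>, \<phi>), l) = Rd s d + R\<mu> s \<mu> + R\<phi> s \<phi> + Rl s l"
  by (cases s rule: load.cases) (simp add: form_def elastic_form)

lemma ae_linear_left:
  assumes "w \<in> S"
  shows "ae_linear \<Omega> Vd (Ld w)" "ae_linear \<Omega> V\<mu> (L\<mu> w)" "ae_linear \<Omega> V\<phi> (L\<phi> w)" "ae_linear \<Omega> V\<phi> (Ll w)"
proof -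
  obtain d \<mu> \<phi> l where w: "w = ((d, \<mu>, \<phi>), l)" by (cases w rule: load.cases)
  have m: "d \<in> Vd" "\<mu> \<in> V\<mu>" "\<phi> \<in> V\<phi>" "l \<in> V\<phi>" using assms w by auto
  show "ae_linear \<Omega> Vd (Ld w)"
    unfolding w Ld.simps using m
    by (intro ae_linear_add ae_linear_cmult ae_linear_inner spaces_lin_closed ae_linear_ops L2_members)
  show "ae_linear \<Omega> V\<mu> (L\<mu> w)"
    unfolding w L\<mu>.simps using m
    by (intro ae_linear_diff ae_linear_cmult ae_linear_inner spaces_lin_closed ae_linear_ops L2_members)
  show "ae_linear \<Omega> V\<phi> (L\<phi> w)"
    unfolding w L\<phi>.simps using m
    by (intro ae_linear_add ae_linear_diff ae_linear_cmult ae_linear_inner spaces_lin_closed ae_linear_ops L2_members)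
  show "ae_linear \<Omega> V\<phi> (Ll w)"
    unfolding w Ll.simps using m
    by (intro ae_linear_diff ae_linear_cmult ae_linear_inner spaces_lin_closed ae_linear_ops L2_members)
qed

lemma ae_linear_right:
  assumes "s \<in> S"
  shows "ae_linear \<Omega> Vd (Rd s)" "ae_linear \<Omega> V\<mu> (R\<mu> s)" "ae_linear \<Omega> V\<phi> (R\<phi> s)" "ae_linear \<Omega> V\<phi> (Rl s)"
proof -
  obtain d \<mu> \<phi> l where s: "s = ((d, \<mu>, \<phi>), l)" by (cases s rule: load.cases)
  have m: "d \<in> Vd" "\<mu> \<in> V\<mu>" "\<phi> \<in> V\<phi>" "l \<in> V\<phi>" using assms s by auto
  show "ae_linear \<Omega> Vd (Rd s)"
    unfolding s Rd.simps using m
    by (intro ae_linear_add ae_linear_cmult ae_linear_inner spaces_lin_closed ae_linear_ops L2_members)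
  show "ae_linear \<Omega> V\<mu> (R\<mu> s)"
    unfolding s R\<mu>.simps using m
    by (intro ae_linear_add ae_linear_cmult ae_linear_inner spaces_lin_closed ae_linear_ops L2_members)
  show "ae_linear \<Omega> V\<phi> (R\<phi> s)"
    unfolding s R\<phi>.simps using m
    by (intro ae_linear_add ae_linear_diff ae_linear_cmult ae_linear_inner spaces_lin_closed ae_linear_ops L2_members)
  show "ae_linear \<Omega> V\<phi> (Rl s)"
    unfolding s Rl.simps using m
    by (intro ae_linear_diff ae_linear_cmult ae_linear_inner spaces_lin_closed ae_linear_ops L2_members)
qed

lemma ae_linear_load:
  "ae_linear \<Omega> Vd (\<lambda>d. L2_inner \<Omega> f d)" "ae_linear \<Omega> V\<mu> (\<lambda>\<mu>. L2_inner \<Omega> g \<mu>)"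
  "ae_linear \<Omega> V\<phi> (\<lambda>\<phi>. L2_inner \<Omega> p\<^sub>0 \<phi>)" "ae_linear \<Omega> V\<phi> (\<lambda>l. L2_inner \<Omega> \<phi>\<^sub>0 l)"
  by (intro ae_linear_inner spaces_lin_closed ae_linear_ops data)+

fun comb :: "real \<Rightarrow> 'd triple \<times> (real ^ 'd \<Rightarrow> real) \<Rightarrow> 'd triple \<times> (real ^ 'd \<Rightarrow> real) \<Rightarrow> 'd triple \<times> (real ^ 'd \<Rightarrow> real)" where
  "comb c ((d, \<mu>, \<phi>), l) ((d', \<mu>', \<phi>'), l') =
     ((\<lambda>x. d x + c *\<^sub>R d' x, \<lambda>x. \<mu> x + c *\<^sub>R \<mu>' x, \<lambda>x. \<phi> x + c *\<^sub>R \<phi>' x), \<lambda>x. l x + c *\<^sub>R l' x)"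

lemma comb_mem: "u \<in> S \<Longrightarrow> u' \<in> S \<Longrightarrow> comb c u u' \<in> S"
  using spaces_lin_closed by (cases "(c, u, u')" rule: comb.cases) (auto simp: lin_closed_def simp del: real_scaleR_def)

lemma form_comb_left: "u \<in> S \<Longrightarrow> u' \<in> S \<Longrightarrow> w \<in> S \<Longrightarrow> form (comb c u u') w = form u w + c * form u' w"
  by (cases "(c, u, u')" rule: comb.cases)
    (simp add: form_left ae_linear_comb[OF ae_linear_left(1) spaces_lin_closed(1)] ae_linear_comb[OF ae_linear_left(2) spaces_lin_closed(2)]
      ae_linear_comb[OF ae_linear_left(3) spaces_lin_closed(3)] ae_linear_comb[OF ae_linear_left(4) spaces_lin_closed(3)] algebra_simps
      del: real_scaleR_def Ld.simps L\<mu>.simps L\<phi>.simps Ll.simps)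

lemma form_comb_right: "w \<in> S \<Longrightarrow> w' \<in> S \<Longrightarrow> u \<in> S \<Longrightarrow> form u (comb c w w') = form u w + c * form u w'"
  by (cases "(c, w, w')" rule: comb.cases)
    (simp add: form_right ae_linear_comb[OF ae_linear_right(1) spaces_lin_closed(1)] ae_linear_comb[OF ae_linear_right(2) spaces_lin_closed(2)]
      ae_linear_comb[OF ae_linear_right(3) spaces_lin_closed(3)] ae_linear_comb[OF ae_linear_right(4) spaces_lin_closed(3)] algebra_simps
      del: real_scaleR_def Rd.simps R\<mu>.simps R\<phi>.simps Rl.simps)

lemma load_comb: "w \<in> S \<Longrightarrow> w' \<in> S \<Longrightarrow> load (comb c w w') = load w + c * load w'"
  by (cases "(c, w, w')" rule: comb.cases)
    (simp add: ae_linear_comb[OF ae_linear_load(1) spaces_lin_closed(1)] ae_linear_comb[OF ae_linear_load(2) spaces_lin_closed(2)]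
      ae_linear_comb[OF ae_linear_load(3) spaces_lin_closed(3)] ae_linear_comb[OF ae_linear_load(4) spaces_lin_closed(3)] algebra_simps
      del: real_scaleR_def)

lemma left_zero:
  assumes "w \<in> S"
  shows "Ld w (\<lambda>x. 0) = 0" "L\<mu> w (\<lambda>x. 0) = 0" "L\<phi> w (\<lambda>x. 0) = 0" "Ll w (\<lambda>x. 0) = 0"
  using assms by (auto intro!: ae_linear_zero ae_linear_left spaces_lin_closed)

lemma right_zero:
  assumes "s \<in> S"
  shows "Rd s (\<lambda>x. 0) = 0" "R\<mu> s (\<lambda>x. 0) = 0" "R\<phi> s (\<lambda>x. 0) = 0" "Rl s (\<lambda>x. 0) = 0"
  using assms by (auto intro!: ae_linear_zero ae_linear_right spaces_lin_closed)

lemma discrete_solution_iff: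
  "discrete_solution \<Omega> \<rho>\<^sub>0 \<tau> C \<beta> K M (Vd \<times> V\<mu> \<times> V\<phi>) V\<phi> f g p\<^sub>0 \<phi>\<^sub>0 s \<longleftrightarrow>
   s \<in> S \<and> (\<forall>w\<in>S. form s w = load w)" (is "?L \<longleftrightarrow> ?R")
proof
  assume ?L
  then show ?R by (auto simp: discrete_solution_def form_def)
next
  assume R: ?R
  have B0: "op_B \<Omega> v (\<lambda>x. 0) = 0" for v by (cases v) (simp add: L2_inner_def)
  have 1: "op_A \<Omega> \<rho>\<^sub>0 \<tau> C \<beta> K M (fst s) (d, \<mu>, \<phi>) + op_B \<Omega> (d, \<mu>, \<phi>) (snd s) =
        L2_inner \<Omega> f d + \<tau> * L2_inner \<Omega> g \<mu> - L2_inner \<Omega> p\<^sub>0 \<phi>"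
    if m: "d \<in> Vd" "\<mu> \<in> V\<mu>" "\<phi> \<in> V\<phi>" for d \<mu> \<phi>
  proof -
    have "((d, \<mu>, \<phi>), \<lambda>x. 0) \<in> S" using m zeros by simp
    with R have "form s ((d, \<mu>, \<phi>), \<lambda>x. 0) = load ((d, \<mu>, \<phi>), \<lambda>x. 0)" by blast
    then show ?thesis by (simp add: form_def B0 L2_inner_def)
  qed
  have 2: "op_B \<Omega> (fst s) l = - L2_inner \<Omega> \<phi>\<^sub>0 l" if l: "l \<in> V\<phi>" for l
  proof -
    have "((\<lambda>x. 0, \<lambda>x. 0, \<lambda>x. 0), l) \<in> S" using l zeros by simp
    with R have "form s ((\<lambda>x. 0, \<lambda>x. 0, \<lambda>x. 0), l) = load ((\<lambda>x. 0, \<lambda>x. 0, \<lambda>x. 0), l)" by blast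
    then show ?thesis using 1[OF zeros] by (simp add: form_def)
  qed
  show ?L using R 1 2 by (auto simp: discrete_solution_def)
qed

text \<open>
  The test function \<open>l = \<phi>\<close> in the constraint is admissible, since \<open>\<phi>\<close> and the multiplier range over the same
  space.
\<close>

lemma coercive_on_kernel:
  assumes m: "d \<in> Vd" "\<mu> \<in> V\<mu>" "\<phi> \<in> V\<phi>"
    and B0: "\<And>l. l \<in> V\<phi> \<Longrightarrow> op_B \<Omega> (d, \<mu>, \<phi>) l = 0"
    and A0: "op_A \<Omega> \<rho>\<^sub>0 \<tau> C \<beta> K M (d, \<mu>, \<phi>) (d, \<mu>, \<phi>) = 0"
  shows "ae_eq \<Omega> d (\<lambda>x. 0)" "ae_eq \<Omega> \<mu> (\<lambda>x. 0)" "ae_eq \<Omega> \<phi> (\<lambda>x. 0)"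
proof -
  have h: "d \<in> H10_vec \<Omega>" "\<mu> \<in> H10 \<Omega>" "\<phi> \<in> L2 \<Omega>" using m subsets by auto
  have "energy d \<mu> \<phi> \<le> 0"
    using energy_le[OF h] B0[OF m(3)] A0 by simp
  from energy_definite[OF h this]
  show "ae_eq \<Omega> d (\<lambda>x. 0)" "ae_eq \<Omega> \<mu> (\<lambda>x. 0)" "ae_eq \<Omega> \<phi> (\<lambda>x. 0)" .
qed

lemma multiplier_zero:
  assumes "l \<in> V\<phi>" "L2_inner \<Omega> l l = 0" shows "ae_eq \<Omega> l (\<lambda>x. 0)"
  using assms L2_norm_eq_0_iff[of l \<Omega>] subsets(3) by (auto simp: L2_norm_def)

text \<open>
  The first three components vanish by coercivity. Testing with the third component equal to \<open>l\<close> then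
  leaves \<open>(l, l) = 0\<close>.
\<close>

lemma left_kernel:
  assumes z: "((d, \<mu>, \<phi>), l) \<in> S" and form0: "\<And>w. w \<in> S \<Longrightarrow> form ((d, \<mu>, \<phi>), l) w = 0"
  shows "ae_eq \<Omega> d (\<lambda>x. 0)" "ae_eq \<Omega> \<mu> (\<lambda>x. 0)" "ae_eq \<Omega> \<phi> (\<lambda>x. 0)" "ae_eq \<Omega> l (\<lambda>x. 0)"
proof -
  note rz = right_zero[OF z]
  have B0: "op_B \<Omega> (d, \<mu>, \<phi>) l' = 0" if "l' \<in> V\<phi>" for l'
    using form0[of "((\<lambda>x. 0, \<lambda>x. 0, \<lambda>x. 0), l')"] that zeros rz by (simp add: form_right del: Rd.simps R\<mu>.simps R\<phi>.simps)
  have A0: "op_A \<Omega> \<rho>\<^sub>0 \<tau> C \<beta> K M (d, \<mu>, \<phi>) (d, \<mu>, \<phi>) = 0"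
    using form0[of "((d, \<mu>, \<phi>), l)"] z B0[of l] by (simp add: form_def)
  note v0 = coercive_on_kernel[OF _ _ _ B0 A0]
  show v: "ae_eq \<Omega> d (\<lambda>x. 0)" "ae_eq \<Omega> \<mu> (\<lambda>x. 0)" "ae_eq \<Omega> \<phi> (\<lambda>x. 0)"
    using v0 z by auto
  have m: "d \<in> Vd" "\<mu> \<in> V\<mu>" "\<phi> \<in> V\<phi>" "l \<in> V\<phi>" using z by auto
  have w: "((\<lambda>x. 0, \<lambda>x. 0, l), \<lambda>x. 0) \<in> S" using m zeros by simp
  have "Ll ((\<lambda>x. 0, \<lambda>x. 0, l), \<lambda>x. 0) l = 0"
    using form0[OF w] ae_linear_ae_zero[OF ae_linear_left(1)[OF w] spaces_lin_closed(1) m(1) v(1)]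
      ae_linear_ae_zero[OF ae_linear_left(2)[OF w] spaces_lin_closed(2) m(2) v(2)]
      ae_linear_ae_zero[OF ae_linear_left(3)[OF w] spaces_lin_closed(3) m(3) v(3)]
    by (simp add: form_left del: Ld.simps L\<mu>.simps L\<phi>.simps Ll.simps)
  moreover have "L2_inner \<Omega> l (divergence \<Omega> (\<lambda>x. 0)) = 0"
    by (rule ae_linear_zero[OF ae_linear_inner(2)[OF spaces_lin_closed(1) ae_linear_ops(5) L2_members(1)[OF m(4)]] spaces_lin_closed(1)])
  ultimately show "ae_eq \<Omega> l (\<lambda>x. 0)" using multiplier_zero[OF m(4)] by simp
qed

text \<open>
  The adjoint statement; the trial functions used are the ones used as test functions in \<open>left_kernel\<close>.
\<close>

lemma right_kernel:
  assumes z: "((d, \<mu>, \<phi>), l) \<in> S" and form0: "\<And>u. u \<in> S \<Longrightarrow> form u ((d, \<mu>, \<phi>), l) = 0"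
  shows "ae_eq \<Omega> d (\<lambda>x. 0)" "ae_eq \<Omega> \<mu> (\<lambda>x. 0)" "ae_eq \<Omega> \<phi> (\<lambda>x. 0)" "ae_eq \<Omega> l (\<lambda>x. 0)"
proof -
  note lz = left_zero[OF z]
  have B0: "op_B \<Omega> (d, \<mu>, \<phi>) l' = 0" if "l' \<in> V\<phi>" for l'
    using form0[of "((\<lambda>x. 0, \<lambda>x. 0, \<lambda>x. 0), l')"] that zeros lz by (simp add: form_left del: Ld.simps L\<mu>.simps L\<phi>.simps)
  have A0: "op_A \<Omega> \<rho>\<^sub>0 \<tau> C \<beta> K M (d, \<mu>, \<phi>) (d, \<mu>, \<phi>) = 0"
    using form0[of "((d, \<mu>, \<phi>), l)"] z B0[of l] by (simp add: form_def)
  note v0 = coercive_on_kernel[OF _ _ _ B0 A0]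
  show v: "ae_eq \<Omega> d (\<lambda>x. 0)" "ae_eq \<Omega> \<mu> (\<lambda>x. 0)" "ae_eq \<Omega> \<phi> (\<lambda>x. 0)"
    using v0 z by auto
  have m: "d \<in> Vd" "\<mu> \<in> V\<mu>" "\<phi> \<in> V\<phi>" "l \<in> V\<phi>" using z by auto
  have w: "((\<lambda>x. 0, \<lambda>x. 0, l), \<lambda>x. 0) \<in> S" using m zeros by simp
  have "Rl ((\<lambda>x. 0, \<lambda>x. 0, l), \<lambda>x. 0) l = 0"
    using form0[OF w] ae_linear_ae_zero[OF ae_linear_right(1)[OF w] spaces_lin_closed(1) m(1) v(1)]
      ae_linear_ae_zero[OF ae_linear_right(2)[OF w] spaces_lin_closed(2) m(2) v(2)]
      ae_linear_ae_zero[OF ae_linear_right(3)[OF w] spaces_lin_closed(3) m(3) v(3)]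
    by (simp add: form_right del: Rd.simps R\<mu>.simps R\<phi>.simps Rl.simps)
  moreover have "L2_inner \<Omega> l (divergence \<Omega> (\<lambda>x. 0)) = 0"
    by (rule ae_linear_zero[OF ae_linear_inner(2)[OF spaces_lin_closed(1) ae_linear_ops(5) L2_members(1)[OF m(4)]] spaces_lin_closed(1)])
  ultimately show "ae_eq \<Omega> l (\<lambda>x. 0)" using multiplier_zero[OF m(4)] by simp
qed

lemma galerkin_solution_exists: "\<exists>s\<in>S. \<forall>w\<in>S. form s w = load w"
proof -
  obtain Bd where Bd: "finite Bd" "Bd \<subseteq> Vd"
    "\<And>T u. ae_linear \<Omega> Vd T \<Longrightarrow> (\<And>b. b \<in> Bd \<Longrightarrow> T b = 0) \<Longrightarrow> u \<in> Vd \<Longrightarrow> T u = 0"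
    using fin_dim_subspace_spanned[OF Vd] by blast
  obtain B\<mu> where B\<mu>: "finite B\<mu>" "B\<mu> \<subseteq> V\<mu>"
    "\<And>T u. ae_linear \<Omega> V\<mu> T \<Longrightarrow> (\<And>b. b \<in> B\<mu> \<Longrightarrow> T b = 0) \<Longrightarrow> u \<in> V\<mu> \<Longrightarrow> T u = 0"
    using fin_dim_subspace_spanned[OF V\<mu>] by blast
  obtain B\<phi> where B\<phi>: "finite B\<phi>" "B\<phi> \<subseteq> V\<phi>"
    "\<And>T u. ae_linear \<Omega> V\<phi> T \<Longrightarrow> (\<And>b. b \<in> B\<phi> \<Longrightarrow> T b = 0) \<Longrightarrow> u \<in> V\<phi> \<Longrightarrow> T u = 0"
    using fin_dim_subspace_spanned[OF V\<phi>] by blast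
  let ?o = "\<lambda>x. 0"
  define id\<^sub>d where "id\<^sub>d b = (((b, ?o, ?o), ?o) :: 'd triple \<times> (real ^ 'd \<Rightarrow> real))" for b :: "real ^ 'd \<Rightarrow> real ^ 'd"
  define i\<mu> where "i\<mu> b = (((?o, b, ?o), ?o) :: 'd triple \<times> (real ^ 'd \<Rightarrow> real))" for b :: "real ^ 'd \<Rightarrow> real"
  define i\<phi> where "i\<phi> b = (((?o, ?o, b), ?o) :: 'd triple \<times> (real ^ 'd \<Rightarrow> real))" for b :: "real ^ 'd \<Rightarrow> real"
  define il where "il b = (((?o, ?o, ?o), b) :: 'd triple \<times> (real ^ 'd \<Rightarrow> real))" for b :: "real ^ 'd \<Rightarrow> real"
  note i = id\<^sub>d_def i\<mu>_def i\<phi>_def il_def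
  let ?B = "id\<^sub>d ` Bd \<union> i\<mu> ` B\<mu> \<union> i\<phi> ` B\<phi> \<union> il ` B\<phi>"
  show ?thesis
  proof (rule galerkin_solvable[where B="?B"])
    show "finite ?B" using Bd B\<mu> B\<phi> by simp
    show "?B \<subseteq> S" using Bd(2) B\<mu>(2) B\<phi>(2) zeros by (auto simp: i)
    show "\<forall>u\<in>S. form u w = 0" if w: "w \<in> S" and 0: "\<forall>b\<in>?B. form b w = 0" for w
    proof
      fix u assume "u \<in> S"
      then obtain d \<mu> \<phi> l where u: "u = ((d, \<mu>, \<phi>), l)" "d \<in> Vd" "\<mu> \<in> V\<mu>" "\<phi> \<in> V\<phi>" "l \<in> V\<phi>" by auto
      note lz = left_zero[OF w]
      have e: "Ld w b = form (id\<^sub>d b) w" "L\<mu> w b' = form (i\<mu> b') w" "L\<phi> w b' = form (i\<phi> b') w" "Ll w b' = form (il b') w" for b b'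
        using lz by (simp_all add: i form_left)
      have "Ld w d = 0" using 0 by (intro Bd(3)[OF ae_linear_left(1)[OF w] _ u(2)]) (simp add: e)
      moreover have "L\<mu> w \<mu> = 0" using 0 by (intro B\<mu>(3)[OF ae_linear_left(2)[OF w] _ u(3)]) (simp add: e)
      moreover have "L\<phi> w \<phi> = 0" using 0 by (intro B\<phi>(3)[OF ae_linear_left(3)[OF w] _ u(4)]) (simp add: e)
      moreover have "Ll w l = 0" using 0 by (intro B\<phi>(3)[OF ae_linear_left(4)[OF w] _ u(5)]) (simp add: e)
      ultimately      show "form u w = 0" by (simp add: u form_left)
    qed
    show "load w = 0" if w: "w \<in> S" and 0: "\<forall>u\<in>S. form u w = 0" for w
    proof -
      obtain d \<mu> \<phi> l where e: "w = ((d, \<mu>, \<phi>), l)" and m: "d \<in> Vd" "\<mu> \<in> V\<mu>" "\<phi> \<in> V\<phi>" "l \<in> V\<phi>" using w by auto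
      have "form u ((d, \<mu>, \<phi>), l) = 0" if "u \<in> S" for u
        using bspec[OF 0 that] unfolding e .
      note z = right_kernel[OF w[unfolded e] this]
      show ?thesis unfolding e
        using ae_linear_ae_zero[OF ae_linear_load(1) spaces_lin_closed(1) m(1) z(1)] ae_linear_ae_zero[OF ae_linear_load(2) spaces_lin_closed(2) m(2) z(2)]
          ae_linear_ae_zero[OF ae_linear_load(3) spaces_lin_closed(3) m(3) z(3)] ae_linear_ae_zero[OF ae_linear_load(4) spaces_lin_closed(3) m(4) z(4)]
        by simp
    qed
    show "\<exists>u\<in>S. \<forall>w\<in>S. form u w = 0"
    proof (intro bexI ballI)
      show "form ((?o, ?o, ?o), ?o) w = 0" if "w \<in> S" for w
        unfolding form_left left_zero[OF that] by simp
    qed (use zeros in simp)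
    show "\<exists>z\<in>S. \<forall>w\<in>S. form z w = form u w + c * form u' w" if "u \<in> S" "u' \<in> S" for u u' c
      by (intro bexI[OF _ comb_mem[OF that, of c]] ballI form_comb_left that)
    show "\<exists>z\<in>S. load z = load w + c * load w' \<and> (\<forall>u\<in>S. form u z = form u w + c * form u w')"
      if "w \<in> S" "w' \<in> S" for w w' c
      by (intro bexI[OF _ comb_mem[OF that, of c]] ballI conjI form_comb_right load_comb that)
  qed
qed

lemma galerkin_solution_unique:
  assumes s: "s \<in> S" "\<And>w. w \<in> S \<Longrightarrow> form s w = load w" and s': "s' \<in> S" "\<And>w. w \<in> S \<Longrightarrow> form s' w = load w"
  shows "VQ_eq \<Omega> s' s"
proof -
  obtain d \<mu> \<phi> l d' \<mu>' \<phi>' l' where e: "s = ((d, \<mu>, \<phi>), l)" "s' = ((d', \<mu>', \<phi>'), l')"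
    by (metis prod.exhaust)
  have 0: "form (comb (- 1) s' s) w = 0" if "w \<in> S" for w
    using form_comb_left[OF s'(1) s(1) that] s s' that by simp
  have "comb (- 1) s' s \<in> S" by (rule comb_mem[OF s'(1) s(1)])
  note k = left_kernel[OF this[unfolded e comb.simps] 0[unfolded e comb.simps]]
  have diff: "ae_eq \<Omega> u v" if "ae_eq \<Omega> (\<lambda>x. u x + (- 1) *\<^sub>R v x) (\<lambda>x. 0)"
    for u v :: "real ^ 'd \<Rightarrow> 'z::real_vector"
    using that unfolding ae_eq_def by eventually_elim simp
  show ?thesis unfolding e VQ_eq.simps using k[THEN diff] by blast
qed

text \<open>
  The first equation is tested with the solution itself and with \<open>(0, 0, l)\<close>, the constraint with \<open>\<phi>\<close>
  and with \<open>l\<close>. What remains is the Cauchy-Schwarz inequality and \<open>a_priori_arithmetic\<close>.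
\<close>

lemma a_priori_bound:
  assumes s: "s \<in> S" "\<And>w. w \<in> S \<Longrightarrow> form s w = load w" and "M > 0"
    and P: "P > 0" "\<And>u. u \<in> H10 \<Omega> \<Longrightarrow> L2_norm \<Omega> u \<le> P * L2_norm \<Omega> (grad \<Omega> u)"
    and \<kappa>: "0 < \<kappa>" "\<kappa> \<le> 1 / 2" "\<kappa> * (1 + P\<^sup>2) \<le> 1"
    and \<alpha>: "\<alpha>\<^sub>0 = alpha0 \<rho>\<^sub>0 \<tau> Cmin \<beta> Kmin M" "\<alpha>\<^sub>1 = alpha1 \<rho>\<^sub>0 \<tau> Cmax \<beta> Kmax M"
  shows "VQ_norm \<Omega> s \<le> 20 / \<kappa> * Max {1 / \<alpha>\<^sub>0, 2 * sqrt \<alpha>\<^sub>1 / sqrt \<alpha>\<^sub>0, \<alpha>\<^sub>1} *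
     (L2_norm \<Omega> f + \<tau> * L2_norm \<Omega> g + L2_norm \<Omega> p\<^sub>0 + L2_norm \<Omega> \<phi>\<^sub>0)"
proof -
  obtain d \<mu> \<phi> l where e: "s = ((d, \<mu>, \<phi>), l)" and m: "d \<in> Vd" "\<mu> \<in> V\<mu>" "\<phi> \<in> V\<phi>" "l \<in> V\<phi>"
    using s(1) by auto
  have h: "d \<in> H10_vec \<Omega>" "\<mu> \<in> H10 \<Omega>" "\<phi> \<in> L2 \<Omega>" "l \<in> L2 \<Omega>" "d \<in> L2 \<Omega>" "\<mu> \<in> L2 \<Omega>"
    using m subsets by auto
  note CS = L2_Cauchy_Schwarz
  have S: "s \<in> S" by (rule s(1))
  note rz = right_zero[OF S]
  have con: "L2_inner \<Omega> l' (divergence \<Omega> d) - L2_inner \<Omega> \<phi> l' = - L2_inner \<Omega> \<phi>\<^sub>0 l'" if "l' \<in> V\<phi>" for l'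
  proof -
    have "form s ((\<lambda>x. 0, \<lambda>x. 0, \<lambda>x. 0), l') = load ((\<lambda>x. 0, \<lambda>x. 0, \<lambda>x. 0), l')"
      using that zeros by (intro s(2)) simp
    then have "Rl s l' = - L2_inner \<Omega> \<phi>\<^sub>0 l'"
      using rz by (simp add: form_right L2_inner_def del: Rd.simps R\<mu>.simps R\<phi>.simps Rl.simps)
    then show ?thesis by (simp add: e)
  qed
  have mom: "op_A \<Omega> \<rho>\<^sub>0 \<tau> C \<beta> K M (d, \<mu>, \<phi>) (d, \<mu>, \<phi>) - L2_inner \<Omega> \<phi>\<^sub>0 l =
      L2_inner \<Omega> f d + \<tau> * L2_inner \<Omega> g \<mu> - L2_inner \<Omega> p\<^sub>0 \<phi>"
    using s(2)[OF S] con[OF m(4)] by (simp add: e form_def)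
  have mult: "\<beta> * L2_inner \<Omega> (divergence \<Omega> d) l - L2_inner \<Omega> \<mu> l + M * L2_inner \<Omega> \<phi> l - L2_inner \<Omega> l l = - L2_inner \<Omega> p\<^sub>0 l"
  proof -
    have "form s ((\<lambda>x. 0, \<lambda>x. 0, l), \<lambda>x. 0) = load ((\<lambda>x. 0, \<lambda>x. 0, l), \<lambda>x. 0)"
      using m zeros by (intro s(2)) simp
    then have "R\<phi> s l = - L2_inner \<Omega> p\<^sub>0 l"
      using rz by (simp add: form_right L2_inner_def del: Rd.simps R\<mu>.simps R\<phi>.simps Rl.simps)
    then show ?thesis by (simp add: e)
  qed
  have Kpos: "0 < Kmin" "Kmin \<le> Kmax" using K by (auto simp: permeability_def)
  have a: "\<alpha>\<^sub>0 > 0" "\<alpha>\<^sub>0 \<le> \<rho>\<^sub>0 / \<tau>\<^sup>2" "\<alpha>\<^sub>0 \<le> Cmin" "\<alpha>\<^sub>0 \<le> 2 * \<beta>" "\<alpha>\<^sub>0 \<le> \<tau> * Kmin" "\<alpha>\<^sub>0 \<le> M"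
    using pos hooke_pos Kpos \<open>M > 0\<close> by (auto simp: \<alpha> alpha0_def)
  have b: "2 * \<beta> \<le> \<alpha>\<^sub>1" "M \<le> \<alpha>\<^sub>1" by (auto simp: \<alpha> alpha1_def)
  have "sqrt ((L2_norm \<Omega> d)\<^sup>2 + (L2_norm \<Omega> (grad_vec \<Omega> d))\<^sup>2 + ((L2_norm \<Omega> \<mu>)\<^sup>2 + (L2_norm \<Omega> (grad \<Omega> \<mu>))\<^sup>2)
      + (L2_norm \<Omega> \<phi>)\<^sup>2 + (L2_norm \<Omega> l)\<^sup>2)
    \<le> 20 / \<kappa> * Max {1 / \<alpha>\<^sub>0, 2 * sqrt \<alpha>\<^sub>1 / sqrt \<alpha>\<^sub>0, \<alpha>\<^sub>1} *
     (L2_norm \<Omega> f + \<tau> * L2_norm \<Omega> g + L2_norm \<Omega> p\<^sub>0 + L2_norm \<Omega> \<phi>\<^sub>0)"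
  proof (rule a_priori_arithmetic[OF a b P(1) P(2)[OF h(2)] korn[OF h(1)]])
    have "energy d \<mu> \<phi> \<le> L2_inner \<Omega> f d + \<tau> * L2_inner \<Omega> g \<mu> - L2_inner \<Omega> p\<^sub>0 \<phi> + L2_inner \<Omega> \<phi>\<^sub>0 l
        + 2 * \<beta> * L2_inner \<Omega> \<phi>\<^sub>0 \<phi>"
      using energy_le[OF h(1-3)] mom con[OF m(3)] by simp
    also have "\<dots> \<le> L2_norm \<Omega> f * L2_norm \<Omega> d + \<tau> * (L2_norm \<Omega> g * L2_norm \<Omega> \<mu>) + L2_norm \<Omega> p\<^sub>0 * L2_norm \<Omega> \<phi>
        + L2_norm \<Omega> \<phi>\<^sub>0 * L2_norm \<Omega> l + 2 * \<beta> * (L2_norm \<Omega> \<phi>\<^sub>0 * L2_norm \<Omega> \<phi>)"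
    proof -
      have "\<tau> * L2_inner \<Omega> g \<mu> \<le> \<tau> * (L2_norm \<Omega> g * L2_norm \<Omega> \<mu>)"
        using CS[OF data(2) h(6)] pos by (intro mult_left_mono) auto
      moreover have "2 * \<beta> * L2_inner \<Omega> \<phi>\<^sub>0 \<phi> \<le> 2 * \<beta> * (L2_norm \<Omega> \<phi>\<^sub>0 * L2_norm \<Omega> \<phi>)"
        using CS[OF data(4) h(3)] pos by (intro mult_left_mono) auto
      ultimately show ?thesis
        using CS[OF data(1) h(5)] CS[OF data(3) h(3)] CS[OF data(4) h(4)] by linarith
    qed
    finally show "\<rho>\<^sub>0 / \<tau>\<^sup>2 * (L2_norm \<Omega> d)\<^sup>2 + Cmin * (L2_norm \<Omega> (sym_grad \<Omega> d))\<^sup>2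
        + \<tau> * Kmin * (L2_norm \<Omega> (grad \<Omega> \<mu>))\<^sup>2 + (2 * \<beta> + M) * (L2_norm \<Omega> \<phi>)\<^sup>2
      \<le> L2_norm \<Omega> f * L2_norm \<Omega> d + \<tau> * L2_norm \<Omega> g * L2_norm \<Omega> \<mu> + L2_norm \<Omega> p\<^sub>0 * L2_norm \<Omega> \<phi>
        + 2 * \<beta> * (L2_norm \<Omega> \<phi>\<^sub>0 * L2_norm \<Omega> \<phi>) + L2_norm \<Omega> \<phi>\<^sub>0 * L2_norm \<Omega> l"
      unfolding energy_def by (simp add: mult.assoc)
    have "L2_inner \<Omega> l l = (\<beta> + M) * L2_inner \<Omega> \<phi> l - \<beta> * L2_inner \<Omega> \<phi>\<^sub>0 l - L2_inner \<Omega> \<mu> l + L2_inner \<Omega> p\<^sub>0 l"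
    proof -
      have "L2_inner \<Omega> (divergence \<Omega> d) l = L2_inner \<Omega> \<phi> l - L2_inner \<Omega> \<phi>\<^sub>0 l"
        using con[OF m(4)] by (simp add: L2_inner_commute[of \<Omega> l])
      from mult[unfolded this] show ?thesis by (simp add: algebra_simps)
    qed
    also have "\<dots> \<le> (\<beta> + M) * (L2_norm \<Omega> \<phi> * L2_norm \<Omega> l) + \<beta> * (L2_norm \<Omega> \<phi>\<^sub>0 * L2_norm \<Omega> l)
        + L2_norm \<Omega> \<mu> * L2_norm \<Omega> l + L2_norm \<Omega> p\<^sub>0 * L2_norm \<Omega> l"
    proof -
      have "(\<beta> + M) * L2_inner \<Omega> \<phi> l \<le> (\<beta> + M) * (L2_norm \<Omega> \<phi> * L2_norm \<Omega> l)"
        using CS[OF h(3,4)] pos by (intro mult_left_mono) auto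
      moreover have "\<beta> * (- L2_inner \<Omega> \<phi>\<^sub>0 l) \<le> \<beta> * (L2_norm \<Omega> \<phi>\<^sub>0 * L2_norm \<Omega> l)"
        using CS[OF data(4) h(4)] pos by (intro mult_left_mono) auto
      ultimately show ?thesis
        using CS[OF h(6,4)] CS[OF data(3) h(4)] by linarith
    qed
    finally show "(L2_norm \<Omega> l)\<^sup>2 \<le> (\<beta> + M) * (L2_norm \<Omega> \<phi> * L2_norm \<Omega> l) + \<beta> * (L2_norm \<Omega> \<phi>\<^sub>0 * L2_norm \<Omega> l)
        + L2_norm \<Omega> \<mu> * L2_norm \<Omega> l + L2_norm \<Omega> p\<^sub>0 * L2_norm \<Omega> l"
      by (simp add: L2_norm_power2)
  qed (use \<kappa> pos in \<open>auto simp: L2_norm_nonneg\<close>)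
  moreover have "VQ_norm \<Omega> s = sqrt ((L2_norm \<Omega> d)\<^sup>2 + (L2_norm \<Omega> (grad_vec \<Omega> d))\<^sup>2
      + ((L2_norm \<Omega> \<mu>)\<^sup>2 + (L2_norm \<Omega> (grad \<Omega> \<mu>))\<^sup>2) + (L2_norm \<Omega> \<phi>)\<^sup>2 + (L2_norm \<Omega> l)\<^sup>2)"
    by (simp add: e H1_norm_vec_def H1_norm_def sum_power2_ge_zero add_nonneg_nonneg)
  ultimately show ?thesis by simp
qed

end

theorem theorem3p3:
  fixes \<Omega> :: "(real ^ 'd) set"
  assumes "CARD('d) \<in> {2, 3}"
    and "bounded_lipschitz_domain \<Omega>"
  shows "\<exists>const > 0.
    \<forall>(\<rho>\<^sub>0 :: real) (\<tau> :: real) (\<beta> :: real) (M :: real)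
      (K :: real ^ 'd \<Rightarrow> real ^ 'd ^ 'd) (Kmin :: real) (Kmax :: real)
      (C :: real ^ 'd \<Rightarrow> real ^ 'd ^ 'd ^ 'd ^ 'd) (Cmin :: real) (Cmax :: real)
      (Vd :: (real ^ 'd \<Rightarrow> real ^ 'd) set) (V\<mu> :: (real ^ 'd \<Rightarrow> real) set)
      (V\<phi> :: (real ^ 'd \<Rightarrow> real) set) (Vl :: (real ^ 'd \<Rightarrow> real) set)
      (N :: nat) (f :: nat \<Rightarrow> real ^ 'd \<Rightarrow> real ^ 'd) (g :: nat \<Rightarrow> real ^ 'd \<Rightarrow> real)
      (p\<^sub>0 :: real ^ 'd \<Rightarrow> real) (\<phi>\<^sub>0 :: real ^ 'd \<Rightarrow> real).
      \<rho>\<^sub>0 > 0 \<and> \<tau> > 0 \<and> \<beta> > 0 \<and> M \<ge> 0 \<and>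
      permeability \<Omega> K Kmin Kmax \<and> hooke_tensor \<Omega> C Cmin Cmax \<and>
      fin_dim_subspace \<Omega> (H10_vec \<Omega>) Vd \<and> fin_dim_subspace \<Omega> (H10 \<Omega>) V\<mu> \<and>
      fin_dim_subspace \<Omega> (L2 \<Omega>) V\<phi> \<and> fin_dim_subspace \<Omega> (L2 \<Omega>) Vl \<and>
      V\<phi> = Vl \<and>
      (\<forall>n \<in> {1..N}. f n \<in> L2 \<Omega> \<and> g n \<in> L2 \<Omega>) \<and> p\<^sub>0 \<in> L2 \<Omega> \<and> \<phi>\<^sub>0 \<in> L2 \<Omega>
      \<longrightarrow>
      (\<forall>n \<in> {1..N}. \<exists>s.
         discrete_solution \<Omega> \<rho>\<^sub>0 \<tau> C \<beta> K M (Vd \<times> V\<mu> \<times> V\<phi>) Vl (f n) (g n) p\<^sub>0 \<phi>\<^sub>0 s \<and>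
         (\<forall>s'. discrete_solution \<Omega> \<rho>\<^sub>0 \<tau> C \<beta> K M (Vd \<times> V\<mu> \<times> V\<phi>) Vl (f n) (g n) p\<^sub>0 \<phi>\<^sub>0 s'
               \<longrightarrow> VQ_eq \<Omega> s' s) \<and>
         (M > 0 \<longrightarrow>
            (let \<alpha>\<^sub>0 = alpha0 \<rho>\<^sub>0 \<tau> Cmin \<beta> Kmin M; \<alpha>\<^sub>1 = alpha1 \<rho>\<^sub>0 \<tau> Cmax \<beta> Kmax M in
             VQ_norm \<Omega> s \<le>
               const * Max {1 / \<alpha>\<^sub>0, 2 * sqrt \<alpha>\<^sub>1 / sqrt \<alpha>\<^sub>0, \<alpha>\<^sub>1} *
               (L2_norm \<Omega> (f n) + \<tau> * L2_norm \<Omega> (g n) + L2_norm \<Omega> p\<^sub>0 + L2_norm \<Omega> \<phi>\<^sub>0))))"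
proof -
  interpret bounded_open \<Omega>
    using assms(2) by unfold_locales (auto simp: bounded_lipschitz_domain_def)
  obtain P where P: "P > 0" "\<And>u. u \<in> H10 \<Omega> \<Longrightarrow> L2_norm \<Omega> u \<le> P * L2_norm \<Omega> (grad \<Omega> u)"
    using poincare by blast
  \<comment> \<open>\<open>1 / 2\<close> accounts for the constant in Korn's inequality, the other entry for the one in Poincare's\<close>
  define \<kappa> where "\<kappa> = min (1 / 2) (1 / (1 + P\<^sup>2))"
  have "0 < 1 + P\<^sup>2" using P(1) by (simp add: add_pos_pos)
  then have \<kappa>: "0 < \<kappa>" "\<kappa> \<le> 1 / 2" "\<kappa> * (1 + P\<^sup>2) \<le> 1"
    by (auto simp: \<kappa>_def min_def field_simps)
  show ?thesis
  proof (rule exI[of _ "20 / \<kappa>"], intro conjI allI impI ballI, goal_cases)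
    case 1
    then show ?case using \<kappa> by simp
  next
    case (2 \<rho>\<^sub>0 \<tau> \<beta> M K Kmin Kmax C Cmin Cmax Vd V\<mu> V\<phi> Vl N f g p\<^sub>0 \<phi>\<^sub>0 n)
    then interpret discrete_consolidation \<Omega> \<rho>\<^sub>0 \<tau> \<beta> M Kmin Kmax Cmin Cmax K C Vd V\<mu> V\<phi> "f n" "g n" p\<^sub>0 \<phi>\<^sub>0
      by unfold_locales auto
    have Vl: "Vl = V\<phi>" using 2 by simp
    obtain s where s: "s \<in> (Vd \<times> V\<mu> \<times> V\<phi>) \<times> V\<phi>" "\<And>w. w \<in> (Vd \<times> V\<mu> \<times> V\<phi>) \<times> V\<phi> \<Longrightarrow> form s w = load w"
      using galerkin_solution_exists by blast
    show ?case
      unfolding Vl Let_def discrete_solution_iff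
    proof (intro exI[of _ s] conjI allI impI ballI)
      fix s' assume s': "s' \<in> (Vd \<times> V\<mu> \<times> V\<phi>) \<times> V\<phi> \<and> (\<forall>w\<in>(Vd \<times> V\<mu> \<times> V\<phi>) \<times> V\<phi>. form s' w = load w)"
      show "VQ_eq \<Omega> s' s"
        by (rule galerkin_solution_unique[OF s conjunct1[OF s'] bspec[OF conjunct2[OF s']]])
    next
      assume "M > 0"
      show "VQ_norm \<Omega> s \<le> 20 / \<kappa> *
          Max {1 / alpha0 \<rho>\<^sub>0 \<tau> Cmin \<beta> Kmin M,
            2 * sqrt (alpha1 \<rho>\<^sub>0 \<tau> Cmax \<beta> Kmax M) / sqrt (alpha0 \<rho>\<^sub>0 \<tau> Cmin \<beta> Kmin M),
            alpha1 \<rho>\<^sub>0 \<tau> Cmax \<beta> Kmax M} *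
          (L2_norm \<Omega> (f n) + \<tau> * L2_norm \<Omega> (g n) + L2_norm \<Omega> p\<^sub>0 + L2_norm \<Omega> \<phi>\<^sub>0)"
        by (rule a_priori_bound[OF s \<open>M > 0\<close> P \<kappa> refl refl])
    qed (fact s)+
  qed
qed

end
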